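(* Let $X_1,X_2,\dots$ be i.i.d. with a monotone decreasing probability mass function $p$ on $\mathbb N$, and let $Y=(Y_x)_{x\in\mathbb N}$ be the mean-zero Gaussian process in $\ell_2$ with $\mathrm{cov}(Y_x,Y_{x'})=p_x\delta_{x,x'}-p_xp_{x'}$. Define processes $Y^R$ and $Y^G$ as the following transforms of $Y$: for every period of constancy of $p$, i.e. for all $r,s\in\mathbb N$ with $s-r\ge1$ and $p_{r-1}>p_r=\dots=p_s>p_{s+1}$ (convention $p_{-1}=+\infty$), let $$(Y^R)^{(r,s)}=\mathrm{rear}(Y^{(r,s)}),\qquad(Y^G)^{(r,s)}=\mathrm{gren}(Y^{(r,s)}),$$ and let $Y^R_x=Y^G_x=Y_x$ for every $x$ not belonging to any such period of constancy. Then, as $n\to\infty$, $Y_n^R\Rightarrow Y^R$ and $Y_n^G\Rightarrow Y^G$ in $\ell_2$.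
   Context: $\mathbb N=\{0,1,2,\dots\}$. $p$ is monotone decreasing if $p_x\ge p_{x+1}$ for all $x\in\mathbb N$. The empirical estimator is $\widehat p_{n,x}=n^{-1}\#\{i\le n:X_i=x\}$. For a finite vector $w=(w_0,\dots,w_k)$, $\mathrm{rear}(w)$ is the vector of entries of $w$ sorted in nonincreasing order, and $\mathrm{gren}(w)$ is the vector of the $k+1$ left slopes, at $j=0,\dots,k$, of the least concave majorant of the points $\{(j,\sum_{i=0}^jw_i):j=-1,0,\dots,k\}$ (empty sum $=0$). For a vector indexed by $r,\dots,s$ these are defined in the same way after shifting indices, the result again being indexed by $r,\dots,s$. The rearrangement estimator is $\widehat p_n^R=\mathrm{rear}(\widehat p_n)$ and the Grenander estimator (MLE) is $\widehat p_n^G=\mathrm{gren}(\widehat p_n)$; both operators are applied to the finite vector $(\widehat p_{n,x})_{0\le x\le\max_{i\le n}X_i}$, and the results are extended by $0$ to $\mathbb N$. Fluctuation processes: $Y_{n,x}^R=\sqrt n(\widehat p_{n,x}^R-p_x)$, $Y_{n,x}^G=\sqrt n(\widehat p_{n,x}^G-p_x)$. For a sequence $v$, $v^{(r,s)}=(v_r,\dots,v_s)$. $\Rightarrow$ denotes weak convergence of random elements of $\ell_2$. (If $p$ has finite support then $Y_x=0$ a.s. outside the support.) *)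

theory Defs
  imports "HOL-Probability.Probability"
begin

subsection \<open>The Hilbert space of square-summable real sequences\<close>

definition square_summable :: "(nat \<Rightarrow> real) \<Rightarrow> bool" where
  "square_summable f \<longleftrightarrow> summable (\<lambda>x. (f x)\<^sup>2)"

typedef ell2 = "{f. square_summable f}"
  by (rule exI[of _ "\<lambda>_. 0"]) (simp add: square_summable_def)

lemma square_summable_Rep: "square_summable (Rep_ell2 f)"
  using Rep_ell2[of f] by simp

lemma Rep_Abs_ell2: "square_summable f \<Longrightarrow> Rep_ell2 (Abs_ell2 f) = f"
  by (simp add: Abs_ell2_inverse)

lemma ell2_eqI: "(\<And>x. Rep_ell2 f x = Rep_ell2 g x) \<Longrightarrow> f = g"
  by (metis Rep_ell2_inject ext)

lemma square_summable_add:
  assumes "square_summable f" "square_summable g"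
  shows "square_summable (\<lambda>x. f x + g x)"
  unfolding square_summable_def
proof (rule summable_comparison_test')
  show "summable (\<lambda>x. 2 * (f x)\<^sup>2 + 2 * (g x)\<^sup>2)"
    using assms unfolding square_summable_def by (intro summable_add summable_mult)
  fix n :: nat
  have "(f n + g n)\<^sup>2 + (f n - g n)\<^sup>2 = 2 * (f n)\<^sup>2 + 2 * (g n)\<^sup>2"
    by (simp add: power2_eq_square algebra_simps)
  then show "norm ((f n + g n)\<^sup>2) \<le> 2 * (f n)\<^sup>2 + 2 * (g n)\<^sup>2"
    using zero_le_power2[of "f n - g n"] unfolding real_norm_def abs_power2 by linarith
qed

lemma square_summable_scale:
  assumes "square_summable f"
  shows "square_summable (\<lambda>x. c * f x)"
  using assms unfolding square_summable_def by (simp add: power_mult_distrib summable_mult)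

lemma square_summable_prod:
  assumes "square_summable f" "square_summable g"
  shows "summable (\<lambda>x. f x * g x)"
proof (rule summable_comparison_test')
  show "summable (\<lambda>x. (f x)\<^sup>2 + (g x)\<^sup>2)"
    using assms unfolding square_summable_def by (intro summable_add)
  fix n :: nat
  have "2 * (\<bar>f n\<bar> * \<bar>g n\<bar>) \<le> (f n)\<^sup>2 + (g n)\<^sup>2"
    using sum_squares_bound[of "\<bar>f n\<bar>" "\<bar>g n\<bar>"] by simp
  moreover have "0 \<le> \<bar>f n\<bar> * \<bar>g n\<bar>" by simp
  ultimately show "norm (f n * g n) \<le> (f n)\<^sup>2 + (g n)\<^sup>2"
    unfolding real_norm_def abs_mult by linarith
qed

instantiation ell2 :: real_inner
begin

definition "0 = Abs_ell2 (\<lambda>_. 0)"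
definition "f + g = Abs_ell2 (\<lambda>x. Rep_ell2 f x + Rep_ell2 g x)"
definition "- f = Abs_ell2 (\<lambda>x. - Rep_ell2 f x)"
definition "f - g = f + (- g)" for f g :: ell2
definition "c *\<^sub>R f = Abs_ell2 (\<lambda>x. c * Rep_ell2 f x)"
definition "inner f g = (\<Sum>x. Rep_ell2 f x * Rep_ell2 g x)"
definition "norm f = sqrt (inner f f)" for f :: ell2
definition "dist f g = norm (f - g)" for f g :: ell2
definition "sgn f = inverse (norm f) *\<^sub>R f" for f :: ell2
definition [code del]:
  "(uniformity :: (ell2 \<times> ell2) filter) = (INF e\<in>{0<..}. principal {(x, y). dist x y < e})"
definition [code del]:
  "open (U :: ell2 set) \<longleftrightarrow> (\<forall>x\<in>U. eventually (\<lambda>(x', y). x' = x \<longrightarrow> y \<in> U) uniformity)"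

lemma Rep_ell2_zero: "Rep_ell2 0 x = 0"
  by (simp add: zero_ell2_def Rep_Abs_ell2 square_summable_def)

lemma Rep_ell2_add: "Rep_ell2 (f + g) x = Rep_ell2 f x + Rep_ell2 g x"
  by (simp add: plus_ell2_def Rep_Abs_ell2 square_summable_add square_summable_Rep)

lemma Rep_ell2_uminus: "Rep_ell2 (- f) x = - Rep_ell2 f x"
  using square_summable_Rep[of f]
  by (simp add: uminus_ell2_def Rep_Abs_ell2 square_summable_def)

lemma Rep_ell2_scaleR: "Rep_ell2 (c *\<^sub>R f) x = c * Rep_ell2 f x"
  by (simp add: scaleR_ell2_def Rep_Abs_ell2 square_summable_scale square_summable_Rep)

lemmas Rep_ell2_simps = Rep_ell2_zero Rep_ell2_add Rep_ell2_uminus Rep_ell2_scaleR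

instance
proof
  fix f g h :: ell2 and a b c :: real
  have summ: "summable (\<lambda>x. Rep_ell2 f x * Rep_ell2 g x)" for f g
    by (intro square_summable_prod square_summable_Rep)
  show "f + g + h = f + (g + h)" by (rule ell2_eqI) (simp add: Rep_ell2_simps)
  show "f + g = g + f" by (rule ell2_eqI) (simp add: Rep_ell2_simps)
  show "0 + f = f" by (rule ell2_eqI) (simp add: Rep_ell2_simps)
  show "- f + f = 0" by (rule ell2_eqI) (simp add: Rep_ell2_simps)
  show "f - g = f + - g" by (simp add: minus_ell2_def)
  show "c *\<^sub>R (f + g) = c *\<^sub>R f + c *\<^sub>R g"
    by (rule ell2_eqI) (simp add: Rep_ell2_simps algebra_simps)
  show "(a + b) *\<^sub>R f = a *\<^sub>R f + b *\<^sub>R f"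
    by (rule ell2_eqI) (simp add: Rep_ell2_simps algebra_simps)
  show "a *\<^sub>R b *\<^sub>R f = (a * b) *\<^sub>R f" by (rule ell2_eqI) (simp add: Rep_ell2_simps)
  show "1 *\<^sub>R f = f" by (rule ell2_eqI) (simp add: Rep_ell2_simps)
  show "dist f g = norm (f - g)" by (simp add: dist_ell2_def)
  show "sgn f = inverse (norm f) *\<^sub>R f" by (simp add: sgn_ell2_def)
  show "(uniformity :: (ell2 \<times> ell2) filter) = (INF e\<in>{0<..}. principal {(x, y). dist x y < e})"
    by (rule uniformity_ell2_def)
  show "open U \<longleftrightarrow> (\<forall>x\<in>U. eventually (\<lambda>(x', y). x' = x \<longrightarrow> y \<in> U) uniformity)" for U :: "ell2 set"
    by (rule open_ell2_def)
  show "inner f g = inner g f" by (simp add: inner_ell2_def mult.commute)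
  show "inner (f + g) h = inner f h + inner g h"
    unfolding inner_ell2_def by (simp add: Rep_ell2_simps distrib_right suminf_add[OF summ summ])
  show "inner (c *\<^sub>R f) g = c * inner f g"
    unfolding inner_ell2_def by (simp add: Rep_ell2_simps mult.assoc suminf_mult[OF summ])
  show "0 \<le> inner f f"
    unfolding inner_ell2_def by (intro suminf_nonneg summ) simp
  show "inner f f = 0 \<longleftrightarrow> f = 0"
  proof
    assume "inner f f = 0"
    then have "\<forall>x. Rep_ell2 f x * Rep_ell2 f x = 0"
      unfolding inner_ell2_def by (subst (asm) suminf_eq_zero_iff) (auto simp: summ)
    then show "f = 0" by (intro ell2_eqI) (simp add: Rep_ell2_simps)
  qed (simp add: inner_ell2_def Rep_ell2_simps)
  show "norm f = sqrt (inner f f)" by (simp add: norm_ell2_def)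
qed

end

subsection \<open>Random elements of \<open>\<ell>\<^sub>2\<close> and weak convergence\<close>

text \<open>The random elements need not live on a common probability space.\<close>

definition weakly_converges ::
  "'a measure \<Rightarrow> (nat \<Rightarrow> 'a \<Rightarrow> 'c::topological_space) \<Rightarrow> 'b measure \<Rightarrow> ('b \<Rightarrow> 'c) \<Rightarrow> bool" where
  "weakly_converges M Z N W \<longleftrightarrow>
     (\<forall>n. Z n \<in> borel_measurable M) \<and> W \<in> borel_measurable N \<and>
     (\<forall>f :: 'c \<Rightarrow> real. continuous_on UNIV f \<and> bounded (range f) \<longrightarrow>
        (\<lambda>n. \<integral>\<omega>. f (Z n \<omega>) \<partial>M) \<longlonglongrightarrow> (\<integral>\<omega>. f (W \<omega>) \<partial>N))"

text \<open>
  Processes are functions \<open>nat \<Rightarrow> real\<close> depending on the sample point. They are passed to the type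
  \<open>ell2\<close> by \<open>Abs_ell2\<close>, which is meaningful only on square-summable functions; hence square
  summability of the paths is part of the following two definitions.
\<close>

definition random_element_ell2 :: "'a measure \<Rightarrow> ('a \<Rightarrow> nat \<Rightarrow> real) \<Rightarrow> bool" where
  "random_element_ell2 M Z \<longleftrightarrow>
     (\<forall>\<omega>\<in>space M. square_summable (Z \<omega>)) \<and> (\<lambda>\<omega>. Abs_ell2 (Z \<omega>)) \<in> borel_measurable M"

definition weakly_converges_ell2 ::
  "'a measure \<Rightarrow> (nat \<Rightarrow> 'a \<Rightarrow> nat \<Rightarrow> real) \<Rightarrow> 'b measure \<Rightarrow> ('b \<Rightarrow> nat \<Rightarrow> real) \<Rightarrow> bool" where
  "weakly_converges_ell2 M Z N W \<longleftrightarrow>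
     (\<forall>n. random_element_ell2 M (Z n)) \<and> random_element_ell2 N W \<and>
     weakly_converges M (\<lambda>n \<omega>. Abs_ell2 (Z n \<omega>)) N (\<lambda>\<omega>. Abs_ell2 (W \<omega>))"

subsection \<open>Gaussian processes\<close>

text \<open>Point masses count as (degenerate) Gaussian laws.\<close>

definition gaussian_rv :: "'a measure \<Rightarrow> ('a \<Rightarrow> real) \<Rightarrow> bool" where
  "gaussian_rv M Z \<longleftrightarrow> Z \<in> borel_measurable M \<and>
     ((\<exists>\<mu>. AE \<omega> in M. Z \<omega> = \<mu>) \<or>
      (\<exists>\<mu> \<sigma>. \<sigma> > 0 \<and> distributed M lborel Z (normal_density \<mu> \<sigma>)))"

definition gaussian_process :: "'a measure \<Rightarrow> ('a \<Rightarrow> nat \<Rightarrow> real) \<Rightarrow> bool" where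
  "gaussian_process M Z \<longleftrightarrow>
     (\<forall>A c. finite A \<longrightarrow> gaussian_rv M (\<lambda>\<omega>. \<Sum>x\<in>A. c x * Z \<omega> x))"

definition covariance :: "'a measure \<Rightarrow> ('a \<Rightarrow> real) \<Rightarrow> ('a \<Rightarrow> real) \<Rightarrow> real" where
  "covariance M U V = (\<integral>\<omega>. (U \<omega> - (\<integral>\<omega>'. U \<omega>' \<partial>M)) * (V \<omega> - (\<integral>\<omega>'. V \<omega>' \<partial>M)) \<partial>M)"

subsection \<open>The operators \<open>rear\<close> and \<open>gren\<close>\<close>

definition rear :: "real list \<Rightarrow> real list" where
  "rear w = rev (sort w)"

text \<open>
  The least concave majorant of a finite set of points is a function on the smallest interval
  containing their abscissae; its values elsewhere are irrelevant.
\<close>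

definition least_concave_majorant :: "(real \<times> real) set \<Rightarrow> real \<Rightarrow> real" where
  "least_concave_majorant P t =
     Inf {g t |g. concave_on (convex hull (fst ` P)) g \<and> (\<forall>(a, b)\<in>P. b \<le> g a)}"

definition left_slope :: "(real \<Rightarrow> real) \<Rightarrow> real \<Rightarrow> real" where
  "left_slope g t = (THE d. (g has_real_derivative d) (at_left t))"

text \<open>The point with abscissa \<open>j - 1\<close> carries the sum of the first \<open>j\<close> entries of \<open>w\<close>.\<close>

definition partial_sum_points :: "real list \<Rightarrow> (real \<times> real) set" where
  "partial_sum_points w = {(real j - 1, \<Sum>i<j. w ! i) |j. j \<le> length w}"

definition gren :: "real list \<Rightarrow> real list" where
  "gren w = map (\<lambda>j. left_slope (least_concave_majorant (partial_sum_points w)) (real j))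
                [0..<length w]"

lemma length_rear [simp]: "length (rear w) = length w"
  by (simp add: rear_def)

lemma length_gren [simp]: "length (gren w) = length w"
  by (simp add: gren_def)

subsection \<open>Estimators\<close>

text \<open>The sample of size \<open>n\<close> is \<open>X 0, \<dots>, X (n - 1)\<close>.\<close>

definition emp :: "(nat \<Rightarrow> 'a \<Rightarrow> nat) \<Rightarrow> nat \<Rightarrow> 'a \<Rightarrow> nat \<Rightarrow> real" where
  "emp X n \<omega> x = real (card {i. i < n \<and> X i \<omega> = x}) / real n"

definition emp_vector :: "(nat \<Rightarrow> 'a \<Rightarrow> nat) \<Rightarrow> nat \<Rightarrow> 'a \<Rightarrow> real list" where
  "emp_vector X n \<omega> = map (emp X n \<omega>) [0..<Suc (Max ((\<lambda>i. X i \<omega>) ` {..<n}))]"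

definition extend_by_zero :: "real list \<Rightarrow> nat \<Rightarrow> real" where
  "extend_by_zero w x = (if x < length w then w ! x else 0)"

definition rear_estimator :: "(nat \<Rightarrow> 'a \<Rightarrow> nat) \<Rightarrow> nat \<Rightarrow> 'a \<Rightarrow> nat \<Rightarrow> real" where
  "rear_estimator X n \<omega> = extend_by_zero (rear (emp_vector X n \<omega>))"

definition gren_estimator :: "(nat \<Rightarrow> 'a \<Rightarrow> nat) \<Rightarrow> nat \<Rightarrow> 'a \<Rightarrow> nat \<Rightarrow> real" where
  "gren_estimator X n \<omega> = extend_by_zero (gren (emp_vector X n \<omega>))"

text \<open>For \<open>n = 0\<close> the fluctuation is the zero sequence, whatever the estimator.\<close>

definition fluctuation ::
  "(nat \<Rightarrow> real) \<Rightarrow> (nat \<Rightarrow> 'a \<Rightarrow> nat \<Rightarrow> real) \<Rightarrow> nat \<Rightarrow> 'a \<Rightarrow> nat \<Rightarrow> real" where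
  "fluctuation p q n \<omega> x = sqrt (real n) * (q n \<omega> x - p x)"

subsection \<open>Transforms along the periods of constancy\<close>

text \<open>The disjunct \<open>r = 0\<close> implements the convention \<open>p (-1) = \<infinity>\<close>.\<close>

definition constancy_period :: "(nat \<Rightarrow> real) \<Rightarrow> nat \<Rightarrow> nat \<Rightarrow> bool" where
  "constancy_period p r s \<longleftrightarrow>
     r < s \<and> (r = 0 \<or> p (r - 1) > p r) \<and> (\<forall>x\<in>{r..s}. p x = p r) \<and> p s > p (Suc s)"

definition blockwise ::
  "(nat \<Rightarrow> real) \<Rightarrow> (real list \<Rightarrow> real list) \<Rightarrow> (nat \<Rightarrow> real) \<Rightarrow> nat \<Rightarrow> real" where
  "blockwise p T y x =
     (if \<exists>r s. constancy_period p r s \<and> x \<in> {r..s}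
      then let (r, s) = (THE (r, s). constancy_period p r s \<and> x \<in> {r..s})
           in T (map y [r..<Suc s]) ! (x - r)
      else y x)"

lemma constancy_period_unique:
  assumes "constancy_period p r s" "x \<in> {r..s}" "constancy_period p r' s'" "x \<in> {r'..s'}"
  shows "r = r' \<and> s = s'"
proof -
  have left: "\<not> r < r'" if "constancy_period p r s" "x \<in> {r..s}"
      "constancy_period p r' s'" "x \<in> {r'..s'}" for r s r' s'
  proof
    assume "r < r'"
    with that have mem: "r' - 1 \<in> {r..s}" "r' \<in> {r..s}" "r' \<noteq> 0" by auto
    have const: "\<forall>y\<in>{r..s}. p y = p r" using that(1) unfolding constancy_period_def by blast
    have "p (r' - 1) = p r'" using bspec[OF const mem(1)] bspec[OF const mem(2)] by linarith
    moreover have "r' = 0 \<or> p (r' - 1) > p r'" using that(3) unfolding constancy_period_def by blast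
    ultimately show False using mem(3) by linarith
  qed
  have right: "\<not> s < s'" if "constancy_period p r s" "x \<in> {r..s}"
      "constancy_period p r' s'" "x \<in> {r'..s'}" for r s r' s'
  proof
    assume "s < s'"
    with that have mem: "Suc s \<in> {r'..s'}" "s \<in> {r'..s'}" by auto
    have const: "\<forall>y\<in>{r'..s'}. p y = p r'" using that(3) unfolding constancy_period_def by blast
    have "p (Suc s) = p s" using bspec[OF const mem(1)] bspec[OF const mem(2)] by linarith
    moreover have "p s > p (Suc s)" using that(1) unfolding constancy_period_def by blast
    ultimately show False by linarith
  qed
  show ?thesis
    using left[OF assms] left[OF assms(3,4,1,2)] right[OF assms] right[OF assms(3,4,1,2)] by auto
qed

lemma blockwise_on_period:
  assumes per: "constancy_period p r s" and len: "\<And>w. length (T w) = length w"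
  shows "map (blockwise p T y) [r..<Suc s] = T (map y [r..<Suc s])"
proof (rule nth_equalityI)
  have rs: "r \<le> s" using per unfolding constancy_period_def by simp
  show "length (map (blockwise p T y) [r..<Suc s]) = length (T (map y [r..<Suc s]))"
    by (simp add: len)
  fix i assume "i < length (map (blockwise p T y) [r..<Suc s])"
  then have i: "r + i \<in> {r..s}" using rs by auto
  have "(THE (r', s'). constancy_period p r' s' \<and> r + i \<in> {r'..s'}) = (r, s)"
  proof (rule the_equality)
    show "case (r, s) of (r', s') \<Rightarrow> constancy_period p r' s' \<and> r + i \<in> {r'..s'}"
      using per i by blast
    fix z assume "case z of (r', s') \<Rightarrow> constancy_period p r' s' \<and> r + i \<in> {r'..s'}"
    then show "z = (r, s)"
      using constancy_period_unique[OF _ _ per i] by (cases z) blast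
  qed
  moreover have "\<exists>r' s'. constancy_period p r' s' \<and> r + i \<in> {r'..s'}"
    using per i by blast
  ultimately have "blockwise p T y (r + i) = T (map y [r..<Suc s]) ! i"
    unfolding blockwise_def by (simp del: upt_Suc)
  then show "map (blockwise p T y) [r..<Suc s] ! i = T (map y [r..<Suc s]) ! i"
    using i by (simp del: upt_Suc)
qed

lemma blockwise_off_periods:
  assumes "\<And>r s. constancy_period p r s \<Longrightarrow> x \<notin> {r..s}"
  shows "blockwise p T y x = y x"
  using assms unfolding blockwise_def by auto

end

theory Submission
  imports Defs
begin

text \<open>
  Both operators are nonexpansive in \<open>\<ell>\<^sub>2\<close> (for \<open>gren\<close> because it is the projection onto the cone of
  nonincreasing vectors), fix nonincreasing vectors, commute with increasing affine maps, and split over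
  \<open>u @ v\<close> when every entry of \<open>u\<close> dominates every entry of \<open>v\<close>. With high probability the empirical
  frequencies on the two sides of each drop of \<open>p\<close> before a fixed index \<open>K\<close> are separated, so that up to
  \<open>K\<close> the fluctuation of the estimator equals the blockwise transform \<open>\<Phi>\<close> of the empirical process \<open>Z\<^sub>n\<close>,
  while beyond \<open>K\<close> the squared norm of both is at most that of \<open>Z\<^sub>n\<close>, whose mean is at most
  \<open>\<Sum>x\<ge>K. p x\<close>. As \<open>\<Phi>\<close> is 1-Lipschitz, it remains to see that \<open>Z\<^sub>n\<close> converges weakly to \<open>Y\<close>; by the same
  tail bound this reduces to finitely many coordinates, where products of functions of single coordinates
  are reached from the central limit theorem for linear combinations by applying the one-dimensional
  continuity theorem under nonnegative weights.
\<close>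

text \<open>Two features shape the argument. The estimators act on one vector of random length,
  whereas the limit acts on each block separately. Centring by \<open>p\<close> is an affine map
  only within a block, so the vector has to be cut before anything can be transported. Beyond
  \<open>K\<close> the drops of \<open>p\<close> may be arbitrarily small and separation is out of
  reach; norms suffice there because \<open>p\<close> itself is fixed by the operator. Where
  \<open>p\<close> vanishes there is no drop at all, but there the empirical frequencies vanish
  almost surely, which is why such indices may serve as cuts.

  Exceptional events and tightness are handled by inequalities between integrands instead of
  probabilities of events: an indicator is dominated by a squared norm, and a square root by an
  affine function of its argument. What remains is linear in second moments. The weights
  \<open>1 + cos\<close> arise because a cosine alone is not a nonnegative weight; the added 1 is
  removed by subtraction afterwards.\<close>

lemma sum_lessThan_add:
  fixes f :: "nat \<Rightarrow> 'a::comm_monoid_add"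
  shows "sum f {..<m + k} = sum f {..<m} + (\<Sum>i<k. f (m + i))"
  by (induction k) (simp_all add: add_ac)

lemma sum_atLeastLessThan_shift:
  fixes F :: "nat \<Rightarrow> 'a::comm_monoid_add"
  assumes "b \<le> c"
  shows "(\<Sum>x = b..<c. F x) = (\<Sum>i<c - b. F (b + i))"
  using sum.shift_bounds_nat_ivl[of F 0 b "c - b"] assms
  by (simp add: lessThan_atLeast0 add.commute)

subsection \<open>Isotonic operators\<close>

locale isotonic_operator =
  fixes T :: "real list \<Rightarrow> real list"
  assumes length_T [simp]: "length (T w) = length w"
    and nonexpansive: "length u = length v \<Longrightarrow>
      (\<Sum>i<length u. (T u ! i - T v ! i)\<^sup>2) \<le> (\<Sum>i<length u. (u ! i - v ! i)\<^sup>2)"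
    and fixes_decreasing: "sorted_wrt (\<ge>) w \<Longrightarrow> T w = w"
    and map_affine: "a > 0 \<Longrightarrow> T (map (\<lambda>x. a * x + b) w) = map (\<lambda>x. a * x + b) (T w)"
    and split_append: "(\<forall>x\<in>set u. \<forall>y\<in>set v. y \<le> x) \<Longrightarrow> T (u @ v) = T u @ T v"

text \<open>Inserting \<open>b\<close> into sorted position is a chain of exchanges of neighbours.
  Each exchange lowers the cost because \<open>(a' - a) * (b - c)\<close> is nonnegative, which is
  the rearrangement inequality for two pairs.\<close>

lemma sum_list_sq_diff_insort_le:
  fixes u s :: "real list"
  assumes "length u = length s" "sorted (a # u)" "sorted s"
  shows "(\<Sum>(x, y)\<leftarrow>zip (a # u) (insort b s). (x - y)\<^sup>2)
       \<le> (a - b)\<^sup>2 + (\<Sum>(x, y)\<leftarrow>zip u s. (x - y)\<^sup>2)"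
  using assms
proof (induction u s arbitrary: a rule: list_induct2)
  case (Cons a' u c s)
  show ?case
  proof (cases "b \<le> c")
    case False
    have "0 \<le> (a' - a) * (b - c)" using Cons.prems False by simp
    then have "(a - c)\<^sup>2 + (a' - b)\<^sup>2 \<le> (a - b)\<^sup>2 + (a' - c)\<^sup>2"
      by (simp add: power2_eq_square algebra_simps)
    moreover have "(\<Sum>(x, y)\<leftarrow>zip (a' # u) (insort b s). (x - y)\<^sup>2)
       \<le> (a' - b)\<^sup>2 + (\<Sum>(x, y)\<leftarrow>zip u s. (x - y)\<^sup>2)"
      using Cons.prems by (intro Cons.IH) simp_all
    ultimately show ?thesis using False by simp
  qed simp
qed simp

lemma sum_list_sq_diff_sort_snd_le:
  fixes u v :: "real list"
  assumes "length u = length v" "sorted u"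
  shows "(\<Sum>(x, y)\<leftarrow>zip u (sort v). (x - y)\<^sup>2) \<le> (\<Sum>(x, y)\<leftarrow>zip u v. (x - y)\<^sup>2)"
  using assms
proof (induction u v rule: list_induct2)
  case (Cons a u b v)
  have "(\<Sum>(x, y)\<leftarrow>zip (a # u) (insort b (sort v)). (x - y)\<^sup>2)
       \<le> (a - b)\<^sup>2 + (\<Sum>(x, y)\<leftarrow>zip u (sort v). (x - y)\<^sup>2)"
    using Cons by (intro sum_list_sq_diff_insort_le) simp_all
  with Cons show ?case by simp
qed simp

text \<open>The sum over pairs does not depend on their order, so the pairs may be arranged with
  increasing first components. Only the second components then remain to be sorted.\<close>

lemma sum_list_sq_diff_sort_le:
  fixes u v :: "real list"
  assumes "length u = length v"
  shows "(\<Sum>(x, y)\<leftarrow>zip (sort u) (sort v). (x - y)\<^sup>2) \<le> (\<Sum>(x, y)\<leftarrow>zip u v. (x - y)\<^sup>2)"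
proof -
  define z where "z = sort_key fst (zip u v)"
  have mz: "mset z = mset (zip u v)" by (simp add: z_def)
  have lz: "length z = length u" using mz assms by (metis length_zip min.idem size_mset)
  have sfst: "map fst z = sort u"
  proof (rule properties_for_sort[symmetric])
    have "mset (map fst z) = image_mset fst (mset (zip u v))" using mz by (metis mset_map)
    also have "\<dots> = mset (map fst (zip u v))" by (simp only: mset_map)
    finally show "mset (map fst z) = mset u" using assms by simp
  qed (simp add: z_def)
  have ssnd: "sort (map snd z) = sort v"
  proof -
    have "mset (map snd z) = image_mset snd (mset (zip u v))" using mz by (metis mset_map)
    also have "\<dots> = mset (map snd (zip u v))" by (simp only: mset_map)
    finally have "mset (map snd z) = mset v" using assms by simp
    then show ?thesis by (metis mset_sort properties_for_sort sorted_sort)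
  qed
  have "(\<Sum>(x, y)\<leftarrow>zip (sort u) (sort v). (x - y)\<^sup>2) = (\<Sum>(x, y)\<leftarrow>zip (map fst z) (sort (map snd z)). (x - y)\<^sup>2)"
    by (simp add: sfst ssnd)
  also have "\<dots> \<le> (\<Sum>(x, y)\<leftarrow>zip (map fst z) (map snd z). (x - y)\<^sup>2)"
    by (intro sum_list_sq_diff_sort_snd_le) (simp_all add: sfst lz)
  also have "\<dots> = (\<Sum>(x, y)\<leftarrow>z. (x - y)\<^sup>2)" by (simp only: zip_map_fst_snd)
  also have "\<dots> = (\<Sum>(x, y)\<leftarrow>zip u v. (x - y)\<^sup>2)"
    by (simp only: sum_mset_sum_list[symmetric] mset_map mz)
  finally show ?thesis .
qed

lemma sum_list_zip_conv_sum_nth: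
  fixes F :: "'a \<Rightarrow> 'b \<Rightarrow> 'c::comm_monoid_add"
  assumes "length u = length v"
  shows "(\<Sum>(x, y)\<leftarrow>zip u v. F x y) = (\<Sum>i<length u. F (u ! i) (v ! i))"
proof -
  have "(\<Sum>(x, y)\<leftarrow>zip u v. F x y) = (\<Sum>i = 0..<length u. F (u ! i) (v ! i))"
    using assms by (simp add: sum_list_sum_nth)
  then show ?thesis by (simp add: atLeast0LessThan)
qed

interpretation rear: isotonic_operator rear
proof
  fix u v :: "real list" assume l: "length u = length v"
  have "(\<Sum>i<length u. (rear u ! i - rear v ! i)\<^sup>2)
      = (\<Sum>(x, y)\<leftarrow>zip (rear u) (rear v). (x - y)\<^sup>2)"
    using l by (subst sum_list_zip_conv_sum_nth) simp_all
  also have "\<dots> = (\<Sum>(x, y)\<leftarrow>rev (zip (sort u) (sort v)). (x - y)\<^sup>2)"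
    using l by (simp add: rear_def zip_rev)
  also have "\<dots> = (\<Sum>(x, y)\<leftarrow>zip (sort u) (sort v). (x - y)\<^sup>2)"
    by (simp only: rev_map[symmetric] sum_list_rev)
  also have "\<dots> \<le> (\<Sum>(x, y)\<leftarrow>zip u v. (x - y)\<^sup>2)"
    using l by (rule sum_list_sq_diff_sort_le)
  also have "\<dots> = (\<Sum>i<length u. (u ! i - v ! i)\<^sup>2)"
    using l by (subst sum_list_zip_conv_sum_nth) simp_all
  finally show "(\<Sum>i<length u. (rear u ! i - rear v ! i)\<^sup>2) \<le> (\<Sum>i<length u. (u ! i - v ! i)\<^sup>2)" .
next
  fix w :: "real list" assume "sorted_wrt (\<ge>) w"
  then have "sorted (rev w)" by (simp add: sorted_wrt_rev)
  then have "sort w = rev w" by (intro properties_for_sort) simp_all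
  then show "rear w = w" by (simp add: rear_def)
next
  fix a b :: real and w assume "a > 0"
  then have "sort (map (\<lambda>x. a * x + b) w) = map (\<lambda>x. a * x + b) (sort w)"
    by (intro properties_for_sort) (auto simp: sorted_map intro!: sorted_wrt_mono_rel[OF _ sorted_sort])
  then show "rear (map (\<lambda>x. a * x + b) w) = map (\<lambda>x. a * x + b) (rear w)"
    by (simp add: rear_def rev_map)
next
  fix u v :: "real list" assume "\<forall>x\<in>set u. \<forall>y\<in>set v. y \<le> x"
  then have "sort (u @ v) = sort v @ sort u"
    by (intro properties_for_sort) (auto simp: sorted_append)
  then show "rear (u @ v) = rear u @ rear v"
    by (simp add: rear_def)
qed simp

subsection \<open>Slopes of the least concave majorant\<close>

text \<open>These are the Karush-Kuhn-Tucker conditions for projecting \<open>w\<close> onto the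
  nonincreasing vectors: the excesses of the partial sums of \<open>g\<close> over those of
  \<open>w\<close> are the multipliers, and the last clause is complementary slackness.
  Geometrically, the slope drops only where the majorant touches a point. The index form confines
  functions of a real variable to the identification with \<open>gren\<close>.\<close>

definition lcm_slopes :: "nat \<Rightarrow> (nat \<Rightarrow> real) \<Rightarrow> (nat \<Rightarrow> real) \<Rightarrow> bool" where
  "lcm_slopes n w g \<longleftrightarrow>
     (\<forall>i j. i \<le> j \<longrightarrow> j < n \<longrightarrow> g j \<le> g i) \<and>
     (\<forall>j\<le>n. sum w {..<j} \<le> sum g {..<j}) \<and>
     sum w {..<n} = sum g {..<n} \<and>
     (\<forall>j. Suc j < n \<longrightarrow> g (Suc j) < g j \<longrightarrow> sum w {..<Suc j} = sum g {..<Suc j})"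

lemma lcm_slopes_antitone: "lcm_slopes n w g \<Longrightarrow> i \<le> j \<Longrightarrow> j < n \<Longrightarrow> g j \<le> g i"
  and lcm_slopes_ge: "lcm_slopes n w g \<Longrightarrow> j \<le> n \<Longrightarrow> sum w {..<j} \<le> sum g {..<j}"
  and lcm_slopes_total: "lcm_slopes n w g \<Longrightarrow> sum w {..<n} = sum g {..<n}"
  and lcm_slopes_contact:
    "lcm_slopes n w g \<Longrightarrow> Suc j < n \<Longrightarrow> g (Suc j) < g j \<Longrightarrow> sum w {..<Suc j} = sum g {..<Suc j}"
  unfolding lcm_slopes_def by blast+

lemma lcm_slopes_cong:
  assumes "\<And>i. i < n \<Longrightarrow> w i = w' i" "\<And>i. i < n \<Longrightarrow> g i = g' i"
  shows "lcm_slopes n w g \<longleftrightarrow> lcm_slopes n w' g'"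
proof -
  have s: "sum w {..<j} = sum w' {..<j}" "sum g {..<j} = sum g' {..<j}" if "j \<le> n" for j
    using that assms by (auto intro!: sum.cong)
  have 1: "(\<forall>i j. i \<le> j \<longrightarrow> j < n \<longrightarrow> g j \<le> g i) \<longleftrightarrow> (\<forall>i j. i \<le> j \<longrightarrow> j < n \<longrightarrow> g' j \<le> g' i)"
    using assms(2) by (metis le_less_trans)
  have 2: "(Suc j < n \<longrightarrow> g (Suc j) < g j \<longrightarrow> sum w {..<Suc j} = sum g {..<Suc j}) \<longleftrightarrow>
           (Suc j < n \<longrightarrow> g' (Suc j) < g' j \<longrightarrow> sum w' {..<Suc j} = sum g' {..<Suc j})" for j
    using assms(2)[of j] assms(2)[of "Suc j"] s[of "Suc j"] by (auto simp del: sum.lessThan_Suc)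
  show ?thesis unfolding lcm_slopes_def 1 2 using s by auto
qed

lemma lcm_slopes_const_between_contacts:
  assumes "lcm_slopes n w g" "b \<le> n"
    and "\<And>c. a < c \<Longrightarrow> c < b \<Longrightarrow> sum w {..<c} \<noteq> sum g {..<c}"
  shows "a \<le> i \<Longrightarrow> i < b \<Longrightarrow> g i = g a"
proof (induction i rule: dec_induct)
  case (step i)
  have "\<not> g (Suc i) < g i"
    using lcm_slopes_contact[OF assms(1), of i] assms(2) assms(3)[of "Suc i"] step by auto
  moreover have "g (Suc i) \<le> g i"
    using step assms(2) by (intro lcm_slopes_antitone[OF assms(1)]) auto
  ultimately show ?case using step by simp
qed simp

text \<open>Up to the first positive contact the slopes are constant, so the first and largest slope
  is an average of an initial segment of \<open>w\<close>. Bounds on such averages thereby become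
  bounds on all slopes.\<close>

lemma lcm_slopes_first:
  assumes "lcm_slopes n w g" "n > 0"
  obtains c where "0 < c" "c \<le> n" "real c * g 0 = sum w {..<c}"
proof -
  define P where "P c \<longleftrightarrow> 0 < c \<and> sum w {..<c} = sum g {..<c}" for c
  define c where "c = (LEAST c. P c)"
  have Pn: "P n" using assms lcm_slopes_total[OF assms(1)] by (simp add: P_def)
  have c: "P c" unfolding c_def using Pn by (rule LeastI)
  have cn: "c \<le> n" unfolding c_def using Pn by (rule Least_le)
  have const: "g i = g 0" if "i < c" for i
  proof (rule lcm_slopes_const_between_contacts[OF assms(1) cn])
    fix d assume d: "0 < d" "d < c"
    have "\<not> P d" using d(2) unfolding c_def by (rule not_less_Least)
    with d(1) show "sum w {..<d} \<noteq> sum g {..<d}" by (simp add: P_def)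
  qed (use that in auto)
  have "sum g {..<c} = (\<Sum>i<c. g 0)" by (intro sum.cong) (auto intro: const)
  then have "sum g {..<c} = real c * g 0" by simp
  then show ?thesis using c cn unfolding P_def by (intro that[of c]) auto
qed

text \<open>The junction \<open>m\<close> is a contact point because the totals of the first part
  agree, so the slope may drop there. Hence only the order of the slopes across the junction has to
  be assumed. Both existence and the splitting law of \<open>gren\<close> rest on this.\<close>

lemma lcm_slopes_append:
  assumes g: "lcm_slopes m w g" and h: "lcm_slopes k (\<lambda>i. w (m + i)) h"
    and le: "\<And>i j. i < m \<Longrightarrow> j < k \<Longrightarrow> h j \<le> g i"
  shows "lcm_slopes (m + k) w (\<lambda>i. if i < m then g i else h (i - m))"
    (is "lcm_slopes _ _ ?f")
proof -
  have lo: "sum ?f {..<j} = sum g {..<j}" if "j \<le> m" for j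
    using that by (auto intro!: sum.cong)
  have hi: "sum ?f {..<m + j} = sum g {..<m} + sum h {..<j}" for j
    by (subst sum_lessThan_add) (simp add: lo)
  have whi: "sum w {..<m + j} = sum g {..<m} + (\<Sum>i<j. w (m + i))" for j
    by (subst sum_lessThan_add) (simp add: lcm_slopes_total[OF g])
  show ?thesis unfolding lcm_slopes_def
  proof (intro conjI allI impI)
    fix i j assume "i \<le> j" "j < m + k"
    then show "?f j \<le> ?f i"
      using le lcm_slopes_antitone[OF g] lcm_slopes_antitone[OF h] by (auto simp: not_less)
  next
    fix j assume j: "j \<le> m + k"
    show "sum w {..<j} \<le> sum ?f {..<j}"
    proof (cases "j \<le> m")
      case True then show ?thesis using lo lcm_slopes_ge[OF g] by simp
    next
      case False
      then obtain d where d: "j = m + d" by (metis le_add_diff_inverse nat_le_linear)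
      then show ?thesis using lcm_slopes_ge[OF h, of d] j by (simp add: hi whi)
    qed
  next
    show "sum w {..<m + k} = sum ?f {..<m + k}" using lcm_slopes_total[OF h] by (simp add: hi whi)
  next
    fix j assume j: "Suc j < m + k" "?f (Suc j) < ?f j"
    consider "Suc j < m" | "Suc j = m" | "j \<ge> m" by linarith
    then show "sum w {..<Suc j} = sum ?f {..<Suc j}"
    proof cases
      case 1 then show ?thesis using j lcm_slopes_contact[OF g, of j] lo[of "Suc j"] by simp
    next
      case 2 then show ?thesis using lo[of m] lcm_slopes_total[OF g] by (simp del: sum.lessThan_Suc)
    next
      case 3
      then obtain d where d: "j = m + d" by (metis le_add_diff_inverse)
      have "(\<Sum>i<Suc d. w (m + i)) = sum h {..<Suc d}"
        using j d by (intro lcm_slopes_contact[OF h]) auto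
      then show ?thesis using hi[of "Suc d"] whi[of "Suc d"] d by (simp del: sum.lessThan_Suc)
    qed
  qed
qed

text \<open>Greedy construction: the first linear piece ends where the average of an initial segment
  is largest, and induction treats the remaining entries.\<close>

lemma lcm_slopes_exists: "\<exists>g. lcm_slopes n w g"
proof (induction n arbitrary: w rule: less_induct)
  case (less n)
  show ?case
  proof (cases "n = 0")
    case True then show ?thesis by (simp add: lcm_slopes_def)
  next
    case False
    let ?q = "\<lambda>j. sum w {..<j} / real j"
    have "Max (?q ` {1..n}) \<in> ?q ` {1..n}" using False by (intro Max_in) auto
    then obtain j where j: "Max (?q ` {1..n}) = ?q j" "j \<in> {1..n}" by (rule imageE)
    define a where "a = ?q j"
    have amax: "sum w {..<i} \<le> a * real i" if "i \<le> n" for i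
    proof (cases "i = 0")
      case False
      then have "?q i \<le> a" unfolding a_def j(1)[symmetric] using that by (intro Max_ge) auto
      then show ?thesis using False by (simp add: field_simps)
    qed simp
    have aj: "sum w {..<j} = a * real j" using j(2) by (simp add: a_def)
    have ga: "lcm_slopes j w (\<lambda>_. a)"
      unfolding lcm_slopes_def using j(2) amax by (simp add: aj mult.commute)
    obtain h where h: "lcm_slopes (n - j) (\<lambda>i. w (j + i)) h"
      using less.IH[of "n - j" "\<lambda>i. w (j + i)"] j(2) by auto
    \<comment> \<open>A larger slope in the remainder would, by \<open>lcm_slopes_first\<close>,
      give a longer initial segment with average above the maximum \<open>a\<close>.\<close>
    have ha: "h i \<le> a" if "i < n - j" for i
    proof -
      obtain c where c: "0 < c" "c \<le> n - j" "real c * h 0 = (\<Sum>i<c. w (j + i))"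
        by (rule lcm_slopes_first[OF h]) (use \<open>i < n - j\<close> in auto)
      have "sum w {..<j + c} \<le> a * real (j + c)" using c by (intro amax) auto
      then have "real c * h 0 \<le> real c * a" unfolding sum_lessThan_add using aj c(3)
        by (simp add: algebra_simps)
      then have "h 0 \<le> a" using c(1) by (simp only: mult_le_cancel_left_pos of_nat_0_less_iff)
      then show ?thesis using lcm_slopes_antitone[OF h, of 0 i] that by simp
    qed
    have "lcm_slopes (j + (n - j)) w (\<lambda>i. if i < j then a else h (i - j))"
      using ha by (intro lcm_slopes_append ga h)
    then show ?thesis using j(2) by auto
  qed
qed

section \<open>Projection onto the nonincreasing vectors\<close>

lemma sum_mult_by_parts:
  fixes d h :: "nat \<Rightarrow> real"
  shows "(\<Sum>i<Suc n. d i * h i)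
       = sum d {..<Suc n} * h n + (\<Sum>j<n. sum d {..<Suc j} * (h j - h (Suc j)))"
proof (induction n)
  case (Suc n)
  have "(\<Sum>i<Suc (Suc n). d i * h i) = (\<Sum>i<Suc n. d i * h i) + d (Suc n) * h (Suc n)"
    by simp
  then show ?case by (simp only: Suc.IH) (simp add: algebra_simps)
qed simp

text \<open>
  The next two lemmas characterize \<open>g\<close> as the projection of \<open>w\<close> onto the cone of nonincreasing vectors,
  which is why the map is nonexpansive.
\<close>

lemma lcm_slopes_inner_le:
  assumes "lcm_slopes n w g" and h: "\<And>i j. i \<le> j \<Longrightarrow> j < n \<Longrightarrow> h j \<le> h i"
  shows "(\<Sum>i<n. (w i - g i) * h i) \<le> 0"
proof (cases n)
  case (Suc m)
  have D: "sum (\<lambda>i. w i - g i) {..<Suc m} = 0"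
    using lcm_slopes_total[OF assms(1)] Suc by (simp only: sum_subtractf)
  have "(\<Sum>i<n. (w i - g i) * h i) = (\<Sum>j<m. sum (\<lambda>i. w i - g i) {..<Suc j} * (h j - h (Suc j)))"
    unfolding Suc sum_mult_by_parts D by simp
  also have "\<dots> \<le> 0"
  proof (rule sum_nonpos, rule mult_nonpos_nonneg)
    fix j assume "j \<in> {..<m}"
    then show "sum (\<lambda>i. w i - g i) {..<Suc j} \<le> 0"
      using lcm_slopes_ge[OF assms(1), of "Suc j"] Suc by (simp only: sum_subtractf) simp
    show "0 \<le> h j - h (Suc j)" using h[of j "Suc j"] Suc \<open>j \<in> {..<m}\<close> by simp
  qed
  finally show ?thesis .
qed simp

lemma lcm_slopes_inner_eq:
  assumes "lcm_slopes n w g"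
  shows "(\<Sum>i<n. (w i - g i) * g i) = 0"
proof (cases n)
  case (Suc m)
  have D: "sum (\<lambda>i. w i - g i) {..<Suc m} = 0"
    using lcm_slopes_total[OF assms(1)] Suc by (simp only: sum_subtractf)
  have "sum (\<lambda>i. w i - g i) {..<Suc j} * (g j - g (Suc j)) = 0" if "j < m" for j
  proof (cases "g (Suc j) < g j")
    case True
    then show ?thesis using lcm_slopes_contact[OF assms, of j] that Suc by (simp only: sum_subtractf) simp
  next
    case False
    then show ?thesis using lcm_slopes_antitone[OF assms, of j "Suc j"] that Suc by simp
  qed
  then have "(\<Sum>j<m. sum (\<lambda>i. w i - g i) {..<Suc j} * (g j - g (Suc j))) = 0"
    by (intro sum.neutral) blast
  then show ?thesis unfolding Suc sum_mult_by_parts D by simp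
qed simp

lemma lcm_slopes_nonexpansive:
  assumes g: "lcm_slopes n w g" and g': "lcm_slopes n w' g'"
  shows "(\<Sum>i<n. (g i - g' i)\<^sup>2) \<le> (\<Sum>i<n. (w i - w' i)\<^sup>2)"
proof -
  have 1: "(\<Sum>i<n. (w i - g i) * g' i) \<le> 0"
    by (rule lcm_slopes_inner_le[OF g]) (rule lcm_slopes_antitone[OF g'])
  have 2: "(\<Sum>i<n. (w' i - g' i) * g i) \<le> 0"
    by (rule lcm_slopes_inner_le[OF g']) (rule lcm_slopes_antitone[OF g])
  have 3: "(\<Sum>i<n. (w i - g i) * g i) = 0" "(\<Sum>i<n. (w' i - g' i) * g' i) = 0"
    using lcm_slopes_inner_eq g g' by blast+
  \<comment> \<open>The cross term of the expanded square is the inner product of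
    \<open>(w - g) - (w' - g')\<close> with \<open>g - g'\<close>. Of its four pieces two vanish and
    two have the favourable sign.\<close>
  have "(\<Sum>i<n. (w i - w' i)\<^sup>2) - (\<Sum>i<n. (g i - g' i)\<^sup>2)
      = (\<Sum>i<n. ((w i - w' i) - (g i - g' i))\<^sup>2)
        + 2 * ((\<Sum>i<n. (w i - g i) * g i) - (\<Sum>i<n. (w i - g i) * g' i)
               - (\<Sum>i<n. (w' i - g' i) * g i) + (\<Sum>i<n. (w' i - g' i) * g' i))"
    unfolding sum_subtractf[symmetric] sum.distrib[symmetric] sum_distrib_left
    by (intro sum.cong refl) (simp add: power2_eq_square algebra_simps)
  moreover have "0 \<le> (\<Sum>i<n. ((w i - w' i) - (g i - g' i))\<^sup>2)" by (intro sum_nonneg) simp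
  ultimately show ?thesis using 1 2 unfolding 3 by argo
qed

text \<open>At the first index with slope below \<open>c\<close> the slope has just dropped, or the
  index is 0, so it is a contact. From there to the end \<open>w\<close> and \<open>g\<close> have
  equal sums, although every slope is below \<open>c\<close> and every entry is not.\<close>

lemma lcm_slopes_lower_bound:
  assumes g: "lcm_slopes n w g" and c: "\<And>i. i < n \<Longrightarrow> c \<le> w i" and "i < n"
  shows "c \<le> g i"
proof (rule ccontr)
  assume neg: "\<not> c \<le> g i"
  define j where "j = (LEAST j. g j < c)"
  have gj: "g j < c" using LeastI[of "\<lambda>j. g j < c" i] neg by (simp add: j_def)
  have ji: "j \<le> i" using Least_le[of "\<lambda>j. g j < c" i] neg by (simp add: j_def)
  have contact: "sum w {..<j} = sum g {..<j}"
  proof (cases j)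
    case (Suc k)
    have "\<not> g k < c" using not_less_Least[of k "\<lambda>j. g j < c"] Suc by (simp add: j_def)
    then show ?thesis using lcm_slopes_contact[OF g, of k] gj ji \<open>i < n\<close> Suc by simp
  qed simp
  obtain d where d: "n = j + Suc d"
    using ji \<open>i < n\<close> by (metis add_Suc_right le_less_trans less_iff_Suc_add)
  have 1: "(\<Sum>i<Suc d. g (j + i)) < (\<Sum>i<Suc d. c)"
  proof (rule sum_strict_mono)
    fix k assume "k \<in> {..<Suc d}"
    then show "g (j + k) < c" using lcm_slopes_antitone[OF g, of j "j + k"] gj d by simp
  qed auto
  have 2: "(\<Sum>i<Suc d. c) \<le> (\<Sum>i<Suc d. w (j + i))" using d by (intro sum_mono c) auto
  have 3: "(\<Sum>i<Suc d. w (j + i)) = (\<Sum>i<Suc d. g (j + i))"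
    using lcm_slopes_total[OF g] contact unfolding d sum_lessThan_add by simp
  show False using 1 2 3 by linarith
qed

lemma lcm_slopes_upper_bound:
  assumes g: "lcm_slopes n w g" and c: "\<And>i. i < n \<Longrightarrow> w i \<le> c" and "i < n"
  shows "g i \<le> c"
proof -
  obtain k where k: "0 < k" "k \<le> n" "real k * g 0 = sum w {..<k}"
    by (rule lcm_slopes_first[OF g]) (use \<open>i < n\<close> in auto)
  have "sum w {..<k} \<le> (\<Sum>i<k. c)" using k by (intro sum_mono c) auto
  then have "real k * g 0 \<le> real k * c" by (simp only: k(3) sum_constant card_lessThan)
  then have "g 0 \<le> c" using k(1) by (simp only: mult_le_cancel_left_pos of_nat_0_less_iff)
  then show ?thesis using lcm_slopes_antitone[OF g, of 0 i] \<open>i < n\<close> by simp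
qed

section \<open>The majorant as a function of a real variable\<close>

text \<open>The knot with cumulated value \<open>sum g {..<j}\<close> has abscissa
  \<open>real j - 1\<close>, so line \<open>j\<close> carries the majorant on the interval from
  \<open>real j - 1\<close> to \<open>real j\<close>.\<close>

definition majorant_line :: "(nat \<Rightarrow> real) \<Rightarrow> nat \<Rightarrow> real \<Rightarrow> real" where
  "majorant_line g j t = sum g {..<j} + g j * (t - (real j - 1))"

lemma majorant_line_Suc:
  "majorant_line g (Suc i) t = majorant_line g i t + (g (Suc i) - g i) * (t - real i)"
  by (simp add: majorant_line_def algebra_simps)

text \<open>Lines \<open>i\<close> and \<open>Suc i\<close> cross at abscissa \<open>real i\<close>:
  to its left the earlier one is lower, to its right the later one. Moving away from
  \<open>j\<close> one line at a time therefore never lowers the value.\<close>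

lemma majorant_line_least:
  assumes anti: "\<And>i j. i \<le> j \<Longrightarrow> j < n \<Longrightarrow> g j \<le> g i"
    and "j < n" "i < n" "real j - 1 \<le> t" "t \<le> real j"
  shows "majorant_line g j t \<le> majorant_line g i t"
proof (cases "j \<le> i")
  case True
  then show ?thesis using \<open>i < n\<close>
  proof (induction i rule: dec_induct)
    case (step i)
    have "0 \<le> (g (Suc i) - g i) * (t - real i)"
      using anti[of i "Suc i"] step assms by (intro mult_nonpos_nonpos) auto
    then show ?case using step by (simp add: majorant_line_Suc)
  qed simp
next
  case False
  then have "i \<le> j" by simp
  then show ?thesis using assms(4,5)
  proof (induction i rule: inc_induct)
    case (step i)
    have "(g (Suc i) - g i) * (t - real i) \<le> 0"
      using anti[of i "Suc i"] step \<open>j < n\<close> by (intro mult_nonpos_nonneg) auto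
    then show ?case using step by (simp add: majorant_line_Suc)
  qed simp
qed

text \<open>As a minimum of affine functions the polygon is visibly concave; the piecewise
  description is recovered in \<open>polygonal_majorant_eq_line\<close>.\<close>

definition polygonal_majorant :: "nat \<Rightarrow> (nat \<Rightarrow> real) \<Rightarrow> real \<Rightarrow> real" where
  "polygonal_majorant n g t = Min ((\<lambda>j. majorant_line g j t) ` {..<n})"

lemma polygonal_majorant_eq_line:
  assumes "\<And>i j. i \<le> j \<Longrightarrow> j < n \<Longrightarrow> g j \<le> g i" "j < n" "real j - 1 \<le> t" "t \<le> real j"
  shows "polygonal_majorant n g t = majorant_line g j t"
  unfolding polygonal_majorant_def
  using assms(2) majorant_line_least[of n g j _ t, OF assms(1)] assms(3,4)
  by (intro Min_eqI) auto

lemma concave_on_polygonal_majorant: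
  assumes "n > 0" "convex S"
  shows "concave_on S (polygonal_majorant n g)"
  unfolding concave_on_iff
proof (intro conjI ballI allI impI)
  fix x y u v :: real assume uv: "0 \<le> u" "0 \<le> v" "u + v = 1"
  have "u * polygonal_majorant n g x + v * polygonal_majorant n g y \<le> majorant_line g j (u *\<^sub>R x + v *\<^sub>R y)"
    if "j < n" for j
  proof -
    have *: "polygonal_majorant n g z \<le> majorant_line g j z" for z
      unfolding polygonal_majorant_def using that by (intro Min_le) auto
    have "u * polygonal_majorant n g x + v * polygonal_majorant n g y
        \<le> u * majorant_line g j x + v * majorant_line g j y"
      using uv * by (intro add_mono mult_left_mono) auto
    also have "\<dots> = (u + v) * (sum g {..<j} - g j * (real j - 1)) + g j * (u * x + v * y)"
      unfolding majorant_line_def by (simp add: algebra_simps)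
    also have "\<dots> = majorant_line g j (u *\<^sub>R x + v *\<^sub>R y)"
      unfolding majorant_line_def uv by (simp add: algebra_simps)
    finally show ?thesis .
  qed
  then show "u * polygonal_majorant n g x + v * polygonal_majorant n g y
      \<le> polygonal_majorant n g (u *\<^sub>R x + v *\<^sub>R y)"
    using assms(1) by (subst (3) polygonal_majorant_def) (auto intro!: Min.boundedI)
qed (rule assms(2))

lemma hull_partial_sum_points:
  "convex hull (fst ` partial_sum_points w) = {-1..real (length w) - 1}"
proof
  show "convex hull (fst ` partial_sum_points w) \<subseteq> {-1..real (length w) - 1}"
    by (rule hull_minimal) (auto simp: partial_sum_points_def)
  have "(-1, 0) \<in> partial_sum_points w"
       "(real (length w) - 1, \<Sum>i<length w. w ! i) \<in> partial_sum_points w"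
    unfolding partial_sum_points_def by force+
  then have "-1 \<in> fst ` partial_sum_points w" "real (length w) - 1 \<in> fst ` partial_sum_points w"
    by force+
  then have "closed_segment (-1) (real (length w) - 1) \<subseteq> convex hull (fst ` partial_sum_points w)"
    by (intro closed_segment_subset_convex_hull hull_inc)
  then show "{-1..real (length w) - 1} \<subseteq> convex hull (fst ` partial_sum_points w)"
    by (simp add: closed_segment_eq_real_ivl)
qed

text \<open>The polygon is itself an admissible majorant. Between two successive contacts it is a
  chord joining two of the given points, and any concave function above these points lies above the
  chord.\<close>

lemma least_concave_majorant_eq:
  assumes g: "lcm_slopes (length w) (\<lambda>i. w ! i) g"
    and j: "j < length w" "real j - 1 \<le> t" "t \<le> real j"
  shows "least_concave_majorant (partial_sum_points w) t = majorant_line g j t"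
proof -
  let ?n = "length w" let ?W = "\<lambda>j. \<Sum>i<j. w ! i" let ?F = "polygonal_majorant (length w) g"
  have F: "?F t = majorant_line g j t" if "j < ?n" "real j - 1 \<le> t" "t \<le> real j" for j t
    by (rule polygonal_majorant_eq_line[OF lcm_slopes_antitone[OF g] that])
  have Fknot: "?F (real j - 1) = sum g {..<j}" if "j \<le> ?n" for j
  proof (cases "j < ?n")
    case True
    then show ?thesis using F[of j "real j - 1"] by (simp add: majorant_line_def)
  next
    case False
    then obtain k where "j = Suc k" using that j(1) by (cases j) auto
    then show ?thesis using F[of k "real k"] that by (simp add: majorant_line_def algebra_simps)
  qed
  have mem: "?F t \<in> {f t |f. concave_on (convex hull (fst ` partial_sum_points w)) f \<and>
                 (\<forall>(a, b)\<in>partial_sum_points w. b \<le> f a)}"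
  proof (intro CollectI exI[of _ ?F] conjI refl)
    show "concave_on (convex hull (fst ` partial_sum_points w)) ?F"
      using j(1) by (intro concave_on_polygonal_majorant convex_convex_hull) auto
    show "\<forall>(a, b)\<in>partial_sum_points w. b \<le> ?F a"
      using Fknot lcm_slopes_ge[OF g] unfolding partial_sum_points_def by auto
  qed
  have least: "?F t \<le> f t" if conc: "concave_on (convex hull (fst ` partial_sum_points w)) f"
    and maj: "\<forall>(a, b)\<in>partial_sum_points w. b \<le> f a" for f
  proof -
    have fW: "?W c \<le> f (real c - 1)" if "c \<le> ?n" for c
      using maj that unfolding partial_sum_points_def by auto
    \<comment> \<open>\<open>a\<close> and \<open>b\<close> are the contacts enclosing the interval
      of line \<open>j\<close>. They exist because \<open>0\<close> and \<open>length w\<close> are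
      always contacts.\<close>
    define a where "a = Max {c. c \<le> j \<and> ?W c = sum g {..<c}}"
    define b where "b = Min {c. j < c \<and> c \<le> ?n \<and> ?W c = sum g {..<c}}"
    have "a \<in> {c. c \<le> j \<and> ?W c = sum g {..<c}}"
      unfolding a_def by (rule Max_in) (auto intro: exI[of _ 0])
    then have a: "a \<le> j" "?W a = sum g {..<a}" by auto
    have "b \<in> {c. j < c \<and> c \<le> ?n \<and> ?W c = sum g {..<c}}"
      unfolding b_def using j(1) lcm_slopes_total[OF g] by (intro Min_in) auto
    then have b: "j < b" "b \<le> ?n" "?W b = sum g {..<b}" by auto
    have amax: "c \<le> a" if "c \<le> j" "?W c = sum g {..<c}" for c
      unfolding a_def using that by (intro Max_ge) auto
    have bmin: "b \<le> c" if "j < c" "c \<le> ?n" "?W c = sum g {..<c}" for c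
      unfolding b_def using that by (intro Min_le) auto
    have const: "g i = g a" if "a \<le> i" "i < b" for i
      using that
    proof (rule lcm_slopes_const_between_contacts[OF g b(2), rotated])
      fix c assume "a < c" "c < b" then show "?W c \<noteq> sum g {..<c}"
        using amax[of c] bmin[of c] b(2) by (cases "c \<le> j") auto
    qed
    have gsum: "sum g {..<c} = sum g {..<a} + real (c - a) * g a" if "a \<le> c" "c \<le> b" for c
    proof -
      have "(\<Sum>i<c - a. g (a + i)) = (\<Sum>i<c - a. g a)"
        by (rule sum.cong[OF refl], rule const) (use that in auto)
      then show ?thesis using sum_lessThan_add[of g a "c - a"] that by simp
    qed
    define u where "u = (t - (real a - 1)) / real (b - a)"
    have ab: "real (b - a) > 0" "real (b - a) = real b - real a" using a b by auto
    have u: "0 \<le> u" "u \<le> 1" using ab a(1) b(1) j unfolding u_def by (auto simp: field_simps)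
    have uab: "u * real (b - a) = t - (real a - 1)" using ab by (simp add: u_def)
    have t: "(1 - u) *\<^sub>R (real a - 1) + u *\<^sub>R (real b - 1) = t"
      using uab ab(2) by (simp add: algebra_simps)
    have "?F t = sum g {..<a} + g a * (t - (real a - 1))"
      using F[OF j] gsum[of j] a b const[of j] by (simp add: majorant_line_def algebra_simps of_nat_diff)
    also have "\<dots> = (1 - u) * sum g {..<a} + u * (sum g {..<a} + real (b - a) * g a)"
      unfolding uab[symmetric] by (simp add: algebra_simps)
    also have "\<dots> = (1 - u) * ?W a + u * ?W b"
      using a b gsum[of b] by simp
    also have "\<dots> \<le> (1 - u) * f (real a - 1) + u * f (real b - 1)"
      using fW[of a] fW[of b] a b j(1) u by (intro add_mono mult_left_mono) auto
    also have "\<dots> \<le> f ((1 - u) *\<^sub>R (real a - 1) + u *\<^sub>R (real b - 1))"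
      using a b j(1) by (intro concave_onD[OF conc] u) (auto simp: hull_partial_sum_points)
    finally show ?thesis by (simp only: t)
  qed
  have "least_concave_majorant (partial_sum_points w) t = ?F t"
    unfolding least_concave_majorant_def using least by (intro cInf_eq_minimum[OF mem]) blast
  then show ?thesis using F[OF j] by simp
qed

lemma left_slope_eq:
  assumes "d > 0" "\<And>s. t - d \<le> s \<Longrightarrow> s \<le> t \<Longrightarrow> f s = a + m * s"
  shows "left_slope f t = m"
proof -
  have *: "(f has_real_derivative m) (at_left t)"
    unfolding has_field_derivative_iff
  proof (rule tendsto_eventually)
    show "\<forall>\<^sub>F s in at_left t. (f s - f t) / (s - t) = m"
      unfolding eventually_at_left_field
    proof (intro exI[of _ "t - d"] conjI allI impI)
      fix s assume "t - d < s" "s < t"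
      then show "(f s - f t) / (s - t) = m" using assms by (simp add: field_simps)
    qed (use assms(1) in simp)
  qed
  show ?thesis unfolding left_slope_def
  proof (rule the_equality)
    show "(f has_real_derivative m) (at_left t)" by (rule *)
  next
    fix m' assume "(f has_real_derivative m') (at_left t)"
    with * show "m' = m" unfolding has_field_derivative_iff
      by (intro tendsto_unique[OF trivial_limit_at_left_real])
  qed
qed

lemma gren_eq:
  assumes "lcm_slopes (length w) (\<lambda>i. w ! i) g"
  shows "gren w = map g [0..<length w]"
  unfolding gren_def
proof (rule map_cong[OF refl])
  fix j assume "j \<in> set [0..<length w]"
  then have j: "j < length w" by simp
  show "left_slope (least_concave_majorant (partial_sum_points w)) (real j) = g j"
  proof (rule left_slope_eq[of 1])
    fix s assume "real j - 1 \<le> s" "s \<le> real j"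
    then show "least_concave_majorant (partial_sum_points w) s
        = (sum g {..<j} - g j * (real j - 1)) + g j * s"
      using least_concave_majorant_eq[OF assms j] by (simp add: majorant_line_def algebra_simps)
  qed simp
qed

lemma lcm_slopes_gren: "lcm_slopes (length w) (\<lambda>i. w ! i) (\<lambda>i. gren w ! i)"
proof -
  obtain g where g: "lcm_slopes (length w) (\<lambda>i. w ! i) g" using lcm_slopes_exists by blast
  then show ?thesis using gren_eq[OF g] by (subst lcm_slopes_cong[where w' = "\<lambda>i. w ! i" and g' = g]) auto
qed

lemma gren_eqI:
  assumes "lcm_slopes (length w) (\<lambda>i. w ! i) (\<lambda>i. v ! i)" "length v = length w"
  shows "gren w = v"
  using gren_eq[OF assms(1)] assms(2) map_nth[of v] by simp

lemma lcm_slopes_affine: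
  assumes g: "lcm_slopes n w g" and "a > 0"
  shows "lcm_slopes n (\<lambda>i. a * w i + b) (\<lambda>i. a * g i + b)"
proof -
  have s: "sum (\<lambda>i. a * f i + b) {..<j} = a * sum f {..<j} + real j * b" for f :: "nat \<Rightarrow> real" and j
    by (simp add: sum.distrib sum_distrib_left)
  show ?thesis
    using g \<open>a > 0\<close> unfolding lcm_slopes_def s by (auto simp del: sum.lessThan_Suc)
qed

interpretation gren: isotonic_operator gren
proof
  fix u v :: "real list" assume "length u = length v"
  then show "(\<Sum>i<length u. (gren u ! i - gren v ! i)\<^sup>2) \<le> (\<Sum>i<length u. (u ! i - v ! i)\<^sup>2)"
    using lcm_slopes_gren[of u] lcm_slopes_gren[of v] by (intro lcm_slopes_nonexpansive) auto
next
  fix w :: "real list" assume w: "sorted_wrt (\<ge>) w"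
  have "w ! j \<le> w ! i" if "i \<le> j" "j < length w" for i j
    using w that by (cases "i = j") (auto simp: sorted_wrt_iff_nth_less)
  then show "gren w = w"
    by (intro gren_eqI) (auto simp: lcm_slopes_def)
next
  fix a b :: real and w assume "a > 0"
  then have "lcm_slopes (length w) (\<lambda>i. a * w ! i + b) (\<lambda>i. a * gren w ! i + b)"
    by (intro lcm_slopes_affine lcm_slopes_gren)
  then show "gren (map (\<lambda>x. a * x + b) w) = map (\<lambda>x. a * x + b) (gren w)"
    by (intro gren_eqI, subst lcm_slopes_cong[where w' = "\<lambda>i. a * w ! i + b" and g' = "\<lambda>i. a * gren w ! i + b"])
      auto
next
  fix u v :: "real list" assume uv: "\<forall>x\<in>set u. \<forall>y\<in>set v. y \<le> x"
  \<comment> \<open>The least entry of \<open>u\<close> separates the two groups of slopes: it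
    bounds those of \<open>u\<close> from below and those of \<open>v\<close> from above.\<close>
  have le: "gren v ! j \<le> gren u ! i" if "i < length u" "j < length v" for i j
  proof -
    define c where "c = Min (set u)"
    have ne: "set u \<noteq> {}" using that by auto
    have "c \<le> gren u ! i"
    proof (rule lcm_slopes_lower_bound[OF lcm_slopes_gren _ that(1)])
      fix i assume "i < length u" then show "c \<le> u ! i" unfolding c_def by (intro Min_le) auto
    qed
    moreover have "gren v ! j \<le> c"
    proof (rule lcm_slopes_upper_bound[OF lcm_slopes_gren _ that(2)])
      fix j assume "j < length v"
      moreover have "c \<in> set u" unfolding c_def using ne by (intro Min_in) auto
      ultimately show "v ! j \<le> c" using uv by auto
    qed
    ultimately show ?thesis by simp
  qed
  have "lcm_slopes (length u + length v) (\<lambda>i. (u @ v) ! i)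
      (\<lambda>i. if i < length u then gren u ! i else gren v ! (i - length u))"
  proof (rule lcm_slopes_append)
    show "lcm_slopes (length u) (\<lambda>i. (u @ v) ! i) (\<lambda>i. gren u ! i)"
      using lcm_slopes_gren[of u] by (subst lcm_slopes_cong[where w' = "\<lambda>i. u ! i" and g' = "\<lambda>i. gren u ! i"]) (auto simp: nth_append)
    show "lcm_slopes (length v) (\<lambda>i. (u @ v) ! (length u + i)) (\<lambda>i. gren v ! i)"
      using lcm_slopes_gren[of v] by simp
  qed (rule le)
  then show "gren (u @ v) = gren u @ gren v"
    by (intro gren_eqI) (simp_all add: nth_append cong: if_cong)
qed simp

subsection \<open>Norm and coordinates in \<open>\<ell>\<^sub>2\<close>\<close>

lemma Rep_ell2_minus: "Rep_ell2 (f - g) x = Rep_ell2 f x - Rep_ell2 g x"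
  unfolding minus_ell2_def by (simp only: Rep_ell2_simps diff_conv_add_uminus)

lemma summable_Rep_ell2_sq: "summable (\<lambda>x. (Rep_ell2 f x)\<^sup>2)"
  using square_summable_Rep[of f] by (simp add: square_summable_def)

lemma norm_ell2_sq: "(norm f)\<^sup>2 = (\<Sum>x. (Rep_ell2 f x)\<^sup>2)"
proof -
  have "(norm f)\<^sup>2 = inner f f" by (simp add: power2_norm_eq_inner)
  then show ?thesis by (simp add: inner_ell2_def power2_eq_square)
qed

text \<open>Only arbitrarily long initial segments need to be bounded, because blockwise estimates
  are available at cuts alone.\<close>

lemma norm_ell2_leI:
  assumes "\<And>m. \<exists>K\<ge>m. (\<Sum>x<K. (Rep_ell2 f x)\<^sup>2) \<le> B\<^sup>2" "0 \<le> B"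
  shows "norm f \<le> B"
proof (rule power2_le_imp_le)
  have "(\<Sum>x. (Rep_ell2 f x)\<^sup>2) \<le> B\<^sup>2"
  proof (rule suminf_le_const[OF summable_Rep_ell2_sq])
    fix m
    obtain K where "K \<ge> m" "(\<Sum>x<K. (Rep_ell2 f x)\<^sup>2) \<le> B\<^sup>2" using assms(1) by blast
    then show "(\<Sum>x<m. (Rep_ell2 f x)\<^sup>2) \<le> B\<^sup>2"
      using sum_mono2[of "{..<K}" "{..<m}" "\<lambda>x. (Rep_ell2 f x)\<^sup>2"] by auto
  qed
  then show "(norm f)\<^sup>2 \<le> B\<^sup>2" by (simp add: norm_ell2_sq)
qed (rule assms(2))

definition tail_sq :: "nat \<Rightarrow> ell2 \<Rightarrow> real" where
  "tail_sq K f = (\<Sum>x. (Rep_ell2 f (x + K))\<^sup>2)"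

lemma tail_sq_eq: "tail_sq K f = (norm f)\<^sup>2 - (\<Sum>x<K. (Rep_ell2 f x)\<^sup>2)"
  using suminf_minus_initial_segment[OF summable_Rep_ell2_sq[of f], of K]
  by (simp add: tail_sq_def norm_ell2_sq)

lemma tail_sq_nonneg: "0 \<le> tail_sq K f"
  unfolding tail_sq_def
  by (intro suminf_nonneg summable_ignore_initial_segment summable_Rep_ell2_sq) simp

lemma sum_sq_le_tail_sq: "(\<Sum>x = K..<m. (Rep_ell2 f x)\<^sup>2) \<le> tail_sq K f"
proof (cases "K \<le> m")
  case True
  have "(\<Sum>x = K..<m. (Rep_ell2 f x)\<^sup>2) + (\<Sum>x<K. (Rep_ell2 f x)\<^sup>2) = (\<Sum>x<m. (Rep_ell2 f x)\<^sup>2)"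
    using sum.atLeastLessThan_concat[of 0 K m "\<lambda>x. (Rep_ell2 f x)\<^sup>2"] True
    by (simp add: lessThan_atLeast0 add.commute)
  moreover have "(\<Sum>x<m. (Rep_ell2 f x)\<^sup>2) \<le> (norm f)\<^sup>2"
    unfolding norm_ell2_sq by (intro sum_le_suminf summable_Rep_ell2_sq) auto
  ultimately show ?thesis by (simp add: tail_sq_eq)
qed (simp add: tail_sq_nonneg)

lemma tail_sq_0: "tail_sq 0 f = (norm f)\<^sup>2"
  by (simp add: tail_sq_eq)

lemma abs_Rep_ell2_le_norm: "\<bar>Rep_ell2 f x\<bar> \<le> norm f"
proof (rule power2_le_imp_le)
  have "(Rep_ell2 f x)\<^sup>2 \<le> (\<Sum>x = 0..<Suc x. (Rep_ell2 f x)\<^sup>2)"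
    by (rule member_le_sum) auto
  also have "\<dots> \<le> (norm f)\<^sup>2" using sum_sq_le_tail_sq[where K = 0] by (simp only: tail_sq_0)
  finally show "\<bar>Rep_ell2 f x\<bar>\<^sup>2 \<le> (norm f)\<^sup>2" by simp
qed simp

lemma lipschitz_Rep_ell2: "lipschitz_on 1 S (\<lambda>f. Rep_ell2 f x)"
  by (rule lipschitz_onI)
    (simp_all add: dist_real_def dist_ell2_def abs_Rep_ell2_le_norm flip: Rep_ell2_minus)

lemma continuous_on_Rep_ell2: "continuous_on S (\<lambda>f. Rep_ell2 f x)"
  by (rule lipschitz_on_continuous_on[OF lipschitz_Rep_ell2])

lemma borel_measurable_Rep_ell2 [measurable]: "(\<lambda>f. Rep_ell2 f x) \<in> borel_measurable borel"
  by (rule borel_measurable_continuous_onI[OF continuous_on_Rep_ell2])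

lemma borel_measurable_tail_sq [measurable]: "tail_sq K \<in> borel_measurable borel"
  unfolding tail_sq_eq[abs_def] by measurable

lemma square_summable_finite_support:
  assumes "\<And>x. x \<ge> m \<Longrightarrow> f x = 0"
  shows "square_summable f"
  unfolding square_summable_def
  by (rule summable_finite[of "{..<m}"]) (use assms in \<open>auto simp: not_less\<close>)

subsection \<open>Cuts and the block transform\<close>

locale decreasing_null_sequence =
  fixes p :: "nat \<Rightarrow> real"
  assumes decseq: "decseq p" and null: "p \<longlonglongrightarrow> 0"
begin

lemma p_nonneg: "0 \<le> p x"
  using decseq_ge[OF decseq null] .

lemma p_antimono: "x \<le> y \<Longrightarrow> p y \<le> p x"
  using decseq by (simp add: decseq_def)

text \<open>Beyond the support of \<open>p\<close> every index is a cut, so that cuts are always unbounded.\<close>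

definition cut :: "nat \<Rightarrow> bool" where
  "cut b \<longleftrightarrow> b = 0 \<or> p b < p (b - 1) \<or> p (b - 1) = 0"

lemma cut_0: "cut 0"
  by (simp add: cut_def)

lemma cuts_unbounded: "\<exists>K\<ge>m. cut K"
proof (cases "p m = 0")
  case True
  then show ?thesis by (intro exI[of _ "Suc m"]) (simp add: cut_def)
next
  case False
  then have "0 < p m" using p_nonneg[of m] by simp
  then have "\<exists>k. p k < p m"
    using order_tendstoD(2)[OF null \<open>0 < p m\<close>] unfolding eventually_sequentially by blast
  define K where "K = (LEAST k. p k < p m)"
  have K: "p K < p m" unfolding K_def using \<open>\<exists>k. p k < p m\<close> by (rule LeastI_ex)
  have Km: "m < K" using K p_antimono[of K m] by (cases "K \<le> m") auto
  then have "\<not> p (K - 1) < p m" unfolding K_def by (intro not_less_Least) simp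
  then have "cut K" using K unfolding cut_def by linarith
  then show ?thesis using Km by (intro exI[of _ K]) simp
qed

text \<open>Induction over successive cuts reduces statements about many blocks to a single one. The
  free starting cut \<open>K0\<close> allows it to be used on tails as well.\<close>

lemma cut_induct [consumes 3, case_names base step]:
  assumes "cut K0" "cut K" "K0 \<le> K"
    and base: "P K0"
    and step: "\<And>b c. K0 \<le> b \<Longrightarrow> b < c \<Longrightarrow> c \<le> K \<Longrightarrow> cut b \<Longrightarrow> cut c \<Longrightarrow>
      (\<And>d. b < d \<Longrightarrow> d < c \<Longrightarrow> \<not> cut d) \<Longrightarrow> P b \<Longrightarrow> P c"
  shows "P K"
proof -
  have "c \<le> K \<Longrightarrow> cut c \<Longrightarrow> K0 \<le> c \<Longrightarrow> P c" for c
  proof (induction c rule: less_induct)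
    case (less c)
    show ?case
    proof (cases "c = K0")
      case False
      let ?B = "{b. K0 \<le> b \<and> b < c \<and> cut b}"
      define b where "b = Max ?B"
      have "K0 \<in> ?B" using False less.prems assms(1) by simp
      then have "b \<in> ?B" unfolding b_def by (intro Max_in) (simp, blast)
      moreover have "\<not> cut d" if "b < d" "d < c" for d
      proof
        assume "cut d"
        then have "d \<le> b" unfolding b_def using that calculation by (intro Max_ge) auto
        then show False using that by simp
      qed
      ultimately show ?thesis using less.prems less.IH[of b] by (intro step[of b c]) auto
    qed (simp add: base)
  qed
  then show ?thesis using assms by blast
qed

lemma const_between_cuts:
  assumes "\<And>d. b < d \<Longrightarrow> d < c \<Longrightarrow> \<not> cut d" "b \<le> x" "x < c"
  shows "p x = p b"
  using assms(2,3)
proof (induction x rule: dec_induct)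
  case (step x)
  have "\<not> cut (Suc x)" using step by (intro assms(1)) auto
  then have "p x \<le> p (Suc x)" by (simp add: cut_def)
  then show ?case using p_antimono[of x "Suc x"] step by simp
qed simp

text \<open>Since \<open>Suc b\<close> is not a cut, \<open>p b\<close> is positive. So neither end
  is a cut merely through the convention for zeros: \<open>c\<close> is a genuine drop, and so is
  \<open>b\<close> unless it is 0.\<close>

lemma constancy_period_between_cuts:
  assumes "cut b" "cut c" "Suc b < c" "\<And>d. b < d \<Longrightarrow> d < c \<Longrightarrow> \<not> cut d"
  shows "constancy_period p b (c - 1)"
proof -
  have nz: "p b \<noteq> 0" using assms(4)[of "Suc b"] assms(3) by (simp add: cut_def)
  have const: "p x = p b" if "x \<in> {b..c - 1}" for x
    using that assms(3) by (intro const_between_cuts[OF assms(4)]) auto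
  have "p (b - 1) > p b" if "b \<noteq> 0"
    using assms(1) that nz p_antimono[of "b - 1" b] p_nonneg[of b] by (auto simp: cut_def)
  moreover have "p c < p (c - 1)"
    using assms(2,3) nz const[of "c - 1"] by (auto simp: cut_def)
  moreover have "b < c - 1" "Suc (c - 1) = c" using assms(3) by auto
  ultimately show ?thesis unfolding constancy_period_def
    using const by metis
qed

text \<open>On a period \<open>p\<close> is positive, as it still drops afterwards without becoming
  negative. Both cuts are then genuine drops, up to the start at 0, and isolate \<open>b\<close>,
  whereas a period has at least two points.\<close>

lemma not_in_constancy_period:
  assumes "cut b" "cut (Suc b)" "constancy_period p r s"
  shows "b \<notin> {r..s}"
proof
  assume b: "b \<in> {r..s}"
  have rs: "r < s" "p s > p (Suc s)" and const: "\<And>x. x \<in> {r..s} \<Longrightarrow> p x = p r"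
    using assms(3) unfolding constancy_period_def by blast+
  have pos: "p b > 0" using const[OF b] const[of s] rs p_nonneg[of "Suc s"] by simp
  have "s = b"
  proof (rule ccontr)
    assume "s \<noteq> b"
    then have "p (Suc b) = p b" using b const[of "Suc b"] const[of b] by simp
    then show False using assms(2) pos by (simp add: cut_def)
  qed
  then have "p (b - 1) = p b" using const[of "b - 1"] const[of b] rs by simp
  then show False using assms(1) pos rs \<open>s = b\<close> by (simp add: cut_def)
qed

end

locale block_transform = decreasing_null_sequence p + isotonic_operator T for p T
begin

lemma T_singleton: "T [x] = [x]"
  by (rule fixes_decreasing) simp

text \<open>A single point is fixed by \<open>T\<close>, so isolated indices and periods of
  constancy obey one formula and need no distinction from here on.\<close>

lemma blockwise_between_cuts:
  assumes "cut b" "cut c" "b < c" "\<And>d. b < d \<Longrightarrow> d < c \<Longrightarrow> \<not> cut d"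
  shows "map (blockwise p T y) [b..<c] = T (map y [b..<c])"
proof (cases "c = Suc b")
  case True
  then have "blockwise p T y b = y b"
    using assms not_in_constancy_period by (intro blockwise_off_periods) auto
  then show ?thesis using True by (simp add: T_singleton)
next
  case False
  then have "constancy_period p b (c - 1)"
    using assms by (intro constancy_period_between_cuts) auto
  from blockwise_on_period[OF this, of T y] show ?thesis using assms(3) by simp
qed

lemma blockwise_nth_between_cuts:
  assumes "cut b" "cut c" "b < c" "\<And>d. b < d \<Longrightarrow> d < c \<Longrightarrow> \<not> cut d" "b \<le> x" "x < c"
  shows "blockwise p T y x = T (map y [b..<c]) ! (x - b)"
proof -
  have "map (blockwise p T y) [b..<c] ! (x - b) = T (map y [b..<c]) ! (x - b)"
    using blockwise_between_cuts[OF assms(1-4)] by simp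
  then show ?thesis using assms(5,6) by simp
qed

lemma nonexpansive_interval:
  assumes "b \<le> c"
  shows "(\<Sum>x = b..<c. (T (map u [b..<c]) ! (x - b) - T (map v [b..<c]) ! (x - b))\<^sup>2)
       \<le> (\<Sum>x = b..<c. (u x - v x)\<^sup>2)"
  unfolding sum_atLeastLessThan_shift[OF assms]
  using nonexpansive[of "map u [b..<c]" "map v [b..<c]"] by simp

lemma blockwise_nonexpansive_interval:
  assumes "cut K0" "cut K" "K0 \<le> K"
  shows "(\<Sum>x = K0..<K. (blockwise p T u x - blockwise p T v x)\<^sup>2) \<le> (\<Sum>x = K0..<K. (u x - v x)\<^sup>2)"
  using assms
proof (induction rule: cut_induct)
  case (step b c)
  have "(\<Sum>x = b..<c. (blockwise p T u x - blockwise p T v x)\<^sup>2)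
      = (\<Sum>x = b..<c. (T (map u [b..<c]) ! (x - b) - T (map v [b..<c]) ! (x - b))\<^sup>2)"
    using step by (intro sum.cong refl) (simp add: blockwise_nth_between_cuts[of b c])
  also have "\<dots> \<le> (\<Sum>x = b..<c. (u x - v x)\<^sup>2)"
    using step by (intro nonexpansive_interval) simp
  finally have "(\<Sum>x = b..<c. (blockwise p T u x - blockwise p T v x)\<^sup>2) \<le> (\<Sum>x = b..<c. (u x - v x)\<^sup>2)" .
  moreover have "(\<Sum>x = K0..<c. F x) = (\<Sum>x = K0..<b. F x) + (\<Sum>x = b..<c. F x)" for F :: "nat \<Rightarrow> real"
    using step by (simp add: sum.atLeastLessThan_concat)
  ultimately show ?case using step.IH by simp
qed simp

lemma blockwise_zero: "blockwise p T (\<lambda>_. 0) x = 0"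
proof -
  obtain K where K: "K \<ge> Suc x" "cut K" using cuts_unbounded by blast
  have "\<forall>x<K. blockwise p T (\<lambda>_. 0) x = 0"
    using cut_0 K(2) le0
  proof (induction rule: cut_induct)
    case (step b c)
    have "T (map (\<lambda>_. 0) [b..<c]) = map (\<lambda>_. 0) [b..<c]"
      by (rule fixes_decreasing) (simp add: sorted_wrt_iff_nth_less)
    then have "blockwise p T (\<lambda>_. 0) x = 0" if "b \<le> x" "x < c" for x
      using that step by (subst blockwise_nth_between_cuts[of b c]) auto
    then show ?case using step.IH by (meson not_le)
  qed simp
  then show ?thesis using K(1) by simp
qed

lemma blockwise_sq_interval_le:
  assumes "cut K0" "cut K" "K0 \<le> K"
  shows "(\<Sum>x = K0..<K. (blockwise p T u x)\<^sup>2) \<le> (\<Sum>x = K0..<K. (u x)\<^sup>2)"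
  using blockwise_nonexpansive_interval[OF assms, of u "\<lambda>_. 0"] by (simp add: blockwise_zero)

lemma square_summable_blockwise:
  assumes "square_summable y"
  shows "square_summable (blockwise p T y)"
  unfolding square_summable_def
proof (rule summableI_nonneg_bounded)
  fix m
  obtain K where K: "K \<ge> m" "cut K" using cuts_unbounded by blast
  have "(\<Sum>x<m. (blockwise p T y x)\<^sup>2) \<le> (\<Sum>x = 0..<K. (blockwise p T y x)\<^sup>2)"
    using K(1) by (intro sum_mono2) auto
  also have "\<dots> \<le> (\<Sum>x = 0..<K. (y x)\<^sup>2)"
    by (rule blockwise_sq_interval_le[OF cut_0 K(2)]) simp
  also have "\<dots> \<le> (\<Sum>x. (y x)\<^sup>2)"
    using assms by (intro sum_le_suminf) (auto simp: square_summable_def)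
  finally show "(\<Sum>x<m. (blockwise p T y x)\<^sup>2) \<le> (\<Sum>x. (y x)\<^sup>2)" .
qed simp

definition block_map :: "ell2 \<Rightarrow> ell2" where
  "block_map f = Abs_ell2 (blockwise p T (Rep_ell2 f))"

lemma Rep_block_map: "Rep_ell2 (block_map f) = blockwise p T (Rep_ell2 f)"
  unfolding block_map_def by (intro Rep_Abs_ell2 square_summable_blockwise square_summable_Rep)

lemma lipschitz_block_map: "lipschitz_on 1 S block_map"
proof (rule lipschitz_onI)
  fix f g :: ell2
  have "norm (block_map f - block_map g) \<le> norm (f - g)"
  proof (rule norm_ell2_leI)
    fix m
    obtain K where K: "K \<ge> m" "cut K" using cuts_unbounded by blast
    have "(\<Sum>x<K. (Rep_ell2 (block_map f - block_map g) x)\<^sup>2) \<le> (\<Sum>x = 0..<K. (Rep_ell2 (f - g) x)\<^sup>2)"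
      using blockwise_nonexpansive_interval[OF cut_0 K(2), of "Rep_ell2 f" "Rep_ell2 g"]
      by (simp add: Rep_ell2_minus Rep_block_map lessThan_atLeast0)
    also have "\<dots> \<le> (norm (f - g))\<^sup>2" using sum_sq_le_tail_sq[of "f - g" 0 K] by (simp add: tail_sq_0)
    finally show "\<exists>K\<ge>m. (\<Sum>x<K. (Rep_ell2 (block_map f - block_map g) x)\<^sup>2) \<le> (norm (f - g))\<^sup>2"
      using K(1) by blast
  qed simp
  then show "dist (block_map f) (block_map g) \<le> 1 * dist f g" by (simp add: dist_norm)
qed simp

subsection \<open>Localization of the estimator\<close>

text \<open>The length of the empirical vector is random. Trailing zeros lie below all other entries
  and split off unchanged, so the estimator may be computed on any longer window, in particular one
  that reaches a chosen cut.\<close>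

lemma extend_by_zero_pad:
  assumes "\<And>x. 0 \<le> q x" "\<And>x. x \<ge> m \<Longrightarrow> q x = 0" "m \<le> m'"
  shows "extend_by_zero (T (map q [0..<m])) = extend_by_zero (T (map q [0..<m']))"
proof -
  have "map q [0..<m'] = map q [0..<m] @ map q [m..<m']"
    using assms(3) by (metis le_add_diff_inverse map_append upt_add_eq_append zero_le)
  also have "map q [m..<m'] = replicate (m' - m) 0"
    using assms(2) by (intro nth_equalityI) auto
  finally have "T (map q [0..<m']) = T (map q [0..<m]) @ T (replicate (m' - m) 0)"
    using assms(1) by (simp add: split_append)
  also have "T (replicate (m' - m) 0) = replicate (m' - m) 0"
    by (intro fixes_decreasing) (simp add: sorted_wrt_iff_nth_less)
  finally show ?thesis
    by (auto simp: extend_by_zero_def fun_eq_iff nth_append)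
qed

context
  fixes q :: "nat \<Rightarrow> real" and m K :: nat and a :: real
  assumes q_nonneg: "\<And>x. 0 \<le> q x" and q_support: "\<And>x. x \<ge> m \<Longrightarrow> q x = 0"
    and a: "a > 0"
    and K: "cut K"
    and splits: "\<And>b x y. b \<le> K \<Longrightarrow> cut b \<Longrightarrow> x < b \<Longrightarrow> b \<le> y \<Longrightarrow> q y \<le> q x"
begin

lemma T_split_at_cut:
  assumes "b \<le> K" "cut b" "b \<le> c"
  shows "T (map q [0..<c]) = T (map q [0..<b]) @ T (map q [b..<c])"
proof -
  have "[0..<c] = [0..<b] @ [b..<c]"
    using assms(3) by (metis le_add_diff_inverse upt_add_eq_append zero_le)
  then show ?thesis using splits[OF assms(1,2)] by (simp add: split_append)
qed

text \<open>On a block \<open>p\<close> is the constant \<open>p b\<close>. Centring and scaling are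
  then a single affine map with slope \<open>a > 0\<close>, which passes through
  \<open>T\<close>.\<close>

lemma estimator_eq_below_cut:
  assumes "x < K"
  shows "a * (extend_by_zero (T (map q [0..<m])) x - p x) = blockwise p T (\<lambda>x. a * (q x - p x)) x"
proof -
  let ?Z = "\<lambda>x. a * (q x - p x)"
  have main: "\<forall>x<K. a * (T (map q [0..<K]) ! x - p x) = blockwise p T ?Z x"
    using cut_0 K le0
  proof (induction rule: cut_induct)
    case (step b c)
    show ?case
    proof (intro allI impI)
      fix x assume "x < c"
      have eq: "T (map q [0..<c]) = T (map q [0..<b]) @ T (map q [b..<c])"
        using step by (intro T_split_at_cut) auto
      show "a * (T (map q [0..<c]) ! x - p x) = blockwise p T ?Z x"
      proof (cases "x < b")
        case True
        then show ?thesis using step.IH by (simp add: eq nth_append)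
      next
        case False
        then have x: "b \<le> x" "x < c" using \<open>x < c\<close> by auto
        have const: "p z = p b" if "b \<le> z" "z < c" for z
          using that step by (intro const_between_cuts[of b c]) auto
        have "map ?Z [b..<c] = map (\<lambda>t. a * t + - a * p b) (map q [b..<c])"
          by (rule nth_equalityI) (use const[of "b + _"] in \<open>simp_all add: algebra_simps\<close>)
        then have "T (map ?Z [b..<c]) = map (\<lambda>t. a * t + - a * p b) (T (map q [b..<c]))"
          by (simp only: map_affine[OF a])
        then have "T (map ?Z [b..<c]) ! (x - b) = a * T (map q [b..<c]) ! (x - b) + - a * p b"
          using x by simp
        moreover have "blockwise p T ?Z x = T (map ?Z [b..<c]) ! (x - b)"
          using step x by (intro blockwise_nth_between_cuts) auto
        ultimately show ?thesis using False const[OF x] by (simp add: eq nth_append algebra_simps)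
      qed
    qed
  qed simp
  \<comment> \<open>The cut \<open>K\<close> may lie on either side of the sample maximum; the
    padded window contains both.\<close>
  define m' where "m' = max m K"
  have "extend_by_zero (T (map q [0..<m])) x = extend_by_zero (T (map q [0..<m'])) x"
    by (rule fun_cong[OF extend_by_zero_pad[OF q_nonneg q_support]]) (simp_all add: m'_def)
  also have "\<dots> = T (map q [0..<K]) ! x"
    using assms T_split_at_cut[OF order_refl K, of m']
    by (simp add: extend_by_zero_def m'_def nth_append)
  finally show ?thesis using main assms by simp
qed

text \<open>Beyond \<open>K\<close> the sequence \<open>p\<close> varies, but its restriction is
  nonincreasing and hence fixed by \<open>T\<close>. Nonexpansiveness applied to \<open>q\<close>
  and \<open>p\<close> gives the bound without any separation inside the tail.\<close>

lemma estimator_sq_beyond_cut: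
  assumes "m \<le> M" "K \<le> M"
  shows "(\<Sum>x = K..<M. (a * (extend_by_zero (T (map q [0..<m])) x - p x))\<^sup>2)
       \<le> (\<Sum>x = K..<M. (a * (q x - p x))\<^sup>2)"
proof -
  have est: "extend_by_zero (T (map q [0..<m])) x = T (map q [K..<M]) ! (x - K)" if "x \<in> {K..<M}" for x
  proof -
    have "extend_by_zero (T (map q [0..<m])) x = extend_by_zero (T (map q [0..<M])) x"
      by (simp add: extend_by_zero_pad[OF q_nonneg q_support assms(1)])
    also have "\<dots> = T (map q [K..<M]) ! (x - K)"
      using that T_split_at_cut[OF order_refl K assms(2)]
      by (simp add: extend_by_zero_def nth_append)
    finally show ?thesis .
  qed
  have "T (map p [K..<M]) = map p [K..<M]"
    by (rule fixes_decreasing) (auto simp: sorted_wrt_iff_nth_less intro!: p_antimono)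
  then have pT: "p x = T (map p [K..<M]) ! (x - K)" if "x \<in> {K..<M}" for x
    using that by (simp add: diff_less_mono)
  have "(\<Sum>x = K..<M. (extend_by_zero (T (map q [0..<m])) x - p x)\<^sup>2)
      = (\<Sum>x = K..<M. (T (map q [K..<M]) ! (x - K) - T (map p [K..<M]) ! (x - K))\<^sup>2)"
    using est pT by (intro sum.cong refl) presburger
  also have "\<dots> \<le> (\<Sum>x = K..<M. (q x - p x)\<^sup>2)" by (rule nonexpansive_interval[OF assms(2)])
  finally show ?thesis
    by (simp add: power_mult_distrib mult_left_mono flip: sum_distrib_left)
qed

text \<open>The two sequences agree below \<open>K\<close>, and beyond it each has squared norm at
  most \<open>tail_sq K Z\<close>. The factor 2 comes from
  \<open>(x - y)\<^sup>2 \<le> 2 * x\<^sup>2 + 2 * y\<^sup>2\<close>.\<close>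

lemma norm_estimator_block_map_le:
  assumes Z: "\<And>x. Rep_ell2 Z x = a * (q x - p x)"
    and E: "\<And>x. Rep_ell2 E x = a * (extend_by_zero (T (map q [0..<m])) x - p x)"
  shows "norm (E - block_map Z) \<le> 2 * sqrt (tail_sq K Z)"
proof (rule norm_ell2_leI)
  fix l
  obtain M where M: "M \<ge> max l (max m K)" "cut M" using cuts_unbounded by blast
  let ?d = "\<lambda>x. Rep_ell2 (E - block_map Z) x"
  have RZ: "Rep_ell2 Z = (\<lambda>x. a * (q x - p x))" by (rule ext) (rule Z)
  have d0: "?d x = 0" if "x < K" for x
    using estimator_eq_below_cut[OF that] by (simp add: Rep_ell2_minus Rep_block_map E RZ)
  have "(\<Sum>x<M. (?d x)\<^sup>2) = (\<Sum>x = 0..<K. (?d x)\<^sup>2) + (\<Sum>x = K..<M. (?d x)\<^sup>2)"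
    using M by (simp add: sum.atLeastLessThan_concat lessThan_atLeast0)
  also have "(\<Sum>x = 0..<K. (?d x)\<^sup>2) = 0" by (intro sum.neutral) (simp add: d0)
  also have "0 + (\<Sum>x = K..<M. (?d x)\<^sup>2)
      \<le> (\<Sum>x = K..<M. 2 * (Rep_ell2 E x)\<^sup>2 + 2 * (Rep_ell2 (block_map Z) x)\<^sup>2)"
    unfolding add_0_left
  proof (rule sum_mono)
    fix x
    show "(?d x)\<^sup>2 \<le> 2 * (Rep_ell2 E x)\<^sup>2 + 2 * (Rep_ell2 (block_map Z) x)\<^sup>2"
      using zero_le_power2[of "Rep_ell2 E x + Rep_ell2 (block_map Z) x"]
      by (simp add: Rep_ell2_minus power2_eq_square algebra_simps)
  qed
  also have "\<dots> = 2 * (\<Sum>x = K..<M. (Rep_ell2 E x)\<^sup>2) + 2 * (\<Sum>x = K..<M. (Rep_ell2 (block_map Z) x)\<^sup>2)"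
    by (simp add: sum.distrib sum_distrib_left)
  also have "\<dots> \<le> 2 * tail_sq K Z + 2 * tail_sq K Z"
  proof (intro add_mono mult_left_mono)
    have "(\<Sum>x = K..<M. (Rep_ell2 E x)\<^sup>2) \<le> (\<Sum>x = K..<M. (Rep_ell2 Z x)\<^sup>2)"
      using estimator_sq_beyond_cut[of M] M(1) by (simp add: E Z)
    then show "(\<Sum>x = K..<M. (Rep_ell2 E x)\<^sup>2) \<le> tail_sq K Z"
      by (rule order_trans[OF _ sum_sq_le_tail_sq])
    have "(\<Sum>x = K..<M. (Rep_ell2 (block_map Z) x)\<^sup>2) \<le> (\<Sum>x = K..<M. (Rep_ell2 Z x)\<^sup>2)"
      using blockwise_sq_interval_le[OF K M(2)] M(1) by (simp add: Rep_block_map)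
    then show "(\<Sum>x = K..<M. (Rep_ell2 (block_map Z) x)\<^sup>2) \<le> tail_sq K Z"
      by (rule order_trans[OF _ sum_sq_le_tail_sq])
  qed simp_all
  also have "\<dots> = (2 * sqrt (tail_sq K Z))\<^sup>2"
    by (simp add: power_mult_distrib tail_sq_nonneg)
  finally show "\<exists>M\<ge>l. (\<Sum>x<M. (?d x)\<^sup>2) \<le> (2 * sqrt (tail_sq K Z))\<^sup>2"
    using M(1) by (intro exI[of _ M]) auto
qed (simp add: tail_sq_nonneg)

end

end

subsection \<open>Weak convergence through Lipschitz test functions\<close>

text \<open>These are the Pasch-Hausdorff envelopes of \<open>f\<close>, the infimal convolutions
  with \<open>real k * dist\<close>. Approximation from below is what the one-sided argument that
  follows requires.\<close>

lemma lipschitz_inf_convolution: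
  fixes f :: "'c::metric_space \<Rightarrow> real"
  assumes f: "continuous_on UNIV f" and B: "\<And>x. \<bar>f x\<bar> \<le> B"
  obtains g :: "nat \<Rightarrow> 'c \<Rightarrow> real"
  where "\<And>k. lipschitz_on (real k) UNIV (g k)" "\<And>k x. \<bar>g k x\<bar> \<le> B" "\<And>k x. g k x \<le> f x"
    "\<And>x. (\<lambda>k. g k x) \<longlonglongrightarrow> f x"
proof
  define g where "g k x = (INF y. f y + real k * dist x y)" for k :: nat and x
  have fB: "-B \<le> f y" "f y \<le> B" for y using B[of y] by linarith+
  have bdd: "bdd_below (range (\<lambda>y. f y + real k * dist x y))" for k x
    by (rule bdd_belowI[of _ "-B"]) (auto intro!: add_increasing2 fB)
  have le: "g k x \<le> f y + real k * dist x y" for k x y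
    unfolding g_def by (rule cINF_lower[OF bdd]) simp
  have ge: "c \<le> g k x" if "\<And>y. c \<le> f y + real k * dist x y" for c k x
    unfolding g_def using that by (intro cINF_greatest) auto
  have lip: "g k x \<le> g k z + real k * dist x z" for k x z
  proof -
    have "g k x - real k * dist x z \<le> g k z"
    proof (rule ge)
      fix y
      have "real k * dist x y \<le> real k * (dist x z + dist z y)"
        by (intro mult_left_mono dist_triangle) simp
      then show "g k x - real k * dist x z \<le> f y + real k * dist z y"
        using le[of k x y] by (simp add: algebra_simps)
    qed
    then show ?thesis by simp
  qed
  show "lipschitz_on (real k) UNIV (g k)" for k
  proof (rule lipschitz_onI)
    fix x z show "dist (g k x) (g k z) \<le> real k * dist x z"
      using lip[of k x z] lip[of k z x] by (simp add: dist_real_def dist_commute abs_le_iff)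
  qed simp
  show up: "g k x \<le> f x" for k x using le[of k x x] by simp
  have lowB: "-B \<le> g k x" for k x by (rule ge) (auto intro!: add_increasing2 fB)
  show "\<bar>g k x\<bar> \<le> B" for k x using lowB[of k x] up[of k x] fB(2)[of x] by linarith
  show "(\<lambda>k. g k x) \<longlonglongrightarrow> f x" for x
  proof (rule LIMSEQ_I)
    fix e :: real assume "e > 0"
    then obtain d where d: "d > 0" "\<And>y. dist y x < d \<Longrightarrow> dist (f y) (f x) < e / 2"
      using f unfolding continuous_on_iff by (metis UNIV_I half_gt_zero)
    \<comment> \<open>Outside the ball of radius \<open>d\<close> the penalty is at least
      \<open>2 * B\<close>, the largest possible oscillation of \<open>f\<close>; inside it
      continuity suffices.\<close>
    obtain k0 where k0: "real k0 > 2 * B / d" using reals_Archimedean2 by blast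
    have "norm (g k x - f x) < e" if "k \<ge> k0" for k
    proof -
      have "f x - e / 2 \<le> g k x"
      proof (rule ge)
        fix y
        show "f x - e / 2 \<le> f y + real k * dist x y"
        proof (cases "dist y x < d")
          case True
          then have "\<bar>f y - f x\<bar> < e / 2" using d(2)[of y] by (simp add: dist_real_def)
          then have "f x - e / 2 \<le> f y" by linarith
          moreover have "0 \<le> real k * dist x y" by simp
          ultimately show ?thesis by linarith
        next
          case False
          have "2 * B = 2 * B / d * d" using d by simp
          also have "\<dots> \<le> real k * dist x y"
            using False that k0 d(1) fB[of x] by (intro mult_mono) (auto simp: dist_commute)
          finally show ?thesis using fB[of x] fB[of y] \<open>e > 0\<close> by linarith
        qed
      qed
      then show ?thesis using up[of k x] \<open>e > 0\<close> by (simp add: abs_less_iff)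
    qed
    then show "\<exists>k0. \<forall>k\<ge>k0. norm (g k x - f x) < e" by blast
  qed
qed

text \<open>Lipschitz functions below \<open>f\<close> give the lower bound on the limit inferior,
  and the same argument for \<open>- f\<close> gives the upper bound. Tightness is not
  involved.\<close>

lemma tendsto_integral_of_lipschitz:
  fixes Z :: "nat \<Rightarrow> 'a \<Rightarrow> 'c::metric_space" and W :: "'b \<Rightarrow> 'c" and f :: "'c \<Rightarrow> real"
  assumes "prob_space M" "prob_space N"
    and Z: "\<And>n. Z n \<in> borel_measurable M" and W: "W \<in> borel_measurable N"
    and lip: "\<And>g :: 'c \<Rightarrow> real. \<And>L B. lipschitz_on L UNIV g \<Longrightarrow> (\<And>x. \<bar>g x\<bar> \<le> B) \<Longrightarrow>
      (\<lambda>n. \<integral>\<omega>. g (Z n \<omega>) \<partial>M) \<longlonglongrightarrow> (\<integral>\<omega>. g (W \<omega>) \<partial>N)"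
    and f: "continuous_on UNIV f" "\<And>x. \<bar>f x\<bar> \<le> B"
  shows "(\<lambda>n. \<integral>\<omega>. f (Z n \<omega>) \<partial>M) \<longlonglongrightarrow> (\<integral>\<omega>. f (W \<omega>) \<partial>N)"
proof -
  interpret M: prob_space M by fact
  interpret N: prob_space N by fact
  have intZ: "integrable M (\<lambda>\<omega>. h (Z n \<omega>))" if "continuous_on UNIV h" "\<And>x. \<bar>h x\<bar> \<le> B" for h :: "'c \<Rightarrow> real" and n
    using that by (intro M.integrable_const_bound[of _ B])
      (auto intro!: measurable_compose[OF Z] borel_measurable_continuous_onI)
  have lower: "\<forall>\<^sub>F n in sequentially. (\<integral>\<omega>. h (W \<omega>) \<partial>N) - e < (\<integral>\<omega>. h (Z n \<omega>) \<partial>M)"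
    if h: "continuous_on UNIV h" "\<And>x. \<bar>h x\<bar> \<le> B" and "e > 0" for h :: "'c \<Rightarrow> real" and e
  proof -
    obtain g where g: "\<And>k. lipschitz_on (real k) UNIV (g k)" "\<And>k x. \<bar>g k x\<bar> \<le> B"
      "\<And>k x. g k x \<le> h x" "\<And>x. (\<lambda>k. g k x) \<longlonglongrightarrow> h x"
      by (rule lipschitz_inf_convolution[OF h]) (rule that)
    have gc: "continuous_on UNIV (g k)" for k by (rule lipschitz_on_continuous_on[OF g(1)])
    have "(\<lambda>k. \<integral>\<omega>. g k (W \<omega>) \<partial>N) \<longlonglongrightarrow> (\<integral>\<omega>. h (W \<omega>) \<partial>N)"
    proof (rule integral_dominated_convergence[where w = "\<lambda>_. B"])
      show "(\<lambda>\<omega>. h (W \<omega>)) \<in> borel_measurable N"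
        by (rule measurable_compose[OF W borel_measurable_continuous_onI[OF h(1)]])
      show "(\<lambda>\<omega>. g k (W \<omega>)) \<in> borel_measurable N" for k
        by (rule measurable_compose[OF W borel_measurable_continuous_onI[OF gc]])
    qed (use g in auto)
    then have "\<forall>\<^sub>F k in sequentially. (\<integral>\<omega>. h (W \<omega>) \<partial>N) - e / 2 < (\<integral>\<omega>. g k (W \<omega>) \<partial>N)"
      by (rule order_tendstoD(1)) (use \<open>e > 0\<close> in simp)
    then obtain k where k: "(\<integral>\<omega>. h (W \<omega>) \<partial>N) - e / 2 < (\<integral>\<omega>. g k (W \<omega>) \<partial>N)"
      unfolding eventually_sequentially by blast
    have "\<forall>\<^sub>F n in sequentially. (\<integral>\<omega>. g k (W \<omega>) \<partial>N) - e / 2 < (\<integral>\<omega>. g k (Z n \<omega>) \<partial>M)"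
      by (rule order_tendstoD(1)[OF lip[OF g(1,2)]]) (use \<open>e > 0\<close> in simp)
    then show ?thesis
    proof eventually_elim
      case (elim n)
      have "(\<integral>\<omega>. g k (Z n \<omega>) \<partial>M) \<le> (\<integral>\<omega>. h (Z n \<omega>) \<partial>M)"
        using g h gc by (intro integral_mono intZ) auto
      then show ?case using elim k by linarith
    qed
  qed
  show ?thesis
  proof (rule order_tendstoI)
    fix a assume "a < (\<integral>\<omega>. f (W \<omega>) \<partial>N)"
    then show "\<forall>\<^sub>F n in sequentially. a < (\<integral>\<omega>. f (Z n \<omega>) \<partial>M)"
      using lower[OF f, of "(\<integral>\<omega>. f (W \<omega>) \<partial>N) - a"] by simp
  next
    fix a assume "(\<integral>\<omega>. f (W \<omega>) \<partial>N) < a"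
    then show "\<forall>\<^sub>F n in sequentially. (\<integral>\<omega>. f (Z n \<omega>) \<partial>M) < a"
      using lower[of "\<lambda>x. - f x" "a - (\<integral>\<omega>. f (W \<omega>) \<partial>N)"] f by (simp add: continuous_on_minus)
  qed
qed

subsection \<open>A weighted continuity theorem\<close>

text \<open>Normalizing a weight to a density turns weighted integrals of functions of
  \<open>U\<close> into expectations under a law on the line, to which characteristic functions
  apply.\<close>

lemma tilted_distribution:
  assumes "prob_space M"
    and [measurable]: "V \<in> borel_measurable M" "U \<in> borel_measurable M"
    and V: "\<And>\<omega>. 0 \<le> V \<omega>" "\<And>\<omega>. V \<omega> \<le> C" and c: "(\<integral>\<omega>. V \<omega> \<partial>M) = c" "0 < c"
  defines "\<mu> \<equiv> distr (density M (\<lambda>\<omega>. ennreal (V \<omega> / c))) borel U"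
  shows "real_distribution \<mu>"
    and "\<And>h :: real \<Rightarrow> real. h \<in> borel_measurable borel \<Longrightarrow>
           (\<integral>x. h x \<partial>\<mu>) = (\<integral>\<omega>. V \<omega> * h (U \<omega>) \<partial>M) / c"
proof -
  interpret prob_space M by fact
  have iV: "integrable M V" using V by (intro integrable_const_bound[of _ C]) auto
  have "(\<integral>\<^sup>+\<omega>. ennreal (V \<omega> / c) \<partial>M) = ennreal (\<integral>\<omega>. V \<omega> / c \<partial>M)"
    using iV V c(2) by (intro nn_integral_eq_integral) auto
  also have "\<dots> = 1" using c by simp
  finally have "prob_space (density M (\<lambda>\<omega>. ennreal (V \<omega> / c)))"
    by (intro prob_spaceI) (simp add: emeasure_density cong: nn_integral_cong)
  then have "prob_space \<mu>" unfolding \<mu>_def by (intro prob_space.prob_space_distr) auto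
  then show "real_distribution \<mu>"
    unfolding real_distribution_def real_distribution_axioms_def by (simp add: \<mu>_def)
  fix h :: "real \<Rightarrow> real" assume [measurable]: "h \<in> borel_measurable borel"
  have "(\<integral>x. h x \<partial>\<mu>) = (\<integral>\<omega>. (V \<omega> / c) *\<^sub>R h (U \<omega>) \<partial>M)"
    unfolding \<mu>_def using V(1) c(2)
    by (subst integral_distr, simp, simp, subst integral_density) auto
  then show "(\<integral>x. h x \<partial>\<mu>) = (\<integral>\<omega>. V \<omega> * h (U \<omega>) \<partial>M) / c" by simp
qed

text \<open>A sine is a cosine shifted by \<open>pi / 2\<close>, so cosines with a free phase carry
  both parts of the characteristic function. This explains the phase \<open>a\<close> in the
  convergence hypotheses below.\<close>

lemma (in real_distribution) char_eq_cos:
  "char M t = of_real (\<integral>x. cos (t * x) \<partial>M) + \<i> * of_real (\<integral>x. cos (t * x + - pi / 2) \<partial>M)"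
proof -
  have int: "integrable M (\<lambda>x. cos (t * x + a))" for a :: real
    by (intro integrable_const_bound[of _ 1]) auto
  have "iexp (t * x) = complex_of_real (cos (t * x)) + \<i> * complex_of_real (cos (t * x + - pi / 2))" for x
    unfolding cis_conv_exp[symmetric] by (simp add: complex_eq_iff cos_diff)
  then have "char M t = (\<integral>x. complex_of_real (cos (t * x)) + \<i> * complex_of_real (cos (t * x + - pi / 2)) \<partial>M)"
    unfolding char_def by simp
  also have "\<dots> = (\<integral>x. complex_of_real (cos (t * x)) \<partial>M) + (\<integral>x. \<i> * complex_of_real (cos (t * x + - pi / 2)) \<partial>M)"
    using int[of 0] int[of "- pi / 2"]
    by (intro Bochner_Integration.integral_add integrable_mult_right integrable_of_real) simp_all
  also have "\<dots> = of_real (\<integral>x. cos (t * x) \<partial>M) + \<i> * of_real (\<integral>x. cos (t * x + - pi / 2) \<partial>M)"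
    by (simp only: integral_mult_right_zero integral_complex_of_real)
  finally show ?thesis .
qed

lemma abs_integral_weighted_le:
  fixes V h :: "'a \<Rightarrow> real"
  assumes "integrable M V" "\<And>\<omega>. 0 \<le> V \<omega>" "\<And>\<omega>. \<bar>h \<omega>\<bar> \<le> B"
  shows "\<bar>\<integral>\<omega>. V \<omega> * h \<omega> \<partial>M\<bar> \<le> B * (\<integral>\<omega>. V \<omega> \<partial>M)"
proof -
  have B: "0 \<le> B" using assms(3)[of undefined] by linarith
  have "\<bar>\<integral>\<omega>. V \<omega> * h \<omega> \<partial>M\<bar> \<le> (\<integral>\<omega>. \<bar>V \<omega> * h \<omega>\<bar> \<partial>M)" by (rule integral_abs_bound)
  also have "\<dots> \<le> (\<integral>\<omega>. V \<omega> * B \<partial>M)"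
    using assms B by (intro integral_mono' integrable_mult_left)
      (auto simp: abs_mult intro!: mult_left_mono)
  finally show ?thesis by (simp add: mult.commute)
qed

lemma weighted_levy_continuity:
  fixes V U :: "nat \<Rightarrow> 'a \<Rightarrow> real" and V' U' :: "'b \<Rightarrow> real" and h :: "real \<Rightarrow> real"
  assumes "prob_space M" "prob_space N"
    and [measurable]: "\<And>n. V n \<in> borel_measurable M" "\<And>n. U n \<in> borel_measurable M"
      "V' \<in> borel_measurable N" "U' \<in> borel_measurable N"
    and V: "\<And>n \<omega>. 0 \<le> V n \<omega>" "\<And>n \<omega>. V n \<omega> \<le> C"
    and V': "\<And>\<omega>. 0 \<le> V' \<omega>" "\<And>\<omega>. V' \<omega> \<le> C"
    and conv: "\<And>s a. (\<lambda>n. \<integral>\<omega>. V n \<omega> * cos (s * U n \<omega> + a) \<partial>M) \<longlonglongrightarrow> (\<integral>\<omega>. V' \<omega> * cos (s * U' \<omega> + a) \<partial>N)"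
    and h: "\<And>x. isCont h x" "\<And>x. \<bar>h x\<bar> \<le> B"
  shows "(\<lambda>n. \<integral>\<omega>. V n \<omega> * h (U n \<omega>) \<partial>M) \<longlonglongrightarrow> (\<integral>\<omega>. V' \<omega> * h (U' \<omega>) \<partial>N)"
proof -
  interpret M: prob_space M by fact
  interpret N: prob_space N by fact
  have [measurable]: "h \<in> borel_measurable borel"
    using h(1) by (intro borel_measurable_continuous_onI continuous_at_imp_continuous_on) auto
  define c where "c n = (\<integral>\<omega>. V n \<omega> \<partial>M)" for n
  define c' where "c' = (\<integral>\<omega>. V' \<omega> \<partial>N)"
  \<comment> \<open>With \<open>s = 0\<close> and \<open>a = 0\<close> the cosine equals 1, so the
    total weights converge.\<close>
  have cc: "c \<longlonglongrightarrow> c'" using conv[of 0 0] by (simp add: c_def[abs_def] c'_def)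
  have iV: "integrable M (V n)" for n using V by (intro M.integrable_const_bound[of _ C]) auto
  have iV': "integrable N V'" using V' by (intro N.integrable_const_bound[of _ C]) auto
  have B0: "0 \<le> B" using h(2)[of 0] by linarith
  have bound: "\<bar>\<integral>\<omega>. V n \<omega> * h (U n \<omega>) \<partial>M\<bar> \<le> B * c n" for n
    unfolding c_def using V(1) h(2) by (rule abs_integral_weighted_le[OF iV])
  have bound': "\<bar>\<integral>\<omega>. V' \<omega> * h (U' \<omega>) \<partial>N\<bar> \<le> B * c'"
    unfolding c'_def using V'(1) h(2) by (rule abs_integral_weighted_le[OF iV'])
  have "0 \<le> c'" unfolding c'_def using V'(1) by (intro integral_nonneg_AE) auto
  show ?thesis
  \<comment> \<open>A limiting weight of mass 0 cannot be normalized; in that case the bound on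
    \<open>h\<close> forces both sides to 0.\<close>
  proof (cases "c' = 0")
    case True
    have "(\<lambda>n. B * c n) \<longlonglongrightarrow> 0" using tendsto_mult_left[OF cc, of B] True by simp
    then have "(\<lambda>n. \<integral>\<omega>. V n \<omega> * h (U n \<omega>) \<partial>M) \<longlonglongrightarrow> 0"
      by (rule Lim_null_comparison[rotated]) (simp add: bound)
    moreover have "(\<integral>\<omega>. V' \<omega> * h (U' \<omega>) \<partial>N) = 0" using bound' True by simp
    ultimately show ?thesis by (simp only:)
  next
    case False
    then have c'0: "0 < c'" using \<open>0 \<le> c'\<close> by simp
    \<comment> \<open>Early weights may have mass 0, so the tilted laws start at \<open>n0\<close>;
      \<open>LIMSEQ_offset\<close> undoes the shift at the end.\<close>
    obtain n0 where n0: "\<And>n. n \<ge> n0 \<Longrightarrow> 0 < c n"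
      using order_tendstoD(1)[OF cc c'0] unfolding eventually_sequentially by blast
    define \<mu> where "\<mu> n = distr (density M (\<lambda>\<omega>. ennreal (V (n + n0) \<omega> / c (n + n0)))) borel (U (n + n0))" for n
    define \<nu> where "\<nu> = distr (density N (\<lambda>\<omega>. ennreal (V' \<omega> / c'))) borel U'"
    have \<mu>: "real_distribution (\<mu> n)"
      "\<And>f :: real \<Rightarrow> real. f \<in> borel_measurable borel \<Longrightarrow>
        (\<integral>x. f x \<partial>\<mu> n) = (\<integral>\<omega>. V (n + n0) \<omega> * f (U (n + n0) \<omega>) \<partial>M) / c (n + n0)" for n
      unfolding \<mu>_def
      by (rule tilted_distribution[OF assms(1), where C = C]; use V n0 in \<open>simp add: c_def\<close>)+
    have \<nu>: "real_distribution \<nu>"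
      "\<And>f :: real \<Rightarrow> real. f \<in> borel_measurable borel \<Longrightarrow>
        (\<integral>x. f x \<partial>\<nu>) = (\<integral>\<omega>. V' \<omega> * f (U' \<omega>) \<partial>N) / c'"
      unfolding \<nu>_def
      by (rule tilted_distribution[OF assms(2), where C = C]; use V' c'0 in \<open>simp add: c'_def\<close>)+
    have cc0: "(\<lambda>n. c (n + n0)) \<longlonglongrightarrow> c'" using cc by (rule LIMSEQ_ignore_initial_segment)
    have cosconv: "(\<lambda>n. \<integral>x. cos (s * x + a) \<partial>\<mu> n) \<longlonglongrightarrow> (\<integral>x. cos (s * x + a) \<partial>\<nu>)" for s a
    proof -
      have "(\<lambda>n. (\<integral>\<omega>. V (n + n0) \<omega> * cos (s * U (n + n0) \<omega> + a) \<partial>M) / c (n + n0))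
          \<longlonglongrightarrow> (\<integral>\<omega>. V' \<omega> * cos (s * U' \<omega> + a) \<partial>N) / c'"
        by (intro tendsto_divide cc0 False LIMSEQ_ignore_initial_segment[OF conv])
      then show ?thesis by (simp add: \<mu>(2) \<nu>(2))
    qed
    have "weak_conv_m \<mu> \<nu>"
    proof (rule levy_continuity[OF \<mu>(1) \<nu>(1)])
      fix t
      show "(\<lambda>n. char (\<mu> n) t) \<longlonglongrightarrow> char \<nu> t"
        unfolding real_distribution.char_eq_cos[OF \<mu>(1)] real_distribution.char_eq_cos[OF \<nu>(1)]
        using cosconv[of t 0] cosconv[of t "- pi / 2"]
        by (intro tendsto_add tendsto_mult tendsto_const tendsto_of_real) simp_all
    qed
    then have "(\<lambda>n. \<integral>x. h x \<partial>\<mu> n) \<longlonglongrightarrow> (\<integral>x. h x \<partial>\<nu>)"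
      using h by (intro weak_conv_imp_integral_bdd_continuous_conv[OF \<mu>(1) \<nu>(1), where B = B]) auto
    then have "(\<lambda>n. (\<integral>x. h x \<partial>\<mu> n) * c (n + n0)) \<longlonglongrightarrow> (\<integral>x. h x \<partial>\<nu>) * c'"
      by (intro tendsto_mult cc0)
    moreover have "(\<integral>x. h x \<partial>\<mu> n) * c (n + n0) = (\<integral>\<omega>. V (n + n0) \<omega> * h (U (n + n0) \<omega>) \<partial>M)" for n
      using n0[of "n + n0"] by (simp add: \<mu>(2))
    moreover have "(\<integral>x. h x \<partial>\<nu>) * c' = (\<integral>\<omega>. V' \<omega> * h (U' \<omega>) \<partial>N)" using False by (simp add: \<nu>(2))
    ultimately have "(\<lambda>n. \<integral>\<omega>. V (n + n0) \<omega> * h (U (n + n0) \<omega>) \<partial>M) \<longlonglongrightarrow> (\<integral>\<omega>. V' \<omega> * h (U' \<omega>) \<partial>N)"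
      by (simp only:)
    then show ?thesis by (rule LIMSEQ_offset)
  qed
qed

subsection \<open>From linear combinations to products of coordinates\<close>

lemma sum_fun_upd_mult:
  fixes t z :: "nat \<Rightarrow> real"
  assumes "k < K"
  shows "(\<Sum>i<K. (t(k := t k + s)) i * z i) = (\<Sum>i<K. t i * z i) + s * z k"
proof -
  have "(\<Sum>i<K. (t(k := t k + s)) i * z i) = (\<Sum>i<K. t i * z i + (if i = k then s * z k else 0))"
    by (intro sum.cong) (auto simp: algebra_simps)
  also have "\<dots> = (\<Sum>i<K. t i * z i) + s * z k" using assms by (simp add: sum.distrib)
  finally show ?thesis .
qed

text \<open>
  One coordinate at a time: the weight \<open>(\<Prod>i<k. h i (z i)) * (1 + cos (L + a))\<close> is nonnegative, so the
  one-dimensional continuity theorem applies to coordinate \<open>k\<close> under it.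
\<close>

lemma tendsto_integral_prod_cos:
  fixes z :: "nat \<Rightarrow> 'a \<Rightarrow> nat \<Rightarrow> real" and z' :: "'b \<Rightarrow> nat \<Rightarrow> real"
  assumes ps: "prob_space M" "prob_space N"
    and meas [measurable]: "\<And>n i. (\<lambda>\<omega>. z n \<omega> i) \<in> borel_measurable M" "\<And>i. (\<lambda>\<omega>. z' \<omega> i) \<in> borel_measurable N"
    and lin: "\<And>t a. (\<lambda>n. \<integral>\<omega>. cos ((\<Sum>i<K. t i * z n \<omega> i) + a) \<partial>M)
      \<longlonglongrightarrow> (\<integral>\<omega>. cos ((\<Sum>i<K. t i * z' \<omega> i) + a) \<partial>N)"
    and h: "\<And>i x. isCont (h i) x" "\<And>i x. 0 \<le> h i x" "\<And>i x. h i x \<le> (1 :: real)"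
    and "k \<le> K"
  shows "(\<lambda>n. \<integral>\<omega>. (\<Prod>i<k. h i (z n \<omega> i)) * cos ((\<Sum>i<K. t i * z n \<omega> i) + a) \<partial>M)
    \<longlonglongrightarrow> (\<integral>\<omega>. (\<Prod>i<k. h i (z' \<omega> i)) * cos ((\<Sum>i<K. t i * z' \<omega> i) + a) \<partial>N)"
  using \<open>k \<le> K\<close>
proof (induction k arbitrary: t a)
  case 0
  show ?case using lin by simp
next
  case (Suc k)
  interpret M: prob_space M by fact
  interpret N: prob_space N by fact
  have k: "k < K" "k \<le> K" using Suc.prems by auto
  note IH = Suc.IH[OF k(2)]
  have hm [measurable]: "h i \<in> borel_measurable borel" for i
    using h(1) by (intro borel_measurable_continuous_onI continuous_at_imp_continuous_on) auto
  define w where "w y = (\<Prod>i<k. h i (y i))" for y :: "nat \<Rightarrow> real"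
  define L where "L y = (\<Sum>i<K. t i * y i)" for y :: "nat \<Rightarrow> real"
  have w01: "0 \<le> w y" "w y \<le> 1" for y unfolding w_def using h by (auto intro!: prod_nonneg prod_le_1)
  have [measurable]: "(\<lambda>\<omega>. w (z n \<omega>)) \<in> borel_measurable M" "(\<lambda>\<omega>. L (z n \<omega>)) \<in> borel_measurable M" for n
    unfolding w_def L_def by measurable
  have [measurable]: "(\<lambda>\<omega>. w (z' \<omega>)) \<in> borel_measurable N" "(\<lambda>\<omega>. L (z' \<omega>)) \<in> borel_measurable N"
    unfolding w_def L_def by measurable
  have intM: "integrable M (\<lambda>\<omega>. w (z n \<omega>) * cos (f \<omega>))" if "f \<in> borel_measurable M" for n f
    using that w01 by (intro M.integrable_const_bound[of _ 1])
      (auto simp: abs_mult intro!: mult_le_one)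
  have intN: "integrable N (\<lambda>\<omega>. w (z' \<omega>) * cos (f \<omega>))" if "f \<in> borel_measurable N" for f
    using that w01 by (intro N.integrable_const_bound[of _ 1])
      (auto simp: abs_mult intro!: mult_le_one)
  \<comment> \<open>Scaling \<open>t\<close> by \<open>e\<close> and adding \<open>s\<close> to its
    entry \<open>k\<close> yields another coefficient vector, so the induction hypothesis, being
    general in \<open>t\<close>, already covers the extra frequency in coordinate
    \<open>k\<close>.\<close>
  have shift: "(\<lambda>n. \<integral>\<omega>. w (z n \<omega>) * cos (e * L (z n \<omega>) + s * z n \<omega> k + b) \<partial>M)
      \<longlonglongrightarrow> (\<integral>\<omega>. w (z' \<omega>) * cos (e * L (z' \<omega>) + s * z' \<omega> k + b) \<partial>N)" for e s b
  proof -
    have "(\<Sum>i<K. ((\<lambda>i. e * t i)(k := e * t k + s)) i * y i) = e * L y + s * y k" for y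
      unfolding sum_fun_upd_mult[OF k(1), of "\<lambda>i. e * t i"] L_def
      by (simp add: sum_distrib_left mult.assoc)
    then show ?thesis using IH[of "(\<lambda>i. e * t i)(k := e * t k + s)" b] by (simp add: w_def)
  qed
  \<comment> \<open>The product of two cosines becomes a sum of cosines of linear combinations,
    which is the form that \<open>shift\<close> handles.\<close>
  have prodcos: "x * (1 + cos u) * cos v = x * cos v + (1 / 2) * (x * cos (u + v)) + (1 / 2) * (x * cos (- u + v))"
    for x u v :: real by (simp add: cos_add cos_diff algebra_simps)
  have weighted: "(\<lambda>n. \<integral>\<omega>. w (z n \<omega>) * (1 + cos (L (z n \<omega>) + a)) * cos (s * z n \<omega> k + b) \<partial>M)
      \<longlonglongrightarrow> (\<integral>\<omega>. w (z' \<omega>) * (1 + cos (L (z' \<omega>) + a)) * cos (s * z' \<omega> k + b) \<partial>N)" for s b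
  proof -
    have eqM: "(\<integral>\<omega>. w (z n \<omega>) * (1 + cos (L (z n \<omega>) + a)) * cos (s * z n \<omega> k + b) \<partial>M)
      = (\<integral>\<omega>. w (z n \<omega>) * cos (0 * L (z n \<omega>) + s * z n \<omega> k + b) \<partial>M)
      + (1 / 2) * (\<integral>\<omega>. w (z n \<omega>) * cos (1 * L (z n \<omega>) + s * z n \<omega> k + (a + b)) \<partial>M)
      + (1 / 2) * (\<integral>\<omega>. w (z n \<omega>) * cos ((-1) * L (z n \<omega>) + s * z n \<omega> k + (b - a)) \<partial>M)" for n
      unfolding prodcos
      by (subst Bochner_Integration.integral_add, (intro Bochner_Integration.integrable_add integrable_mult_right intM; measurable)+,
          subst Bochner_Integration.integral_add, (intro integrable_mult_right intM; measurable)+)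
        (simp add: algebra_simps)
    have eqN: "(\<integral>\<omega>. w (z' \<omega>) * (1 + cos (L (z' \<omega>) + a)) * cos (s * z' \<omega> k + b) \<partial>N)
      = (\<integral>\<omega>. w (z' \<omega>) * cos (0 * L (z' \<omega>) + s * z' \<omega> k + b) \<partial>N)
      + (1 / 2) * (\<integral>\<omega>. w (z' \<omega>) * cos (1 * L (z' \<omega>) + s * z' \<omega> k + (a + b)) \<partial>N)
      + (1 / 2) * (\<integral>\<omega>. w (z' \<omega>) * cos ((-1) * L (z' \<omega>) + s * z' \<omega> k + (b - a)) \<partial>N)"
      unfolding prodcos
      by (subst Bochner_Integration.integral_add, (intro Bochner_Integration.integrable_add integrable_mult_right intN; measurable)+,
          subst Bochner_Integration.integral_add, (intro integrable_mult_right intN; measurable)+)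
        (simp add: algebra_simps)
    show ?thesis unfolding eqM eqN by (intro tendsto_add tendsto_mult tendsto_const shift)
  qed
  have habs: "\<bar>h i x\<bar> \<le> 1" for i x using h(2,3)[where i = i and x = x] by simp
  have cos1: "0 \<le> 1 + cos x" "1 + cos x \<le> 2" for x :: real
    using cos_ge_minus_one[of x] cos_le_one[of x] by linarith+
  have A: "(\<lambda>n. \<integral>\<omega>. w (z n \<omega>) * (1 + cos (L (z n \<omega>) + a)) * h k (z n \<omega> k) \<partial>M)
      \<longlonglongrightarrow> (\<integral>\<omega>. w (z' \<omega>) * (1 + cos (L (z' \<omega>) + a)) * h k (z' \<omega> k) \<partial>N)"
  proof (rule weighted_levy_continuity[OF ps, where C = 2 and B = 1
        and h = "h k" and U = "\<lambda>n \<omega>. z n \<omega> k" and U' = "\<lambda>\<omega>. z' \<omega> k"])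
    have bd: "0 \<le> w y * (1 + cos x)" "w y * (1 + cos x) \<le> 2" for y x
      using mult_mono[OF w01(2)[of y] cos1(2)[of x]] cos1[of x] w01[of y] by auto
    show "0 \<le> w (z n \<omega>) * (1 + cos (L (z n \<omega>) + a))" "w (z n \<omega>) * (1 + cos (L (z n \<omega>) + a)) \<le> 2" for n \<omega>
      by (rule bd)+
    show "0 \<le> w (z' \<omega>) * (1 + cos (L (z' \<omega>) + a))" "w (z' \<omega>) * (1 + cos (L (z' \<omega>) + a)) \<le> 2" for \<omega>
      by (rule bd)+
  qed (use weighted h habs in measurable)
  have B: "(\<lambda>n. \<integral>\<omega>. w (z n \<omega>) * h k (z n \<omega> k) \<partial>M) \<longlonglongrightarrow> (\<integral>\<omega>. w (z' \<omega>) * h k (z' \<omega> k) \<partial>N)"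
  proof (rule weighted_levy_continuity[OF ps, where C = 1 and B = 1
        and h = "h k" and U = "\<lambda>n \<omega>. z n \<omega> k" and U' = "\<lambda>\<omega>. z' \<omega> k"])
    show "(\<lambda>n. \<integral>\<omega>. w (z n \<omega>) * cos (s * z n \<omega> k + b) \<partial>M) \<longlonglongrightarrow> (\<integral>\<omega>. w (z' \<omega>) * cos (s * z' \<omega> k + b) \<partial>N)" for s b
      using shift[of 0 s b] by simp
  qed (use w01 h habs in measurable)
  have bd2: "\<bar>w y * h k u\<bar> \<le> 1" for y u
    using w01[of y] habs[of k u] by (auto simp: abs_mult intro!: mult_le_one)
  have bd1: "\<bar>w y * (1 + cos x) * h k u\<bar> \<le> 2" for y x u
  proof -
    have "\<bar>w y * (1 + cos x) * h k u\<bar> = \<bar>w y * h k u\<bar> * (1 + cos x)"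
      using cos1[of x] by (simp add: abs_mult)
    also have "\<dots> \<le> 1 * 2" by (intro mult_mono bd2 cos1) auto
    finally show ?thesis by simp
  qed
  have int2: "integrable M (\<lambda>\<omega>. w (z n \<omega>) * (1 + cos (L (z n \<omega>) + a)) * h k (z n \<omega> k))"
       "integrable M (\<lambda>\<omega>. w (z n \<omega>) * h k (z n \<omega> k))" for n
    by (rule M.integrable_const_bound[of _ 2]; use bd1 in simp)
       (rule M.integrable_const_bound[of _ 1]; use bd2 in simp)
  have int2': "integrable N (\<lambda>\<omega>. w (z' \<omega>) * (1 + cos (L (z' \<omega>) + a)) * h k (z' \<omega> k))"
       "integrable N (\<lambda>\<omega>. w (z' \<omega>) * h k (z' \<omega> k))"
    by (rule N.integrable_const_bound[of _ 2]; use bd1 in simp)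
       (rule N.integrable_const_bound[of _ 1]; use bd2 in simp)
  \<comment> \<open>A cosine is \<open>1 + cos\<close> minus 1, hence a difference of two
    nonnegative weights; \<open>A\<close> and \<open>B\<close> treat one each.\<close>
  have split: "(\<Prod>i<Suc k. h i (y i)) * cos ((\<Sum>i<K. t i * y i) + a)
      = w y * (1 + cos (L y + a)) * h k (y k) - w y * h k (y k)" for y
    unfolding w_def L_def by (simp add: algebra_simps)
  show ?case unfolding split
    by (subst Bochner_Integration.integral_diff[OF int2], subst Bochner_Integration.integral_diff[OF int2'])
      (intro tendsto_diff A B)
qed

lemma tendsto_integral_prod:
  fixes z :: "nat \<Rightarrow> 'a \<Rightarrow> nat \<Rightarrow> real" and z' :: "'b \<Rightarrow> nat \<Rightarrow> real"
  assumes "prob_space M" "prob_space N"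
    and "\<And>n i. (\<lambda>\<omega>. z n \<omega> i) \<in> borel_measurable M" "\<And>i. (\<lambda>\<omega>. z' \<omega> i) \<in> borel_measurable N"
    and "\<And>t a. (\<lambda>n. \<integral>\<omega>. cos ((\<Sum>i<K. t i * z n \<omega> i) + a) \<partial>M)
      \<longlonglongrightarrow> (\<integral>\<omega>. cos ((\<Sum>i<K. t i * z' \<omega> i) + a) \<partial>N)"
    and "\<And>i x. isCont (h i) x" "\<And>i x. 0 \<le> h i x" "\<And>i x. h i x \<le> (1 :: real)"
  shows "(\<lambda>n. \<integral>\<omega>. (\<Prod>i<K. h i (z n \<omega> i)) \<partial>M) \<longlonglongrightarrow> (\<integral>\<omega>. (\<Prod>i<K. h i (z' \<omega> i)) \<partial>N)"
  using tendsto_integral_prod_cos[OF assms order_refl, where t = "\<lambda>_. 0" and a = 0] by simp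

subsection \<open>Approximation by tent functions\<close>

definition clamp01 :: "real \<Rightarrow> real" where
  "clamp01 u = min 1 (max 0 u)"

text \<open>\<open>tent m i\<close> is the piecewise linear bump of half-width \<open>1\<close> around \<open>i - m\<close>; writing it as a difference
  makes the partition of unity telescope.\<close>

definition tent :: "nat \<Rightarrow> nat \<Rightarrow> real \<Rightarrow> real" where
  "tent m i y = clamp01 (y + real m + 1 - real i) - clamp01 (y + real m - real i)"

lemma tent_nonneg: "0 \<le> tent m i y"
  and tent_le_1: "tent m i y \<le> 1"
  and tent_eq_0: "\<bar>y - (real i - real m)\<bar> \<ge> 1 \<Longrightarrow> tent m i y = 0"
  unfolding tent_def clamp01_def by (auto simp: min_def max_def)

lemma sum_tent: "(\<Sum>i<n. tent m i y) = clamp01 (y + real m + 1) - clamp01 (y + real m + 1 - real n)"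
  by (induction n) (simp_all add: tent_def algebra_simps)

lemma isCont_tent: "isCont (tent m i) y"
  unfolding tent_def clamp01_def by (intro continuous_intros)

text \<open>A product of one-dimensional sums expands into a sum over lattice points. The
  \<open>2 * m + 1\<close> bumps are centred at the integers from \<open>-m\<close> to
  \<open>m\<close>, so their sum is exactly 1 up to distance \<open>m\<close> from the
  origin.\<close>

lemma partition_tent:
  fixes K m :: nat and y :: "nat \<Rightarrow> real"
  defines "P \<equiv> PiE {..<K} (\<lambda>_. {..<2 * m + 1})" and "w \<equiv> \<lambda>f. \<Prod>i<K. tent m (f i) (y i)"
  shows "0 \<le> (\<Sum>f\<in>P. w f)"
    and "(\<Sum>f\<in>P. w f) \<le> 1"
    and "(\<And>i. i < K \<Longrightarrow> \<bar>y i\<bar> \<le> real m) \<Longrightarrow> (\<Sum>f\<in>P. w f) = 1"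
proof -
  have eq: "(\<Sum>f\<in>P. w f) = (\<Prod>i<K. \<Sum>j<2 * m + 1. tent m j (y i))"
    unfolding w_def P_def by (rule prod_sum_PiE[symmetric]) auto
  have s: "0 \<le> (\<Sum>j<2 * m + 1. tent m j u)" "(\<Sum>j<2 * m + 1. tent m j u) \<le> 1" for u
    unfolding sum_tent by (auto simp: clamp01_def min_def max_def)
  show "0 \<le> (\<Sum>f\<in>P. w f)"
    "(\<Sum>f\<in>P. w f) \<le> 1"
    unfolding eq by (rule prod_nonneg, rule s(1), rule prod_le_1) (use s in auto)
  assume "\<And>i. i < K \<Longrightarrow> \<bar>y i\<bar> \<le> real m"
  then have "(\<Sum>j<2 * m + 1. tent m j (y i)) = 1" if "i < K" for i
    using that unfolding sum_tent clamp01_def by (fastforce simp: min_def max_def)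
  then show "(\<Sum>f\<in>P. w f) = 1"
    unfolding eq by (intro prod.neutral) auto
qed

definition ell2_of :: "nat \<Rightarrow> (nat \<Rightarrow> real) \<Rightarrow> ell2" where
  "ell2_of K v = Abs_ell2 (\<lambda>i. if i < K then v i else 0)"

lemma Rep_ell2_of: "Rep_ell2 (ell2_of K v) i = (if i < K then v i else 0)"
  unfolding ell2_of_def by (subst Rep_Abs_ell2) (auto intro: square_summable_finite_support[of K])

lemma norm_sub_truncation: "norm (f - ell2_of K (Rep_ell2 f)) = sqrt (tail_sq K f)"
proof -
  have "(norm (f - ell2_of K (Rep_ell2 f)))\<^sup>2 = tail_sq K (f - ell2_of K (Rep_ell2 f))"
    by (simp add: tail_sq_eq Rep_ell2_minus Rep_ell2_of)
  also have "\<dots> = tail_sq K f" by (simp add: tail_sq_def Rep_ell2_minus Rep_ell2_of)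
  finally show ?thesis by (metis norm_ge_zero real_sqrt_unique)
qed

text \<open>Interpolation of \<open>g\<close> on a lattice of mesh \<open>\<delta>\<close> in the
  first \<open>K\<close> coordinates. It is a finite combination of products of functions of single
  coordinates, so \<open>tendsto_integral_prod\<close> applies to it.\<close>

definition tent_approx :: "(ell2 \<Rightarrow> real) \<Rightarrow> nat \<Rightarrow> real \<Rightarrow> nat \<Rightarrow> (nat \<Rightarrow> real) \<Rightarrow> real" where
  "tent_approx g K \<delta> m y = (\<Sum>f\<in>PiE {..<K} (\<lambda>_. {..<2 * m + 1}).
     g (ell2_of K (\<lambda>i. \<delta> * (real (f i) - real m))) * (\<Prod>i<K. tent m (f i) (y i / \<delta>)))"

lemma abs_tent_approx_le:
  assumes "\<And>x. \<bar>g x\<bar> \<le> B"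
  shows "\<bar>tent_approx g K \<delta> m y\<bar> \<le> B"
proof -
  let ?P = "PiE {..<K} (\<lambda>_. {..<2 * m + 1})" let ?w = "\<lambda>f. \<Prod>i<K. tent m (f i) (y i / \<delta>)"
  have B: "0 \<le> B" using assms[of 0] by linarith
  have "\<bar>tent_approx g K \<delta> m y\<bar> \<le> (\<Sum>f\<in>?P. B * ?w f)"
    unfolding tent_approx_def using assms
    by (intro sum_abs[THEN order_trans] sum_mono)
      (auto simp: abs_mult abs_of_nonneg prod_nonneg tent_nonneg intro!: mult_right_mono)
  also have "\<dots> = B * (\<Sum>f\<in>?P. ?w f)" by (simp only: sum_distrib_left)
  also have "\<dots> \<le> B * 1" by (intro mult_left_mono partition_tent(2) B)
  finally show ?thesis by simp
qed

text \<open>The terms come from dropping the coordinates beyond \<open>K\<close>, from the mesh, and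
  from leaving the cube of half-width \<open>real m * \<delta>\<close>. In the last case the crude
  bound \<open>2 * B\<close> is multiplied by
  \<open>(norm f)\<^sup>2 / (real m * \<delta>)\<^sup>2\<close>, which is then at least 1.\<close>

lemma tent_approx_error:
  assumes g: "lipschitz_on L UNIV g" "\<And>x. \<bar>g x\<bar> \<le> B" and \<delta>: "\<delta> > 0" and m: "m > 0"
  shows "\<bar>g f - tent_approx g K \<delta> m (Rep_ell2 f)\<bar>
    \<le> L * sqrt (tail_sq K f) + L * (\<delta> * sqrt (real K)) + 2 * B / (real m * \<delta>)\<^sup>2 * (norm f)\<^sup>2"
proof -
  let ?P = "PiE {..<K} (\<lambda>_. {..<2 * m + 1})"
  let ?y = "\<lambda>i. Rep_ell2 f i / \<delta>"
  let ?w = "\<lambda>v. \<Prod>i<K. tent m (v i) (?y i)"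
  let ?v = "\<lambda>v. ell2_of K (\<lambda>i. \<delta> * (real (v i) - real m))"
  let ?f = "ell2_of K (Rep_ell2 f)"
  have L0: "0 \<le> L" using g(1) by (rule lipschitz_on_nonneg)
  have B0: "0 \<le> B" using g(2)[of 0] by linarith
  have lip: "\<bar>g a - g b\<bar> \<le> L * norm (a - b)" for a b
    using lipschitz_onD[OF g(1), of a b] by (simp add: dist_real_def dist_norm)
  have nn: "0 \<le> 2 * B / (real m * \<delta>)\<^sup>2 * (norm f)\<^sup>2" using B0 by simp
  show ?thesis
  proof (cases "\<forall>i<K. \<bar>?y i\<bar> \<le> real m")
    case True
    then have W: "(\<Sum>v\<in>?P. ?w v) = 1" by (intro partition_tent(3)) auto
    \<comment> \<open>A lattice point with nonzero weight is within \<open>\<delta>\<close> of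
      \<open>?f\<close> in each of the \<open>K\<close> coordinates.\<close>
    have close: "norm (?f - ?v v) \<le> \<delta> * sqrt (real K)" if "?w v \<noteq> 0" for v
    proof (rule norm_ell2_leI)
      fix l
      have le: "(Rep_ell2 (?f - ?v v) i)\<^sup>2 \<le> (if i < K then \<delta>\<^sup>2 else 0)" for i
      proof (cases "i < K")
        case True
        then have "tent m (v i) (?y i) \<noteq> 0" using that by (auto simp: prod_zero_iff)
        then have "\<bar>?y i - (real (v i) - real m)\<bar> < 1" using tent_eq_0 by force
        then have "\<bar>?y i - (real (v i) - real m)\<bar> * \<delta> \<le> 1 * \<delta>" using \<delta> by (intro mult_right_mono) auto
        also have "\<bar>?y i - (real (v i) - real m)\<bar> * \<delta> = \<bar>(?y i - (real (v i) - real m)) * \<delta>\<bar>"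
          using \<delta> by (simp only: abs_mult abs_of_pos)
        also have "(?y i - (real (v i) - real m)) * \<delta> = Rep_ell2 (?f - ?v v) i"
          using \<delta> True by (simp add: Rep_ell2_minus Rep_ell2_of field_simps)
        finally have "\<bar>Rep_ell2 (?f - ?v v) i\<bar>\<^sup>2 \<le> (1 * \<delta>)\<^sup>2" by (intro power_mono) auto
        then show ?thesis using True by simp
      qed (simp add: Rep_ell2_minus Rep_ell2_of)
      have "(\<Sum>i<max l K. (Rep_ell2 (?f - ?v v) i)\<^sup>2) \<le> (\<Sum>i<max l K. if i < K then \<delta>\<^sup>2 else 0)"
        by (intro sum_mono le)
      also have "\<dots> = (\<Sum>i<K. \<delta>\<^sup>2)" by (rule sum.mono_neutral_cong_right) auto
      also have "\<dots> = (\<delta> * sqrt (real K))\<^sup>2" by (simp add: power_mult_distrib)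
      finally show "\<exists>K'\<ge>l. (\<Sum>i<K'. (Rep_ell2 (?f - ?v v) i)\<^sup>2) \<le> (\<delta> * sqrt (real K))\<^sup>2"
        by (intro exI[of _ "max l K"]) auto
    qed (use \<delta> in simp)
    have "g ?f - tent_approx g K \<delta> m (Rep_ell2 f) = (\<Sum>v\<in>?P. (g ?f - g (?v v)) * ?w v)"
      unfolding tent_approx_def left_diff_distrib sum_subtractf sum_distrib_left[symmetric] W by simp
    also have "\<bar>\<dots>\<bar> \<le> (\<Sum>v\<in>?P. L * (\<delta> * sqrt (real K)) * ?w v)"
    proof (intro sum_abs[THEN order_trans] sum_mono)
      fix v
      show "\<bar>(g ?f - g (?v v)) * ?w v\<bar> \<le> L * (\<delta> * sqrt (real K)) * ?w v"
      proof (cases "?w v = 0")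
        case False
        have "\<bar>g ?f - g (?v v)\<bar> \<le> L * (\<delta> * sqrt (real K))"
          using lip[of ?f "?v v"] mult_left_mono[OF close[OF False] L0] by linarith
        moreover have "0 \<le> ?w v" by (intro prod_nonneg) (simp add: tent_nonneg)
        ultimately show ?thesis by (simp only: abs_mult abs_of_nonneg) (rule mult_right_mono)
      next
        case True
        then show ?thesis by (simp only: mult_zero_right abs_zero order_refl)
      qed
    qed
    also have "\<dots> = L * (\<delta> * sqrt (real K))" by (simp only: sum_distrib_left[symmetric] W mult_1_right)
    finally have "\<bar>g ?f - tent_approx g K \<delta> m (Rep_ell2 f)\<bar> \<le> L * (\<delta> * sqrt (real K))" .
    moreover have "\<bar>g f - g ?f\<bar> \<le> L * sqrt (tail_sq K f)"
      using lip[of f ?f] by (simp add: norm_sub_truncation)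
    ultimately show ?thesis using nn by linarith
  next
    case False
    then obtain i where i: "\<bar>Rep_ell2 f i / \<delta>\<bar> > real m" by (auto simp: not_le)
    then have "real m * \<delta> \<le> \<bar>Rep_ell2 f i\<bar>" using \<delta> by (simp add: field_simps)
    also have "\<dots> \<le> norm f" by (rule abs_Rep_ell2_le_norm)
    finally have "(real m * \<delta>)\<^sup>2 \<le> (norm f)\<^sup>2" using \<delta> by (intro power_mono) auto
    then have "2 * B * 1 \<le> 2 * B * ((norm f)\<^sup>2 / (real m * \<delta>)\<^sup>2)"
      using B0 \<delta> m by (intro mult_left_mono) (auto simp: field_simps)
    then have "2 * B \<le> 2 * B / (real m * \<delta>)\<^sup>2 * (norm f)\<^sup>2" by simp
    moreover have "\<bar>g f\<bar> \<le> B" "\<bar>tent_approx g K \<delta> m (Rep_ell2 f)\<bar> \<le> B"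
      by (rule g(2), rule abs_tent_approx_le[OF g(2)])
    moreover have "0 \<le> L * sqrt (tail_sq K f)" "0 \<le> L * (\<delta> * sqrt (real K))"
      using L0 \<delta> by (auto simp: tail_sq_nonneg)
    ultimately show ?thesis by linarith
  qed
qed

subsection \<open>Weak convergence in \<open>\<ell>\<^sub>2\<close> under a summable second moment bound\<close>

text \<open>For summable \<open>p\<close> this takes the place of tightness: one sequence controls
  the norm and the tails of all the random elements at once.\<close>

definition moment_bounded :: "'a measure \<Rightarrow> ('a \<Rightarrow> ell2) \<Rightarrow> (nat \<Rightarrow> real) \<Rightarrow> bool" where
  "moment_bounded M Z p \<longleftrightarrow> Z \<in> borel_measurable M \<and>
     (\<forall>x. integrable M (\<lambda>\<omega>. (Rep_ell2 (Z \<omega>) x)\<^sup>2) \<and> (\<integral>\<omega>. (Rep_ell2 (Z \<omega>) x)\<^sup>2 \<partial>M) \<le> p x)"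

lemma moment_bounded_nonneg:
  assumes "moment_bounded M Z p"
  shows "0 \<le> p x"
proof -
  have "0 \<le> (\<integral>\<omega>. (Rep_ell2 (Z \<omega>) x)\<^sup>2 \<partial>M)" by (rule Bochner_Integration.integral_nonneg) simp
  also have "\<dots> \<le> p x" using assms unfolding moment_bounded_def by blast
  finally show ?thesis .
qed

text \<open>Termwise integration of a nonnegative series. The case \<open>K = 0\<close> also bounds
  the mean squared norm by \<open>suminf p\<close>.\<close>

lemma expectation_tail_sq:
  assumes mb: "moment_bounded M Z p" and p: "summable p"
  shows "integrable M (\<lambda>\<omega>. tail_sq K (Z \<omega>))"
    and "(\<integral>\<omega>. tail_sq K (Z \<omega>) \<partial>M) \<le> (\<Sum>x. p (x + K))"
proof -
  have Z [measurable]: "Z \<in> borel_measurable M"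
    and int: "\<And>x. integrable M (\<lambda>\<omega>. (Rep_ell2 (Z \<omega>) x)\<^sup>2)"
    and le: "\<And>x. (\<integral>\<omega>. (Rep_ell2 (Z \<omega>) x)\<^sup>2 \<partial>M) \<le> p x"
    using mb unfolding moment_bounded_def by auto
  have p0: "0 \<le> p x" for x by (rule moment_bounded_nonneg[OF mb])
  have pK: "summable (\<lambda>x. p (x + K))" using p by (rule summable_ignore_initial_segment)
  have "(\<integral>\<^sup>+\<omega>. ennreal (tail_sq K (Z \<omega>)) \<partial>M) = (\<integral>\<^sup>+\<omega>. (\<Sum>x. ennreal ((Rep_ell2 (Z \<omega>) (x + K))\<^sup>2)) \<partial>M)"
    unfolding tail_sq_def
    by (intro nn_integral_cong suminf_ennreal2[symmetric] summable_ignore_initial_segment summable_Rep_ell2_sq) simp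
  also have "\<dots> = (\<Sum>x. \<integral>\<^sup>+\<omega>. ennreal ((Rep_ell2 (Z \<omega>) (x + K))\<^sup>2) \<partial>M)"
    by (rule nn_integral_suminf) measurable
  also have "\<dots> \<le> (\<Sum>x. ennreal (p (x + K)))"
  proof (rule suminf_le)
    fix x
    have "(\<integral>\<^sup>+\<omega>. ennreal ((Rep_ell2 (Z \<omega>) (x + K))\<^sup>2) \<partial>M) = ennreal (\<integral>\<omega>. (Rep_ell2 (Z \<omega>) (x + K))\<^sup>2 \<partial>M)"
      by (rule nn_integral_eq_integral[OF int]) simp
    then show "(\<integral>\<^sup>+\<omega>. ennreal ((Rep_ell2 (Z \<omega>) (x + K))\<^sup>2) \<partial>M) \<le> ennreal (p (x + K))"
      using le[of "x + K"] by (simp add: ennreal_leI)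
  qed simp_all
  also have "\<dots> = ennreal (\<Sum>x. p (x + K))" by (rule suminf_ennreal2[OF p0 pK])
  finally have nn: "(\<integral>\<^sup>+\<omega>. ennreal (tail_sq K (Z \<omega>)) \<partial>M) \<le> ennreal (\<Sum>x. p (x + K))" .
  show int: "integrable M (\<lambda>\<omega>. tail_sq K (Z \<omega>))"
  proof (rule integrableI_nonneg)
    show "(\<integral>\<^sup>+\<omega>. ennreal (tail_sq K (Z \<omega>)) \<partial>M) < \<infinity>"
      by (rule le_less_trans[OF nn]) simp
  qed (simp_all add: tail_sq_nonneg)
  have "ennreal (\<integral>\<omega>. tail_sq K (Z \<omega>) \<partial>M) \<le> ennreal (\<Sum>x. p (x + K))"
    using nn nn_integral_eq_integral[OF int] by (simp add: tail_sq_nonneg)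
  then show "(\<integral>\<omega>. tail_sq K (Z \<omega>) \<partial>M) \<le> (\<Sum>x. p (x + K))"
    using p0 pK by (subst (asm) ennreal_le_iff) (auto intro!: suminf_nonneg)
qed

text \<open>This makes norms of tails accessible through the expectation of \<open>tail_sq\<close>
  alone: choose \<open>e\<close> small first, then the tail small compared with the square of
  \<open>e\<close>.\<close>

lemma sqrt_le_add_divide:
  assumes "0 \<le> s" "0 < e"
  shows "sqrt s \<le> e + s / e"
proof -
  have "0 \<le> (sqrt s - e)\<^sup>2 + sqrt s * e" using assms by simp
  also have "\<dots> = s + e * e - sqrt s * e" using assms(1) by (simp add: power2_eq_square algebra_simps)
  finally have "sqrt s * e \<le> s + e * e" by simp
  then show ?thesis using assms(2) by (simp add: field_simps)
qed

lemma abs_integral_diff_le: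
  fixes F G H :: "'a \<Rightarrow> real"
  assumes "integrable M F" "integrable M G" "integrable M H" "AE \<omega> in M. \<bar>F \<omega> - G \<omega>\<bar> \<le> H \<omega>"
  shows "\<bar>(\<integral>\<omega>. F \<omega> \<partial>M) - (\<integral>\<omega>. G \<omega> \<partial>M)\<bar> \<le> (\<integral>\<omega>. H \<omega> \<partial>M)"
proof -
  have "\<bar>(\<integral>\<omega>. F \<omega> \<partial>M) - (\<integral>\<omega>. G \<omega> \<partial>M)\<bar> = \<bar>\<integral>\<omega>. F \<omega> - G \<omega> \<partial>M\<bar>"
    using assms by simp
  also have "\<dots> \<le> (\<integral>\<omega>. \<bar>F \<omega> - G \<omega>\<bar> \<partial>M)" by (rule integral_abs_bound)
  also have "\<dots> \<le> (\<integral>\<omega>. H \<omega> \<partial>M)" using assms by (intro integral_mono_AE) auto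
  finally show ?thesis .
qed

lemma borel_measurable_tent_approx [measurable]:
  "(\<lambda>x. tent_approx g K \<delta> m (Rep_ell2 x)) \<in> borel_measurable borel"
proof -
  have [measurable]: "tent m i \<in> borel_measurable borel" for i
    by (intro borel_measurable_continuous_onI continuous_at_imp_continuous_on) (simp add: isCont_tent)
  show ?thesis unfolding tent_approx_def by measurable
qed

lemma expectation_tent_approx_error:
  assumes "prob_space M" and mb: "moment_bounded M Z p" and p: "summable p"
    and g: "lipschitz_on L UNIV g" "\<And>x. \<bar>g x\<bar> \<le> B" and "\<delta> > 0" "m > 0" "\<eta> > 0"
  shows "\<bar>(\<integral>\<omega>. g (Z \<omega>) \<partial>M) - (\<integral>\<omega>. tent_approx g K \<delta> m (Rep_ell2 (Z \<omega>)) \<partial>M)\<bar>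
    \<le> L * (\<eta> + (\<Sum>x. p (x + K)) / \<eta>) + L * (\<delta> * sqrt (real K)) + 2 * B / (real m * \<delta>)\<^sup>2 * suminf p"
proof -
  interpret prob_space M by fact
  have Z [measurable]: "Z \<in> borel_measurable M" using mb by (simp add: moment_bounded_def)
  have L0: "0 \<le> L" using g(1) by (rule lipschitz_on_nonneg)
  have B0: "0 \<le> B" using g(2)[of 0] by linarith
  have [measurable]: "g \<in> borel_measurable borel"
    by (rule borel_measurable_continuous_onI[OF lipschitz_on_continuous_on[OF g(1)]])
  note tail = expectation_tail_sq[OF mb p]
  have "\<bar>(\<integral>\<omega>. g (Z \<omega>) \<partial>M) - (\<integral>\<omega>. tent_approx g K \<delta> m (Rep_ell2 (Z \<omega>)) \<partial>M)\<bar>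
    \<le> (\<integral>\<omega>. L * (\<eta> + tail_sq K (Z \<omega>) / \<eta>) + L * (\<delta> * sqrt (real K)) + 2 * B / (real m * \<delta>)\<^sup>2 * tail_sq 0 (Z \<omega>) \<partial>M)"
  proof (rule abs_integral_diff_le)
    show "integrable M (\<lambda>\<omega>. g (Z \<omega>))" using g(2) by (intro integrable_const_bound[of _ B]) auto
    show "integrable M (\<lambda>\<omega>. tent_approx g K \<delta> m (Rep_ell2 (Z \<omega>)))"
      using abs_tent_approx_le[OF g(2)] by (intro integrable_const_bound[of _ B]) auto
    show "integrable M (\<lambda>\<omega>. L * (\<eta> + tail_sq K (Z \<omega>) / \<eta>) + L * (\<delta> * sqrt (real K)) + 2 * B / (real m * \<delta>)\<^sup>2 * tail_sq 0 (Z \<omega>))"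
      using tail(1) by simp
    show "AE \<omega> in M. \<bar>g (Z \<omega>) - tent_approx g K \<delta> m (Rep_ell2 (Z \<omega>))\<bar>
      \<le> L * (\<eta> + tail_sq K (Z \<omega>) / \<eta>) + L * (\<delta> * sqrt (real K)) + 2 * B / (real m * \<delta>)\<^sup>2 * tail_sq 0 (Z \<omega>)"
    proof (rule AE_I2)
      fix \<omega>
      have "L * sqrt (tail_sq K (Z \<omega>)) \<le> L * (\<eta> + tail_sq K (Z \<omega>) / \<eta>)"
        using L0 \<open>\<eta> > 0\<close> by (intro mult_left_mono sqrt_le_add_divide tail_sq_nonneg)
      then show "\<bar>g (Z \<omega>) - tent_approx g K \<delta> m (Rep_ell2 (Z \<omega>))\<bar>
        \<le> L * (\<eta> + tail_sq K (Z \<omega>) / \<eta>) + L * (\<delta> * sqrt (real K)) + 2 * B / (real m * \<delta>)\<^sup>2 * tail_sq 0 (Z \<omega>)"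
        using tent_approx_error[OF g \<open>\<delta> > 0\<close> \<open>m > 0\<close>, of "Z \<omega>" K] unfolding tail_sq_0 by linarith
    qed
  qed
  also have "\<dots> = L * (\<eta> + (\<integral>\<omega>. tail_sq K (Z \<omega>) \<partial>M) / \<eta>) + L * (\<delta> * sqrt (real K))
      + 2 * B / (real m * \<delta>)\<^sup>2 * (\<integral>\<omega>. tail_sq 0 (Z \<omega>) \<partial>M)"
    using tail(1) by (simp add: prob_space)
  also have "\<dots> \<le> L * (\<eta> + (\<Sum>x. p (x + K)) / \<eta>) + L * (\<delta> * sqrt (real K)) + 2 * B / (real m * \<delta>)\<^sup>2 * suminf p"
    using tail(2)[of 0] tail(2)[of K] L0 B0 \<open>\<eta> > 0\<close>
    by (intro add_mono mult_left_mono divide_right_mono order_refl) auto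
  finally show ?thesis .
qed

lemma ell2_lipschitz_convergence:
  fixes Z :: "nat \<Rightarrow> 'a \<Rightarrow> ell2" and W :: "'b \<Rightarrow> ell2" and g :: "ell2 \<Rightarrow> real"
  assumes ps: "prob_space M" "prob_space N"
    and mb: "\<And>n. moment_bounded M (Z n) p" "moment_bounded N W p" and p: "summable p"
    and lin: "\<And>K t a. (\<lambda>n. \<integral>\<omega>. cos ((\<Sum>i<K. t i * Rep_ell2 (Z n \<omega>) i) + a) \<partial>M)
      \<longlonglongrightarrow> (\<integral>\<omega>. cos ((\<Sum>i<K. t i * Rep_ell2 (W \<omega>) i) + a) \<partial>N)"
    and g: "lipschitz_on L UNIV g" "\<And>x. \<bar>g x\<bar> \<le> B"
  shows "(\<lambda>n. \<integral>\<omega>. g (Z n \<omega>) \<partial>M) \<longlonglongrightarrow> (\<integral>\<omega>. g (W \<omega>) \<partial>N)"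
proof (rule LIMSEQ_I)
  fix e :: real assume e: "e > 0"
  interpret M: prob_space M by fact
  interpret N: prob_space N by fact
  have Zm [measurable]: "Z n \<in> borel_measurable M" for n using mb(1) by (simp add: moment_bounded_def)
  have Wm [measurable]: "W \<in> borel_measurable N" using mb(2) by (simp add: moment_bounded_def)
  have L0: "0 \<le> L" using g(1) by (rule lipschitz_on_nonneg)
  have B0: "0 \<le> B" using g(2)[of 0] by linarith
  have p0: "0 \<le> p x" for x by (rule moment_bounded_nonneg[OF mb(2)])
  \<comment> \<open>Each of \<open>\<eta>\<close>, \<open>K\<close>, \<open>\<delta>\<close>,
    \<open>m\<close> is chosen depending on the preceding ones. The three errors become
    \<open>e / 6\<close>, \<open>e / 12\<close> and \<open>e / 12\<close>, together
    \<open>e / 3\<close>. The added 1 in the denominators covers \<open>L = 0\<close>.\<close>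
  define \<eta> where "\<eta> = e / (12 * (L + 1))"
  have \<eta>: "\<eta> > 0" using e L0 by (simp add: \<eta>_def)
  have L\<eta>: "L * \<eta> \<le> e / 12" using e L0 by (simp add: \<eta>_def field_simps)
  obtain K where K: "norm (\<Sum>x. p (x + K)) < \<eta>\<^sup>2"
    using suminf_exist_split[OF _ p, of "\<eta>\<^sup>2"] \<eta> by auto
  define \<delta> where "\<delta> = e / (12 * (L * sqrt (real K) + 1))"
  have Ls: "0 \<le> L * sqrt (real K)" using L0 by simp
  then have \<delta>: "\<delta> > 0" using e unfolding \<delta>_def by (intro divide_pos_pos) auto
  have "L * (\<delta> * sqrt (real K)) = e / 12 * ((L * sqrt (real K)) / (L * sqrt (real K) + 1))"
    by (simp add: \<delta>_def)
  also have "\<dots> \<le> e / 12 * 1" using e Ls by (intro mult_left_mono) auto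
  finally have L\<delta>: "L * (\<delta> * sqrt (real K)) \<le> e / 12" by simp
  define c where "c = 2 * B * suminf p / \<delta>\<^sup>2"
  have c0: "0 \<le> c" unfolding c_def using B0 p p0 by (intro divide_nonneg_nonneg mult_nonneg_nonneg suminf_nonneg) auto
  obtain m0 :: nat where m0: "real m0 > 12 * c / e" using reals_Archimedean2 by blast
  define m where "m = Suc m0"
  have m: "m > 0" by (simp add: m_def)
  have "12 * c < e * real m" using m0 e by (simp add: m_def field_simps)
  also have "\<dots> \<le> e * (real m)\<^sup>2" using e m by (intro mult_left_mono) (auto simp: power2_eq_square)
  finally have "c / (real m)\<^sup>2 \<le> e / 12" using m by (simp add: field_simps)
  then have Bm: "2 * B / (real m * \<delta>)\<^sup>2 * suminf p \<le> e / 12"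
    by (simp add: c_def power_mult_distrib mult.commute)
  have "(\<Sum>x. p (x + K)) / \<eta> \<le> \<eta>" using K \<eta> by (simp add: field_simps power2_eq_square)
  then have "L * (\<eta> + (\<Sum>x. p (x + K)) / \<eta>) \<le> L * (\<eta> + \<eta>)" using L0 by (intro mult_left_mono) auto
  also have "\<dots> \<le> e / 6" using L\<eta> by (simp add: algebra_simps)
  finally have bound: "L * (\<eta> + (\<Sum>x. p (x + K)) / \<eta>) + L * (\<delta> * sqrt (real K)) + 2 * B / (real m * \<delta>)\<^sup>2 * suminf p \<le> e / 3"
    using L\<delta> Bm by simp
  let ?S = "\<lambda>y. tent_approx g K \<delta> m (Rep_ell2 y)"
  have ZS: "\<bar>(\<integral>\<omega>. g (Z n \<omega>) \<partial>M) - (\<integral>\<omega>. ?S (Z n \<omega>) \<partial>M)\<bar> \<le> e / 3" for n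
    using expectation_tent_approx_error[OF ps(1) mb(1) p g \<delta> m \<eta>] bound by (rule order_trans)
  have WS: "\<bar>(\<integral>\<omega>. g (W \<omega>) \<partial>N) - (\<integral>\<omega>. ?S (W \<omega>) \<partial>N)\<bar> \<le> e / 3"
    using expectation_tent_approx_error[OF ps(2) mb(2) p g \<delta> m \<eta>] bound by (rule order_trans)
  have S: "(\<lambda>n. \<integral>\<omega>. ?S (Z n \<omega>) \<partial>M) \<longlonglongrightarrow> (\<integral>\<omega>. ?S (W \<omega>) \<partial>N)"
  proof -
    have cont: "isCont (\<lambda>x. tent m j (x / \<delta>)) x" for j x
      by (intro isCont_o2[OF _ isCont_tent] continuous_intros) (use \<delta> in simp)
    have [measurable]: "tent m j \<in> borel_measurable borel" for j
      by (intro borel_measurable_continuous_onI continuous_at_imp_continuous_on) (simp add: isCont_tent)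
    have w01: "\<bar>\<Prod>i<K. tent m (f i) (y i)\<bar> \<le> 1" for f and y :: "nat \<Rightarrow> real"
      by (simp add: abs_prod prod_le_1 tent_nonneg tent_le_1 abs_of_nonneg)
    have intM: "integrable M (\<lambda>\<omega>. \<Prod>i<K. tent m (f i) (Rep_ell2 (Z n \<omega>) i / \<delta>))" for f n
      by (rule M.integrable_const_bound[of _ 1]) (use w01 in simp, measurable)
    have intN: "integrable N (\<lambda>\<omega>. \<Prod>i<K. tent m (f i) (Rep_ell2 (W \<omega>) i / \<delta>))" for f
      by (rule N.integrable_const_bound[of _ 1]) (use w01 in simp, measurable)
    have "(\<lambda>n. \<integral>\<omega>. (\<Prod>i<K. tent m (f i) (Rep_ell2 (Z n \<omega>) i / \<delta>)) \<partial>M)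
        \<longlonglongrightarrow> (\<integral>\<omega>. (\<Prod>i<K. tent m (f i) (Rep_ell2 (W \<omega>) i / \<delta>)) \<partial>N)" for f
    proof (rule tendsto_integral_prod[OF ps, where z = "\<lambda>n \<omega>. Rep_ell2 (Z n \<omega>)" and z' = "\<lambda>\<omega>. Rep_ell2 (W \<omega>)"
          and h = "\<lambda>i x. tent m (f i) (x / \<delta>)"])
    qed (use lin cont in \<open>simp_all add: tent_nonneg tent_le_1\<close>)
    then show ?thesis unfolding tent_approx_def
      by (subst (1 2) Bochner_Integration.integral_sum; (intro integrable_mult_right intM intN)?)
        (simp, intro tendsto_sum tendsto_mult tendsto_const)
  qed
  obtain n0 where n0: "\<And>n. n \<ge> n0 \<Longrightarrow> \<bar>(\<integral>\<omega>. ?S (Z n \<omega>) \<partial>M) - (\<integral>\<omega>. ?S (W \<omega>) \<partial>N)\<bar> < e / 3"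
    using LIMSEQ_D[OF S, of "e / 3"] e by auto
  have "norm ((\<integral>\<omega>. g (Z n \<omega>) \<partial>M) - (\<integral>\<omega>. g (W \<omega>) \<partial>N)) < e" if "n \<ge> n0" for n
    using ZS[of n] WS n0[OF that] unfolding real_norm_def by linarith
  then show "\<exists>n0. \<forall>n\<ge>n0. norm ((\<integral>\<omega>. g (Z n \<omega>) \<partial>M) - (\<integral>\<omega>. g (W \<omega>) \<partial>N)) < e" by blast
qed

section \<open>Deterministic comparison of the estimator with the block transform\<close>

context block_transform
begin

text \<open>If \<open>norm Z\<close> is below \<open>a * \<delta> / 2\<close>, every frequency is
  within \<open>\<delta> / 2\<close> of its target, and gaps of size \<open>\<delta>\<close> keep
  the order across cuts. Otherwise the last factor is at least 1 and pays for the crude bound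
  \<open>2 * B\<close>. No event has to be singled out later.\<close>

lemma estimator_test_function_bound:
  assumes q: "\<And>x. 0 \<le> q x" "\<And>x. x \<ge> m \<Longrightarrow> q x = 0" "\<And>x. p x = 0 \<Longrightarrow> q x = 0"
    and a: "a > 0" and K: "cut K"
    and \<delta>: "\<delta> > 0" "\<And>b. b \<le> K \<Longrightarrow> p b < p (b - 1) \<Longrightarrow> \<delta> \<le> p (b - 1) - p b"
    and Z: "\<And>x. Rep_ell2 Z x = a * (q x - p x)"
    and E: "\<And>x. Rep_ell2 E x = a * (extend_by_zero (T (map q [0..<m])) x - p x)"
    and f: "lipschitz_on L UNIV f" "\<And>x. \<bar>f x\<bar> \<le> (B :: real)"
  shows "\<bar>f E - f (block_map Z)\<bar> \<le> 2 * L * sqrt (tail_sq K Z) + 2 * B * (4 * (norm Z)\<^sup>2 / (a * \<delta>)\<^sup>2)"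
proof -
  have L0: "0 \<le> L" using f(1) by (rule lipschitz_on_nonneg)
  have B0: "0 \<le> B" using f(2)[of 0] by linarith
  show ?thesis
  proof (cases "norm Z < a * \<delta> / 2")
    case True
    have close: "\<bar>q x - p x\<bar> < \<delta> / 2" for x
    proof -
      have "a * \<bar>q x - p x\<bar> \<le> norm Z"
        using abs_Rep_ell2_le_norm[of Z x] a by (simp add: Z abs_mult)
      also have "norm Z < a * (\<delta> / 2)" using True by simp
      finally have "a * \<bar>q x - p x\<bar> < a * (\<delta> / 2)" .
      then show ?thesis using a by (simp only: mult_less_cancel_left_pos)
    qed
    have "q y \<le> q x" if "b \<le> K" "cut b" "x < b" "b \<le> y" for b x y
    \<comment> \<open>At a cut without a drop there is no gap to use; there \<open>q\<close>
      vanishes from \<open>b\<close> on because \<open>p\<close> does.\<close>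
    proof (cases "p (b - 1) = 0")
      case True
      then have "p y = 0" using p_antimono[of "b - 1" y] p_nonneg[of y] that by simp
      then show ?thesis using q by simp
    next
      case False
      then have "p b < p (b - 1)" using that by (auto simp: cut_def)
      then have "\<delta> \<le> p (b - 1) - p b" using \<delta>(2) that by simp
      moreover have "p (b - 1) \<le> p x" "p y \<le> p b" using that by (auto intro!: p_antimono)
      ultimately show ?thesis using close[of x] close[of y] by linarith
    qed
    then have "norm (E - block_map Z) \<le> 2 * sqrt (tail_sq K Z)"
      by (intro norm_estimator_block_map_le[OF q(1,2) a K _ Z E])
    then have "L * norm (E - block_map Z) \<le> L * (2 * sqrt (tail_sq K Z))"
      using L0 by (rule mult_left_mono)
    moreover have "\<bar>f E - f (block_map Z)\<bar> \<le> L * norm (E - block_map Z)"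
      using lipschitz_onD[OF f(1), of E "block_map Z"] by (simp add: dist_real_def dist_norm)
    moreover have "0 \<le> 2 * B * (4 * (norm Z)\<^sup>2 / (a * \<delta>)\<^sup>2)" using B0 by simp
    ultimately show ?thesis by linarith
  next
    case False
    then have "(a * \<delta> / 2)\<^sup>2 \<le> (norm Z)\<^sup>2" using a \<delta>(1) by (intro power_mono) auto
    then have "1 \<le> 4 * (norm Z)\<^sup>2 / (a * \<delta>)\<^sup>2" using a \<delta>(1) by (simp add: field_simps)
    then have "2 * B * 1 \<le> 2 * B * (4 * (norm Z)\<^sup>2 / (a * \<delta>)\<^sup>2)" using B0 by (intro mult_left_mono) auto
    moreover have "\<bar>f E\<bar> \<le> B" "\<bar>f (block_map Z)\<bar> \<le> B" by (rule f(2))+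
    moreover have "0 \<le> 2 * L * sqrt (tail_sq K Z)" using L0 by (simp add: tail_sq_nonneg)
    ultimately show ?thesis by linarith
  qed
qed

lemma gap_exists:
  obtains \<delta> where "\<delta> > 0" "\<And>b. b \<le> K \<Longrightarrow> p b < p (b - 1) \<Longrightarrow> \<delta> \<le> p (b - 1) - p b"
proof
  \<comment> \<open>The element 1 keeps the set nonempty when \<open>p\<close> has no drop up to
    \<open>K\<close>.\<close>
  let ?G = "insert 1 ((\<lambda>b. p (b - 1) - p b) ` {b. b \<le> K \<and> p b < p (b - 1)})"
  show "0 < Min ?G" by (subst Min_gr_iff) auto
  show "Min ?G \<le> p (b - 1) - p b" if "b \<le> K" "p b < p (b - 1)" for b
    using that by (intro Min_le) auto
qed

end

subsection \<open>Gaussian limits\<close>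

lemma (in prob_space) gaussian_rv_square_integrable:
  assumes "gaussian_rv M U"
  shows "integrable M (\<lambda>\<omega>. (U \<omega>)\<^sup>2)"
proof -
  have [measurable]: "U \<in> borel_measurable M" using assms by (simp add: gaussian_rv_def)
  consider \<mu> where "AE \<omega> in M. U \<omega> = \<mu>"
    | \<mu> \<sigma> where "\<sigma> > 0" "distributed M lborel U (normal_density \<mu> \<sigma>)"
    using assms unfolding gaussian_rv_def by blast
  then show ?thesis
  proof cases
    case (1 \<mu>)
    then have "integrable M (\<lambda>\<omega>. (U \<omega>)\<^sup>2) \<longleftrightarrow> integrable M (\<lambda>\<omega>. \<mu>\<^sup>2)"
      by (intro integrable_cong_AE) auto
    then show ?thesis by simp
  next
    case (2 \<mu> \<sigma>)
    \<comment> \<open>Normal moments are known in centred form, hence the expansion in powers of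
      \<open>x - \<mu>\<close> with exponents 1 and 0 written out.\<close>
    have eq: "normal_density \<mu> \<sigma> x * x\<^sup>2 = normal_density \<mu> \<sigma> x * (x - \<mu>)^2
        + 2 * \<mu> * (normal_density \<mu> \<sigma> x * (x - \<mu>)^1) + \<mu>\<^sup>2 * (normal_density \<mu> \<sigma> x * (x - \<mu>)^0)" for x
      by (simp add: power2_eq_square algebra_simps)
    have "integrable lborel (\<lambda>x. normal_density \<mu> \<sigma> x * x\<^sup>2)"
      unfolding eq
      by (intro Bochner_Integration.integrable_add integrable_mult_right integrable_normal_moment 2(1))
    then show ?thesis
      using distributed_integrable[OF 2(2), of "\<lambda>x. x\<^sup>2"] by simp
  qed
qed

lemma (in prob_space) gaussian_rv_integrable:
  assumes "gaussian_rv M U"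
  shows "integrable M U"
  by (rule square_integrable_imp_integrable[OF _ gaussian_rv_square_integrable[OF assms]])
    (use assms in \<open>simp add: gaussian_rv_def\<close>)

text \<open>A centred point mass is the case \<open>\<sigma> = 0\<close> of the formula, so linear
  combinations of variance 0 need no separate treatment when the limit is identified.\<close>

lemma (in prob_space) gaussian_rv_integral_cos:
  assumes U: "gaussian_rv M U" and mean: "expectation U = 0"
    and var: "(\<integral>\<omega>. (U \<omega>)\<^sup>2 \<partial>M) = \<sigma>\<^sup>2" and "0 \<le> \<sigma>"
  shows "(\<integral>\<omega>. cos (U \<omega> + a) \<partial>M) = (\<integral>x. cos (\<sigma> * x + a) \<partial>std_normal_distribution)"
proof -
  have [measurable]: "U \<in> borel_measurable M" using U by (simp add: gaussian_rv_def)
  interpret G: real_distribution std_normal_distribution by (rule real_dist_normal_dist)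
  consider \<mu> where "AE \<omega> in M. U \<omega> = \<mu>"
    | \<mu> \<tau> where "\<tau> > 0" "distributed M lborel U (normal_density \<mu> \<tau>)"
    using U unfolding gaussian_rv_def by blast
  then show ?thesis
  proof cases
    case (1 \<mu>)
    have "expectation U = (\<integral>\<omega>. \<mu> \<partial>M)" using 1 by (intro integral_cong_AE) auto
    then have "\<mu> = 0" using mean by (simp add: prob_space)
    have "(\<integral>\<omega>. (U \<omega>)\<^sup>2 \<partial>M) = (\<integral>\<omega>. 0 \<partial>M)" using 1 \<open>\<mu> = 0\<close> by (intro integral_cong_AE) auto
    then have "\<sigma> = 0" using var by simp
    have "(\<integral>\<omega>. cos (U \<omega> + a) \<partial>M) = (\<integral>\<omega>. cos a \<partial>M)" using 1 \<open>\<mu> = 0\<close> by (intro integral_cong_AE) auto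
    then show ?thesis using \<open>\<sigma> = 0\<close> G.prob_space by (simp add: prob_space)
  next
    case (2 \<mu> \<tau>)
    have "\<mu> = 0" using normal_distributed_expectation[OF 2] mean by simp
    have "\<tau>\<^sup>2 = \<sigma>\<^sup>2" using normal_distributed_variance[OF 2] mean var by simp
    then have "\<tau> = \<sigma>" by (rule power2_eq_imp_eq) (use 2(1) \<open>0 \<le> \<sigma>\<close> in auto)
    have \<sigma>: "\<sigma> > 0" using 2(1) \<open>\<tau> = \<sigma>\<close> by simp
    have D: "distributed M lborel (\<lambda>\<omega>. (U \<omega> - 0) / \<sigma>) std_normal_density"
      using 2(2) unfolding \<open>\<mu> = 0\<close> \<open>\<tau> = \<sigma>\<close>
      by (rule normal_standard_normal_convert[OF \<sigma>, THEN iffD1])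
    have "(\<integral>x. cos (\<sigma> * x + a) \<partial>std_normal_distribution) = (\<integral>x. std_normal_density x * cos (\<sigma> * x + a) \<partial>lborel)"
      by (subst integral_density) auto
    also have "\<dots> = (\<integral>\<omega>. cos (\<sigma> * ((U \<omega> - 0) / \<sigma>) + a) \<partial>M)"
      by (rule distributed_integral[OF D]) auto
    also have "\<dots> = (\<integral>\<omega>. cos (U \<omega> + a) \<partial>M)" using \<sigma> by simp
    finally show ?thesis by simp
  qed
qed

lemma gaussian_process_linear_combination:
  fixes P :: "nat \<Rightarrow> real"
  assumes "prob_space N" and gp: "gaussian_process N Y"
    and mean: "\<And>x. (\<integral>\<omega>. Y \<omega> x \<partial>N) = 0"
    and cov: "\<And>x x'. covariance N (\<lambda>\<omega>. Y \<omega> x) (\<lambda>\<omega>. Y \<omega> x') = P x * (if x = x' then 1 else 0) - P x * P x'"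
  shows "(\<integral>\<omega>. (\<Sum>i<K. t i * Y \<omega> i) \<partial>N) = 0"
    and "(\<integral>\<omega>. (\<Sum>i<K. t i * Y \<omega> i)\<^sup>2 \<partial>N) = (\<Sum>i<K. (t i)\<^sup>2 * P i) - (\<Sum>i<K. t i * P i)\<^sup>2"
    and "integrable N (\<lambda>\<omega>. (Y \<omega> x)\<^sup>2)"
    and "(\<integral>\<omega>. (Y \<omega> x)\<^sup>2 \<partial>N) = P x - (P x)\<^sup>2"
proof -
  interpret prob_space N by fact
  have g: "gaussian_rv N (\<lambda>\<omega>. Y \<omega> x)" for x
    using gp[unfolded gaussian_process_def, rule_format, of "{x}" "\<lambda>_. 1"] by simp
  have [measurable]: "(\<lambda>\<omega>. Y \<omega> x) \<in> borel_measurable N" for x using g[of x] by (simp add: gaussian_rv_def)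
  have int: "integrable N (\<lambda>\<omega>. Y \<omega> x)" for x by (rule gaussian_rv_integrable[OF g])
  show int2: "integrable N (\<lambda>\<omega>. (Y \<omega> x)\<^sup>2)" for x by (rule gaussian_rv_square_integrable[OF g])
  have intp: "integrable N (\<lambda>\<omega>. Y \<omega> x * Y \<omega> x')" for x x'
  proof (rule Bochner_Integration.integrable_bound)
    show "integrable N (\<lambda>\<omega>. (Y \<omega> x)\<^sup>2 + (Y \<omega> x')\<^sup>2)" by (intro Bochner_Integration.integrable_add int2)
    show "AE \<omega> in N. norm (Y \<omega> x * Y \<omega> x') \<le> norm ((Y \<omega> x)\<^sup>2 + (Y \<omega> x')\<^sup>2)"
    proof (rule AE_I2)
      fix \<omega>
      have "2 * (\<bar>Y \<omega> x\<bar> * \<bar>Y \<omega> x'\<bar>) \<le> (Y \<omega> x)\<^sup>2 + (Y \<omega> x')\<^sup>2"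
        using sum_squares_bound[of "\<bar>Y \<omega> x\<bar>" "\<bar>Y \<omega> x'\<bar>"] by simp
      moreover have "0 \<le> \<bar>Y \<omega> x\<bar> * \<bar>Y \<omega> x'\<bar>" by simp
      ultimately show "norm (Y \<omega> x * Y \<omega> x') \<le> norm ((Y \<omega> x)\<^sup>2 + (Y \<omega> x')\<^sup>2)"
        unfolding real_norm_def abs_mult by linarith
    qed
  qed measurable
  have prod: "(\<integral>\<omega>. Y \<omega> x * Y \<omega> x' \<partial>N) = P x * (if x = x' then 1 else 0) - P x * P x'" for x x'
    using cov[of x x'] unfolding covariance_def mean by simp
  show "(\<integral>\<omega>. (Y \<omega> x)\<^sup>2 \<partial>N) = P x - (P x)\<^sup>2"
    using prod[of x x] by (simp add: power2_eq_square)
  show "(\<integral>\<omega>. (\<Sum>i<K. t i * Y \<omega> i) \<partial>N) = 0"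
    by (subst Bochner_Integration.integral_sum) (simp_all add: int mean)
  have "(\<integral>\<omega>. (\<Sum>i<K. t i * Y \<omega> i)\<^sup>2 \<partial>N) = (\<integral>\<omega>. (\<Sum>i<K. \<Sum>j<K. t i * t j * (Y \<omega> i * Y \<omega> j)) \<partial>N)"
    unfolding power2_eq_square sum_product by (simp add: algebra_simps)
  also have "\<dots> = (\<Sum>i<K. \<Sum>j<K. t i * t j * (P i * (if i = j then 1 else 0) - P i * P j))"
    by (simp add: Bochner_Integration.integral_sum integrable_sum intp prod)
  also have "\<dots> = (\<Sum>i<K. (\<Sum>j<K. if i = j then t i * t i * P i else 0) - (\<Sum>j<K. (t i * P i) * (t j * P j)))"
    unfolding sum_subtractf[symmetric] by (intro sum.cong refl) (simp add: algebra_simps)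
  also have "\<dots> = (\<Sum>i<K. (t i)\<^sup>2 * P i) - (\<Sum>i<K. t i * P i)\<^sup>2"
    by (simp add: sum_subtractf sum_product power2_eq_square)
  finally show "(\<integral>\<omega>. (\<Sum>i<K. t i * Y \<omega> i)\<^sup>2 \<partial>N) = (\<Sum>i<K. (t i)\<^sup>2 * P i) - (\<Sum>i<K. t i * P i)\<^sup>2" .
qed

subsection \<open>The empirical process of an i.i.d. sample\<close>

locale iid_sample = prob_space M for M :: "'a measure" +
  fixes X :: "nat \<Rightarrow> 'a \<Rightarrow> nat" and p :: "nat pmf"
  assumes indep: "indep_vars (\<lambda>_. count_space UNIV) X UNIV"
    and dist: "\<And>i. distr M (count_space UNIV) (X i) = measure_pmf p"
begin

lemma measurable_X [measurable]: "X i \<in> measurable M (count_space UNIV)"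
  using indep by (simp add: indep_vars_def2)

lemma expectation_X: "(\<integral>\<omega>. \<phi> (X i \<omega>) \<partial>M) = (\<integral>x. \<phi> x \<partial>measure_pmf p)" for \<phi> :: "nat \<Rightarrow> real"
  unfolding dist[of i, symmetric] by (rule integral_distr[symmetric]) simp_all

lemma integrable_X: "(\<And>x. \<bar>\<phi> x\<bar> \<le> B) \<Longrightarrow> integrable M (\<lambda>\<omega>. \<phi> (X i \<omega>))" for \<phi> :: "nat \<Rightarrow> real"
  by (rule integrable_const_bound[of _ B]) simp_all

lemma indep_X: "indep_vars (\<lambda>_. borel) (\<lambda>i \<omega>. \<phi> (X i \<omega>)) I" for \<phi> :: "nat \<Rightarrow> real"
  by (rule indep_vars_subset[OF indep_vars_compose2[OF indep]]) simp_all

text \<open>It makes the empirical frequencies vanish almost surely wherever \<open>p\<close> does,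
  which replaces separation at the cuts that are not drops.\<close>

lemma AE_X: "AE \<omega> in M. \<forall>i. pmf p (X i \<omega>) > 0"
proof -
  have "AE \<omega> in M. pmf p (X i \<omega>) > 0" for i
  proof -
    have "AE x in measure_pmf p. pmf p x > 0" by (simp add: AE_measure_pmf_iff pmf_positive)
    then have "AE x in distr M (count_space UNIV) (X i). pmf p x > 0" by (simp only: dist)
    then show ?thesis by (subst (asm) AE_distr_iff) simp_all
  qed
  then show ?thesis by (simp add: AE_all_countable)
qed

lemma second_moment_sum:
  fixes \<phi> :: "nat \<Rightarrow> real"
  assumes B: "\<And>x. \<bar>\<phi> x\<bar> \<le> B" and mean: "(\<integral>x. \<phi> x \<partial>measure_pmf p) = 0"
  shows "integrable M (\<lambda>\<omega>. (\<Sum>i<n. \<phi> (X i \<omega>))\<^sup>2)"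
    and "(\<integral>\<omega>. (\<Sum>i<n. \<phi> (X i \<omega>))\<^sup>2 \<partial>M) = real n * (\<integral>x. (\<phi> x)\<^sup>2 \<partial>measure_pmf p)"
proof -
  have B0: "0 \<le> B" using B[of 0] by linarith
  have int: "integrable M (\<lambda>\<omega>. \<phi> (X i \<omega>) * \<phi> (X j \<omega>))" for i j
    using B B0 by (intro integrable_const_bound[of _ "B * B"]) (auto simp: abs_mult intro!: mult_mono)
  have cross: "(\<integral>\<omega>. \<phi> (X i \<omega>) * \<phi> (X j \<omega>) \<partial>M) = (if i = j then (\<integral>x. (\<phi> x)\<^sup>2 \<partial>measure_pmf p) else 0)" for i j
  proof (cases "i = j")
    case True
    then show ?thesis using expectation_X[of "\<lambda>x. (\<phi> x)\<^sup>2" i] by (simp add: power2_eq_square)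
  next
    case False
    have "(\<integral>\<omega>. (\<Prod>k\<in>{i, j}. \<phi> (X k \<omega>)) \<partial>M) = (\<Prod>k\<in>{i, j}. \<integral>\<omega>. \<phi> (X k \<omega>) \<partial>M)"
      by (intro indep_vars_lebesgue_integral indep_X integrable_X[OF B]) simp
    then show ?thesis using False by (simp add: expectation_X mean)
  qed
  have sq: "(\<Sum>i<n. \<phi> (X i \<omega>))\<^sup>2 = (\<Sum>i<n. \<Sum>j<n. \<phi> (X i \<omega>) * \<phi> (X j \<omega>))" for \<omega>
    by (simp only: power2_eq_square sum_product)
  show "integrable M (\<lambda>\<omega>. (\<Sum>i<n. \<phi> (X i \<omega>))\<^sup>2)"
    unfolding sq by (intro Bochner_Integration.integrable_sum int)
  have "(\<integral>\<omega>. (\<Sum>i<n. \<phi> (X i \<omega>))\<^sup>2 \<partial>M) = (\<Sum>i<n. \<Sum>j<n. \<integral>\<omega>. \<phi> (X i \<omega>) * \<phi> (X j \<omega>) \<partial>M)"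
    unfolding sq by (simp add: Bochner_Integration.integral_sum int)
  then show "(\<integral>\<omega>. (\<Sum>i<n. \<phi> (X i \<omega>))\<^sup>2 \<partial>M) = real n * (\<integral>x. (\<phi> x)\<^sup>2 \<partial>measure_pmf p)"
    by (simp add: cross)
qed

text \<open>The centred contribution of one observation \<open>k\<close> to the linear combination
  of the first \<open>K\<close> fluctuations with coefficients \<open>t\<close>; see
  \<open>linear_fluctuation_emp\<close>.\<close>

definition score :: "nat \<Rightarrow> (nat \<Rightarrow> real) \<Rightarrow> nat \<Rightarrow> real" where
  "score K t k = (if k < K then t k else 0) - (\<Sum>x<K. t x * pmf p x)"

lemma score_bound: "\<bar>score K t k\<bar> \<le> (\<Sum>x<K. \<bar>t x\<bar>) + \<bar>\<Sum>x<K. t x * pmf p x\<bar>"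
proof -
  have "\<bar>if k < K then t k else 0\<bar> \<le> (\<Sum>x<K. \<bar>t x\<bar>)"
  proof (cases "k < K")
    case True
    then show ?thesis using member_le_sum[of k "{..<K}" "\<lambda>x. \<bar>t x\<bar>"] by simp
  qed (simp add: sum_nonneg)
  then show ?thesis unfolding score_def by linarith
qed

lemma expectation_score:
  shows "(\<integral>k. score K t k \<partial>measure_pmf p) = 0"
    and "(\<integral>k. (score K t k)\<^sup>2 \<partial>measure_pmf p) = (\<Sum>x<K. (t x)\<^sup>2 * pmf p x) - (\<Sum>x<K. t x * pmf p x)\<^sup>2"
proof -
  let ?f = "\<lambda>k. if k < K then t k else 0" let ?m = "\<Sum>x<K. t x * pmf p x"
  have f: "(\<integral>k. ?f k \<partial>measure_pmf p) = ?m"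
    by (subst integral_measure_pmf_real[of "{..<K}"]) (auto split: if_splits)
  have f2: "(\<integral>k. (?f k)\<^sup>2 \<partial>measure_pmf p) = (\<Sum>x<K. (t x)\<^sup>2 * pmf p x)"
    by (subst integral_measure_pmf_real[of "{..<K}"]) (auto split: if_splits)
  have fb: "\<bar>?f k\<bar> \<le> (\<Sum>x<K. \<bar>t x\<bar>)" for k
  proof (cases "k < K")
    case True
    then show ?thesis using member_le_sum[of k "{..<K}" "\<lambda>x. \<bar>t x\<bar>"] by simp
  qed (simp add: sum_nonneg)
  have i1: "integrable (measure_pmf p) ?f"
    using fb by (intro measure_pmf.integrable_const_bound[of _ "\<Sum>x<K. \<bar>t x\<bar>"]) auto
  have i2: "integrable (measure_pmf p) (\<lambda>k. (?f k)\<^sup>2)"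
    using power_mono[OF fb, of _ 2]
    by (intro measure_pmf.integrable_const_bound[of _ "(\<Sum>x<K. \<bar>t x\<bar>)\<^sup>2"]) auto
  show "(\<integral>k. score K t k \<partial>measure_pmf p) = 0"
    unfolding score_def using i1 f by simp
  have "(score K t k)\<^sup>2 = (?f k)\<^sup>2 - 2 * ?m * ?f k + ?m\<^sup>2" for k
    unfolding score_def by (simp add: power2_diff algebra_simps)
  then have "(\<integral>k. (score K t k)\<^sup>2 \<partial>measure_pmf p) = (\<integral>k. (?f k)\<^sup>2 - 2 * ?m * ?f k + ?m\<^sup>2 \<partial>measure_pmf p)"
    by (simp only:)
  also have "\<dots> = (\<integral>k. (?f k)\<^sup>2 \<partial>measure_pmf p) - 2 * ?m * (\<integral>k. ?f k \<partial>measure_pmf p) + ?m\<^sup>2"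
    by (subst Bochner_Integration.integral_add, intro Bochner_Integration.integrable_diff i2 integrable_mult_right i1, simp,
        subst Bochner_Integration.integral_diff[OF i2 integrable_mult_right[OF i1]]) simp
  also have "\<dots> = (\<Sum>x<K. (t x)\<^sup>2 * pmf p x) - ?m\<^sup>2" unfolding f f2 by (simp add: power2_eq_square)
  finally show "(\<integral>k. (score K t k)\<^sup>2 \<partial>measure_pmf p) = (\<Sum>x<K. (t x)\<^sup>2 * pmf p x) - ?m\<^sup>2" .
qed

lemma emp_eq_sum: "emp X n \<omega> x = (\<Sum>i<n. of_bool (X i \<omega> = x)) / real n"
proof -
  have "{i. i < n \<and> X i \<omega> = x} = {..<n} \<inter> {i. X i \<omega> = x}" by auto
  then show ?thesis unfolding emp_def by (simp add: sum_of_bool_eq)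
qed

lemma linear_fluctuation_emp:
  "(\<Sum>x<K. t x * fluctuation (pmf p) (emp X) n \<omega> x) = (\<Sum>i<n. score K t (X i \<omega>)) / sqrt (real n)"
proof (cases "n = 0")
  case False
  have "(\<Sum>x<K. t x * emp X n \<omega> x) = (\<Sum>x<K. \<Sum>i<n. t x * of_bool (X i \<omega> = x)) / real n"
    unfolding emp_eq_sum sum_divide_distrib sum_distrib_left
    by (intro sum.cong refl) simp
  also have "\<dots> = (\<Sum>i<n. \<Sum>x<K. if x = X i \<omega> then t x else 0) / real n"
    by (subst sum.swap) (auto intro!: sum.cong arg_cong[where f = "\<lambda>z. z / real n"])
  also have "\<dots> = (\<Sum>i<n. if X i \<omega> < K then t (X i \<omega>) else 0) / real n"
    by (simp add: sum.delta)
  finally have e: "(\<Sum>x<K. t x * emp X n \<omega> x) = (\<Sum>i<n. if X i \<omega> < K then t (X i \<omega>) else 0) / real n" .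
  have "(\<Sum>x<K. t x * fluctuation (pmf p) (emp X) n \<omega> x)
      = sqrt (real n) * ((\<Sum>x<K. t x * emp X n \<omega> x) - (\<Sum>x<K. t x * pmf p x))"
    unfolding fluctuation_def sum_subtractf[symmetric] sum_distrib_left
    by (intro sum.cong refl) (simp add: algebra_simps)
  also have "\<dots> = sqrt (real n) / real n * ((\<Sum>i<n. if X i \<omega> < K then t (X i \<omega>) else 0) - real n * (\<Sum>x<K. t x * pmf p x))"
    unfolding e using False by (simp add: field_simps)
  also have "\<dots> = sqrt (real n) / real n * (\<Sum>i<n. score K t (X i \<omega>))"
    unfolding score_def sum_subtractf by simp
  also have "sqrt (real n) / real n = 1 / sqrt (real n)"
    using False by (simp add: field_simps)
  finally show ?thesis by simp
qed (simp add: fluctuation_def)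

lemma linear_combination_clt:
  fixes t :: "nat \<Rightarrow> real"
  assumes \<sigma>: "\<sigma> = sqrt ((\<Sum>x<K. (t x)\<^sup>2 * pmf p x) - (\<Sum>x<K. t x * pmf p x)\<^sup>2)"
  shows "(\<lambda>n. \<integral>\<omega>. cos ((\<Sum>x<K. t x * fluctuation (pmf p) (emp X) n \<omega> x) + a) \<partial>M)
    \<longlonglongrightarrow> (\<integral>x. cos (\<sigma> * x + a) \<partial>std_normal_distribution)"
proof -
  let ?S = "\<lambda>n \<omega>. \<Sum>i<n. score K t (X i \<omega>)"
  interpret G: real_distribution std_normal_distribution by (rule real_dist_normal_dist)
  note sb = score_bound[of K t]
  have nn: "0 \<le> (\<integral>k. (score K t k)\<^sup>2 \<partial>measure_pmf p)" by (rule Bochner_Integration.integral_nonneg) simp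
  then have \<sigma>2: "(\<integral>k. (score K t k)\<^sup>2 \<partial>measure_pmf p) = \<sigma>\<^sup>2" and "0 \<le> \<sigma>"
    unfolding \<sigma> expectation_score(2) by simp_all
  have Sm [measurable]: "(\<lambda>\<omega>. score K t (X i \<omega>)) \<in> borel_measurable M" for i
    by (rule measurable_compose[OF measurable_X]) simp
  show ?thesis
  \<comment> \<open>The central limit theorem is applied only with positive variance. With variance
    0 the sums vanish almost surely.\<close>
  proof (cases "\<sigma> = 0")
    case True
    have "(\<integral>\<omega>. cos (?S n \<omega> / sqrt (real n) + a) \<partial>M) = cos a" for n
    proof -
      have "(\<integral>\<omega>. (?S n \<omega>)\<^sup>2 \<partial>M) = 0"
        using second_moment_sum(2)[OF sb expectation_score(1)] \<sigma>2 True by simp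
      then have "AE \<omega> in M. (?S n \<omega>)\<^sup>2 = 0"
        using integral_nonneg_eq_0_iff_AE[OF second_moment_sum(1)[OF sb expectation_score(1), of n]] by simp
      then have "(\<integral>\<omega>. cos (?S n \<omega> / sqrt (real n) + a) \<partial>M) = (\<integral>\<omega>. cos a \<partial>M)"
        by (intro integral_cong_AE) auto
      then show ?thesis by (simp add: prob_space)
    qed
    then show ?thesis unfolding linear_fluctuation_emp using True G.prob_space by simp
  next
    case False
    then have pos: "\<sigma> > 0" using \<open>0 \<le> \<sigma>\<close> by simp
    let ?D = "\<lambda>n. distr M borel (\<lambda>\<omega>. ?S n \<omega> / sqrt (real n * \<sigma>\<^sup>2))"
    have "weak_conv_m ?D std_normal_distribution"
    proof (rule central_limit_theorem_zero_mean[OF _ _ pos])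
      show "indep_vars (\<lambda>_. borel) (\<lambda>i \<omega>. score K t (X i \<omega>)) UNIV" by (rule indep_X)
      show m0: "expectation (\<lambda>\<omega>. score K t (X n \<omega>)) = 0" for n
        unfolding expectation_X by (rule expectation_score)
      show "integrable M (\<lambda>\<omega>. (score K t (X n \<omega>))\<^sup>2)" for n
        using power_mono[OF sb, of _ 2]
        by (intro integrable_X[of "\<lambda>k. (score K t k)\<^sup>2" "((\<Sum>x<K. \<bar>t x\<bar>) + \<bar>\<Sum>x<K. t x * pmf p x\<bar>)\<^sup>2"]) simp
      show "variance (\<lambda>\<omega>. score K t (X n \<omega>)) = \<sigma>\<^sup>2" for n
        unfolding m0 using expectation_X[of "\<lambda>k. (score K t k)\<^sup>2" n] \<sigma>2 by simp
      show "distr M borel (\<lambda>\<omega>. score K t (X n \<omega>)) = distr (measure_pmf p) borel (score K t)" for n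
        unfolding dist[of n, symmetric] by (subst distr_distr) (simp_all add: comp_def)
    qed
    \<comment> \<open>The limit law is standardized, so the scale \<open>\<sigma>\<close> is moved
      into the test function.\<close>
    then have "(\<lambda>n. \<integral>x. cos (\<sigma> * x + a) \<partial>?D n) \<longlonglongrightarrow> (\<integral>x. cos (\<sigma> * x + a) \<partial>std_normal_distribution)"
      by (intro weak_conv_imp_integral_bdd_continuous_conv[OF real_distribution_distr real_dist_normal_dist, where B = 1])
        auto
    moreover have "(\<integral>x. cos (\<sigma> * x + a) \<partial>?D n) = (\<integral>\<omega>. cos (?S n \<omega> / sqrt (real n) + a) \<partial>M)" for n
    proof -
      have "\<sigma> * (?S n \<omega> / sqrt (real n * \<sigma>\<^sup>2)) = ?S n \<omega> / sqrt (real n)" for \<omega>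
        using pos by (simp add: real_sqrt_mult)
      then show ?thesis by (subst integral_distr) simp_all
    qed
    ultimately show ?thesis unfolding linear_fluctuation_emp by simp
  qed
qed

end

section \<open>Square summability and measurability of functions of the sample\<close>

lemma summable_pmf_nat: "summable (pmf (p :: nat pmf))"
proof (rule summableI_nonneg_bounded)
  fix n
  have "(\<Sum>x<n. pmf p x) = measure (measure_pmf p) {..<n}" by (simp add: measure_measure_pmf_finite)
  then show "(\<Sum>x<n. pmf p x) \<le> 1" by simp
qed simp

lemma square_summable_pmf: "square_summable (pmf (p :: nat pmf))"
  unfolding square_summable_def
proof (rule summable_comparison_test'[OF summable_pmf_nat[of p]])
  fix n
  show "norm ((pmf p n)\<^sup>2) \<le> pmf p n"
    using mult_left_le[OF pmf_le_1 pmf_nonneg, of p n p n] by (simp add: power2_eq_square)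
qed

lemma square_summable_fluctuation:
  assumes "\<And>x. x \<ge> m \<Longrightarrow> q n \<omega> x = 0"
  shows "square_summable (fluctuation (pmf p) q n \<omega>)"
proof -
  have "square_summable (\<lambda>x. sqrt (real n) * q n \<omega> x + (- sqrt (real n)) * pmf p x)"
    using assms
    by (intro square_summable_add square_summable_scale square_summable_pmf square_summable_finite_support[of m])
  then show ?thesis by (simp add: fluctuation_def[abs_def] algebra_simps)
qed

lemma emp_nonneg: "0 \<le> emp X n \<omega> x"
  by (simp add: emp_def)

text \<open>For \<open>n = 0\<close> the maximum is that of an empty set and unspecified, but then
  no observation is counted anyway.\<close>

lemma emp_beyond_Max:
  assumes "x \<ge> Suc (Max ((\<lambda>i. X i \<omega>) ` {..<n}))"
  shows "emp X n \<omega> x = 0"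
proof -
  have "X i \<omega> \<noteq> x" if "i < n" for i
  proof -
    have "X i \<omega> \<le> Max ((\<lambda>i. X i \<omega>) ` {..<n})" using that by (intro Max_ge) auto
    then show ?thesis using assms by linarith
  qed
  then have "{i. i < n \<and> X i \<omega> = x} = {}" by blast
  then show ?thesis unfolding emp_def by (simp only: card.empty of_nat_0 div_0)
qed

lemma emp_vector_cong:
  assumes "\<And>i. i < n \<Longrightarrow> X i \<omega> = X i \<omega>'"
  shows "emp X n \<omega> = emp X n \<omega>'" "emp_vector X n \<omega> = emp_vector X n \<omega>'"
proof -
  have "{i. i < n \<and> X i \<omega> = x} = {i. i < n \<and> X i \<omega>' = x}" for x using assms by auto
  then show e: "emp X n \<omega> = emp X n \<omega>'" by (simp add: fun_eq_iff emp_def)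
  have "(\<lambda>i. X i \<omega>) ` {..<n} = (\<lambda>i. X i \<omega>') ` {..<n}" using assms by (intro image_cong) auto
  then show "emp_vector X n \<omega> = emp_vector X n \<omega>'" unfolding emp_vector_def e by (simp only:)
qed

context iid_sample
begin

lemma measurable_sample: "(\<lambda>\<omega>. map (\<lambda>i. X i \<omega>) [0..<n]) \<in> measurable M (count_space UNIV)"
proof (induction n)
  case (Suc n)
  have "(\<lambda>\<omega>. (map (\<lambda>i. X i \<omega>) [0..<n], X n \<omega>)) \<in> measurable M (count_space UNIV \<Otimes>\<^sub>M count_space UNIV)"
    by (rule measurable_Pair[OF Suc measurable_X])
  also have "count_space (UNIV :: nat list set) \<Otimes>\<^sub>M count_space (UNIV :: nat set) = count_space UNIV"
    by (subst pair_measure_countable) auto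
  finally have "(\<lambda>\<omega>. (\<lambda>(l, x). l @ [x]) (map (\<lambda>i. X i \<omega>) [0..<n], X n \<omega>)) \<in> measurable M (count_space UNIV)"
    by (rule measurable_compose) simp
  then show ?case by simp
qed simp

text \<open>The sample is a random list in a countable set with all subsets measurable. Whatever it
  determines is measurable, so no regularity of \<open>rear\<close> or \<open>gren\<close> has to be
  established.\<close>

lemma measurable_of_sample:
  fixes F :: "'a \<Rightarrow> 'c::topological_space"
  assumes "\<And>\<omega> \<omega>'. (\<And>i. i < n \<Longrightarrow> X i \<omega> = X i \<omega>') \<Longrightarrow> F \<omega> = F \<omega>'"
  shows "F \<in> borel_measurable M"
proof -
  let ?l = "\<lambda>\<omega>. map (\<lambda>i. X i \<omega>) [0..<n]"
  \<comment> \<open>Choosing a representative for each list of values exhibits \<open>F\<close> as a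
    function of that list.\<close>
  have "F \<omega> = F (SOME \<omega>'. ?l \<omega>' = ?l \<omega>)" for \<omega>
  proof (rule assms)
    fix i assume "i < n"
    have "?l (SOME \<omega>'. ?l \<omega>' = ?l \<omega>) = ?l \<omega>" by (rule someI[of "\<lambda>\<omega>'. ?l \<omega>' = ?l \<omega>" \<omega>]) (rule refl)
    then have "?l (SOME \<omega>'. ?l \<omega>' = ?l \<omega>) ! i = ?l \<omega> ! i" by (rule arg_cong)
    then show "X i \<omega> = X i (SOME \<omega>'. ?l \<omega>' = ?l \<omega>)" using \<open>i < n\<close> by simp
  qed
  then have "F = (\<lambda>\<omega>. (\<lambda>l. F (SOME \<omega>'. ?l \<omega>' = l)) (?l \<omega>))" by (rule ext)
  also have "\<dots> \<in> borel_measurable M" by (rule measurable_compose[OF measurable_sample]) simp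
  finally show ?thesis .
qed

definition empirical_process :: "nat \<Rightarrow> 'a \<Rightarrow> ell2" where
  "empirical_process n \<omega> = Abs_ell2 (fluctuation (pmf p) (emp X) n \<omega>)"

lemma Rep_empirical_process: "Rep_ell2 (empirical_process n \<omega>) x = fluctuation (pmf p) (emp X) n \<omega> x"
  unfolding empirical_process_def
  by (subst Rep_Abs_ell2) (auto intro: square_summable_fluctuation emp_beyond_Max)

lemma moment_bounded_empirical_process: "moment_bounded M (empirical_process n) (pmf p)"
  unfolding moment_bounded_def
proof (intro conjI allI)
  show "empirical_process n \<in> borel_measurable M"
  proof (rule measurable_of_sample[of n])
    fix \<omega> \<omega>' assume "\<And>i. i < n \<Longrightarrow> X i \<omega> = X i \<omega>'"
    then have "emp X n \<omega> = emp X n \<omega>'" by (rule emp_vector_cong(1))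
    then show "empirical_process n \<omega> = empirical_process n \<omega>'"
      by (simp only: empirical_process_def fluctuation_def[abs_def])
  qed
  fix x :: nat
  \<comment> \<open>Coordinate \<open>x\<close> as a linear combination of the first
    \<open>Suc x\<close> coordinates, so that the moments of \<open>score\<close> apply.\<close>
  let ?t = "\<lambda>y. if y = x then 1 else (0 :: real)"
  let ?S = "\<lambda>\<omega>. \<Sum>i<n. score (Suc x) ?t (X i \<omega>)"
  have "(\<Sum>y<Suc x. ?t y * F y) = F x" for F :: "nat \<Rightarrow> real"
    by (simp add: sum.neutral)
  then have "fluctuation (pmf p) (emp X) n \<omega> x = ?S \<omega> / sqrt (real n)" for \<omega>
    using linear_fluctuation_emp[where K = "Suc x" and t = ?t and n = n and \<omega> = \<omega>] by (simp only:)
  then have sq: "(Rep_ell2 (empirical_process n \<omega>) x)\<^sup>2 = (?S \<omega>)\<^sup>2 / real n" for \<omega>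
    by (simp add: Rep_empirical_process power_divide)
  note mom = second_moment_sum[OF score_bound[where K = "Suc x" and t = ?t] expectation_score(1), where n = n]
  show "integrable M (\<lambda>\<omega>. (Rep_ell2 (empirical_process n \<omega>) x)\<^sup>2)"
    unfolding sq using mom(1) by simp
  have "(\<integral>\<omega>. (Rep_ell2 (empirical_process n \<omega>) x)\<^sup>2 \<partial>M) = real n * (pmf p x - (pmf p x)\<^sup>2) / real n"
    unfolding sq using mom(2) by (simp add: expectation_score(2))
  \<comment> \<open>For \<open>n = 0\<close> the quotient is 0 because division by zero yields
    zero.\<close>
  also have "\<dots> \<le> pmf p x" by (cases "n = 0") simp_all
  finally show "(\<integral>\<omega>. (Rep_ell2 (empirical_process n \<omega>) x)\<^sup>2 \<partial>M) \<le> pmf p x" .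
qed

section \<open>From the empirical process to the estimators\<close>

lemma estimator_vs_block_map:
  assumes "isotonic_operator T" and dec: "decseq (pmf p)"
    and g: "lipschitz_on L UNIV g" "\<And>x. \<bar>g x\<bar> \<le> (B :: real)"
    and E: "\<And>n. E n \<in> borel_measurable M" "\<And>n \<omega> x. Rep_ell2 (E n \<omega>) x =
      fluctuation (pmf p) (\<lambda>n \<omega>. extend_by_zero (T (emp_vector X n \<omega>))) n \<omega> x"
  shows "(\<lambda>n. (\<integral>\<omega>. g (E n \<omega>) \<partial>M) - (\<integral>\<omega>. g (block_transform.block_map (pmf p) T (empirical_process n \<omega>)) \<partial>M)) \<longlonglongrightarrow> 0"
proof -
  interpret T: isotonic_operator T by fact
  interpret block_transform "pmf p" T
    by unfold_locales (rule dec, rule summable_LIMSEQ_zero[OF summable_pmf_nat])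
  let ?Z = empirical_process
  have L0: "0 \<le> L" using g(1) by (rule lipschitz_on_nonneg)
  have B0: "0 \<le> B" using g(2)[of 0] by linarith
  have Zm [measurable]: "?Z n \<in> borel_measurable M" for n
    using moment_bounded_empirical_process by (simp add: moment_bounded_def)
  note [measurable] = E(1)
  have [measurable]: "g \<in> borel_measurable borel" "block_map \<in> borel_measurable borel"
    by (rule borel_measurable_continuous_onI[OF lipschitz_on_continuous_on[OF g(1)]],
        rule borel_measurable_continuous_onI[OF lipschitz_on_continuous_on[OF lipschitz_block_map]])
  note tail = expectation_tail_sq[OF moment_bounded_empirical_process summable_pmf_nat]
  \<comment> \<open>Integrated form of \<open>estimator_test_function_bound\<close> with
    \<open>a = sqrt (real n)\<close>: the factor 8 is 2 times 4, and \<open>a\<^sup>2\<close>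
    supplies the \<open>real n\<close> in the denominator.\<close>
  have bound: "\<bar>(\<integral>\<omega>. g (E n \<omega>) \<partial>M) - (\<integral>\<omega>. g (block_map (?Z n \<omega>)) \<partial>M)\<bar>
      \<le> 2 * L * (\<eta> + (\<Sum>x. pmf p (x + K)) / \<eta>) + 8 * B / (real n * \<delta>\<^sup>2) * suminf (pmf p)"
    if n: "n > 0" and K: "cut K" and \<eta>: "\<eta> > 0"
      and \<delta>: "\<delta> > 0" "\<And>b. b \<le> K \<Longrightarrow> pmf p b < pmf p (b - 1) \<Longrightarrow> \<delta> \<le> pmf p (b - 1) - pmf p b"
    for n K \<eta> \<delta>
  proof -
    have "\<bar>(\<integral>\<omega>. g (E n \<omega>) \<partial>M) - (\<integral>\<omega>. g (block_map (?Z n \<omega>)) \<partial>M)\<bar>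
      \<le> (\<integral>\<omega>. 2 * L * (\<eta> + tail_sq K (?Z n \<omega>) / \<eta>) + 8 * B / (real n * \<delta>\<^sup>2) * tail_sq 0 (?Z n \<omega>) \<partial>M)"
    proof (rule abs_integral_diff_le)
      show "integrable M (\<lambda>\<omega>. g (E n \<omega>))" "integrable M (\<lambda>\<omega>. g (block_map (?Z n \<omega>)))"
        using g(2) by (auto intro!: integrable_const_bound[of _ B])
      show "integrable M (\<lambda>\<omega>. 2 * L * (\<eta> + tail_sq K (?Z n \<omega>) / \<eta>) + 8 * B / (real n * \<delta>\<^sup>2) * tail_sq 0 (?Z n \<omega>))"
        using tail(1) by simp
      show "AE \<omega> in M. \<bar>g (E n \<omega>) - g (block_map (?Z n \<omega>))\<bar>
          \<le> 2 * L * (\<eta> + tail_sq K (?Z n \<omega>) / \<eta>) + 8 * B / (real n * \<delta>\<^sup>2) * tail_sq 0 (?Z n \<omega>)"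
        using AE_X
      proof eventually_elim
        case (elim \<omega>)
        have null: "emp X n \<omega> x = 0" if "pmf p x = 0" for x
        proof -
          have "X i \<omega> \<noteq> x" for i using spec[OF elim, of i] that by auto
          then have "{i. i < n \<and> X i \<omega> = x} = {}" by blast
          then show ?thesis unfolding emp_def by (simp only: card.empty of_nat_0 div_0)
        qed
        have "\<bar>g (E n \<omega>) - g (block_map (?Z n \<omega>))\<bar>
          \<le> 2 * L * sqrt (tail_sq K (?Z n \<omega>)) + 2 * B * (4 * (norm (?Z n \<omega>))\<^sup>2 / (sqrt (real n) * \<delta>)\<^sup>2)"
        proof (rule estimator_test_function_bound[OF emp_nonneg emp_beyond_Max null _ K \<delta> _ _ g])
          show "Rep_ell2 (?Z n \<omega>) x = sqrt (real n) * (emp X n \<omega> x - pmf p x)" for x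
            by (simp add: Rep_empirical_process fluctuation_def)
          show "Rep_ell2 (E n \<omega>) x = sqrt (real n) *
              (extend_by_zero (T (map (emp X n \<omega>) [0..<Suc (Max ((\<lambda>i. X i \<omega>) ` {..<n}))])) x - pmf p x)" for x
            by (simp only: E(2) fluctuation_def emp_vector_def)
        qed (use n in simp_all)
        moreover have "2 * L * sqrt (tail_sq K (?Z n \<omega>)) \<le> 2 * L * (\<eta> + tail_sq K (?Z n \<omega>) / \<eta>)"
          using L0 \<eta> by (intro mult_left_mono sqrt_le_add_divide tail_sq_nonneg) auto
        moreover have "2 * B * (4 * (norm (?Z n \<omega>))\<^sup>2 / (sqrt (real n) * \<delta>)\<^sup>2) = 8 * B / (real n * \<delta>\<^sup>2) * tail_sq 0 (?Z n \<omega>)"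
          by (simp add: power_mult_distrib tail_sq_0)
        ultimately show ?case by linarith
      qed
    qed
    also have "\<dots> = 2 * L * (\<eta> + (\<integral>\<omega>. tail_sq K (?Z n \<omega>) \<partial>M) / \<eta>) + 8 * B / (real n * \<delta>\<^sup>2) * (\<integral>\<omega>. tail_sq 0 (?Z n \<omega>) \<partial>M)"
      using tail(1) by (simp add: prob_space)
    also have "\<dots> \<le> 2 * L * (\<eta> + (\<Sum>x. pmf p (x + K)) / \<eta>) + 8 * B / (real n * \<delta>\<^sup>2) * suminf (pmf p)"
      using tail(2)[of 0 n] tail(2)[of K n] L0 B0 \<eta>
      by (intro add_mono mult_left_mono divide_right_mono order_refl) auto
    finally show ?thesis .
  qed
  show ?thesis
  proof (rule LIMSEQ_I)
    fix e :: real assume e: "e > 0"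
    \<comment> \<open>Half of \<open>e\<close> is spent on the tail and fixes \<open>\<eta>\<close>
      and \<open>K\<close>. The gap \<open>\<delta>\<close> depends on \<open>K\<close> and may be
      tiny, so \<open>n\<close> is chosen last to spend the other half. \<open>L1\<close> is
      positive even if \<open>L = 0\<close>.\<close>
    define L1 where "L1 = L + 1"
    define \<eta> where "\<eta> = e / (8 * L1)"
    have L1: "L1 > 0" using L0 by (simp add: L1_def)
    have \<eta>: "\<eta> > 0" using e L1 by (simp add: \<eta>_def)
    have "L1 * \<eta> = e / 8" using L1 by (simp add: \<eta>_def)
    then have L\<eta>: "2 * L * (\<eta> + \<eta>) \<le> e / 2" using \<eta> by (simp add: L1_def algebra_simps)
    obtain K0 where K0: "\<And>K. K \<ge> K0 \<Longrightarrow> norm (\<Sum>x. pmf p (x + K)) < \<eta>\<^sup>2"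
      using suminf_exist_split[OF _ summable_pmf_nat, of "\<eta>\<^sup>2" p] \<eta> by auto
    obtain K where K: "K \<ge> K0" "cut K" using cuts_unbounded by blast
    obtain \<delta> where \<delta>: "\<delta> > 0" "\<And>b. b \<le> K \<Longrightarrow> pmf p b < pmf p (b - 1) \<Longrightarrow> \<delta> \<le> pmf p (b - 1) - pmf p b"
      by (rule gap_exists[of K]) (rule that)
    have "(\<Sum>x. pmf p (x + K)) / \<eta> \<le> \<eta>" using K0[OF K(1)] \<eta> by (simp add: field_simps power2_eq_square)
    then have "2 * L * (\<eta> + (\<Sum>x. pmf p (x + K)) / \<eta>) \<le> 2 * L * (\<eta> + \<eta>)" using L0 by (intro mult_left_mono) auto
    then have t1: "2 * L * (\<eta> + (\<Sum>x. pmf p (x + K)) / \<eta>) \<le> e / 2" using L\<eta> by linarith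
    define c where "c = 8 * B / \<delta>\<^sup>2 * suminf (pmf p)"
    obtain n0 :: nat where n0: "real n0 > 2 * c / e" using reals_Archimedean2 by blast
    have "norm ((\<integral>\<omega>. g (E n \<omega>) \<partial>M) - (\<integral>\<omega>. g (block_map (?Z n \<omega>)) \<partial>M) - 0) < e" if "n \<ge> Suc n0" for n
    proof -
      have "2 * c / e < real n" using n0 that by linarith
      then have "c / real n < e / 2" using e that by (simp add: field_simps)
      moreover have "8 * B / (real n * \<delta>\<^sup>2) * suminf (pmf p) = c / real n" by (simp add: c_def)
      moreover have "\<bar>(\<integral>\<omega>. g (E n \<omega>) \<partial>M) - (\<integral>\<omega>. g (block_map (?Z n \<omega>)) \<partial>M)\<bar>
          \<le> 2 * L * (\<eta> + (\<Sum>x. pmf p (x + K)) / \<eta>) + 8 * B / (real n * \<delta>\<^sup>2) * suminf (pmf p)"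
        using that by (intro bound K(2) \<eta> \<delta>) auto
      ultimately show ?thesis using t1 unfolding real_norm_def diff_0_right by linarith
    qed
    then show "\<exists>n0. \<forall>n\<ge>n0. norm ((\<integral>\<omega>. g (E n \<omega>) \<partial>M) - (\<integral>\<omega>. g (block_map (?Z n \<omega>)) \<partial>M) - 0) < e" by blast
  qed
qed

lemma estimator_weak_convergence:
  assumes T: "isotonic_operator T" and dec: "decseq (pmf p)"
    and N: "prob_space N" and Y: "random_element_ell2 N Y" and gp: "gaussian_process N Y"
    and mean: "\<And>x. (\<integral>\<omega>. Y \<omega> x \<partial>N) = 0"
    and cov: "\<And>x x'. covariance N (\<lambda>\<omega>. Y \<omega> x) (\<lambda>\<omega>. Y \<omega> x') =
           pmf p x * (if x = x' then 1 else 0) - pmf p x * pmf p x'"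
  shows "weakly_converges_ell2 M (fluctuation (pmf p) (\<lambda>n \<omega>. extend_by_zero (T (emp_vector X n \<omega>))))
           N (\<lambda>\<omega>. blockwise (pmf p) T (Y \<omega>))"
proof -
  interpret T: isotonic_operator T by fact
  interpret block_transform "pmf p" T
    by unfold_locales (rule dec, rule summable_LIMSEQ_zero[OF summable_pmf_nat])
  let ?F = "fluctuation (pmf p) (\<lambda>n \<omega>. extend_by_zero (T (emp_vector X n \<omega>)))"
  define E where "E n \<omega> = Abs_ell2 (?F n \<omega>)" for n \<omega>
  define W where "W \<omega> = Abs_ell2 (Y \<omega>)" for \<omega>
  have ssE: "square_summable (?F n \<omega>)" for n \<omega>
    by (rule square_summable_fluctuation[of "length (emp_vector X n \<omega>)"]) (simp add: extend_by_zero_def)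
  have Em: "E n \<in> borel_measurable M" for n
  proof (rule measurable_of_sample[of n])
    fix \<omega> \<omega>' assume "\<And>i. i < n \<Longrightarrow> X i \<omega> = X i \<omega>'"
    then have "emp_vector X n \<omega> = emp_vector X n \<omega>'" by (rule emp_vector_cong(2))
    then show "E n \<omega> = E n \<omega>'" by (simp only: E_def fluctuation_def[abs_def])
  qed
  have RE: "Rep_ell2 (E n \<omega>) x = ?F n \<omega> x" for n \<omega> x by (simp add: E_def Rep_Abs_ell2 ssE)
  have ssY: "\<omega> \<in> space N \<Longrightarrow> square_summable (Y \<omega>)" for \<omega>
    using Y by (simp add: random_element_ell2_def)
  have Wm: "W \<in> borel_measurable N"
    using Y by (simp add: random_element_ell2_def W_def[abs_def])
  \<comment> \<open>Square summability of \<open>Y\<close> is known on \<open>space N\<close> only,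
    so identities through \<open>Abs_ell2\<close> hold there and enter by congruence rules.\<close>
  have RW: "\<omega> \<in> space N \<Longrightarrow> Rep_ell2 (W \<omega>) = Y \<omega>" for \<omega> by (simp add: W_def Rep_Abs_ell2 ssY)
  have bW: "\<omega> \<in> space N \<Longrightarrow> Abs_ell2 (blockwise (pmf p) T (Y \<omega>)) = block_map (W \<omega>)" for \<omega>
    by (simp add: block_map_def RW)
  have bmm: "block_map \<in> borel_measurable borel"
    by (rule borel_measurable_continuous_onI[OF lipschitz_on_continuous_on[OF lipschitz_block_map]])
  have bWm: "(\<lambda>\<omega>. block_map (W \<omega>)) \<in> borel_measurable N" by (rule measurable_compose[OF Wm bmm])
  have bYm: "(\<lambda>\<omega>. Abs_ell2 (blockwise (pmf p) T (Y \<omega>))) \<in> borel_measurable N"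
    using bWm by (simp add: bW cong: measurable_cong)
  note gauss = gaussian_process_linear_combination[OF N gp mean cov]
  have mbW: "moment_bounded N W (pmf p)"
    unfolding moment_bounded_def
  proof (intro conjI allI Wm)
    fix x
    show "integrable N (\<lambda>\<omega>. (Rep_ell2 (W \<omega>) x)\<^sup>2)"
      using gauss(3)[of x] by (simp add: RW cong: Bochner_Integration.integrable_cong)
    have "(\<integral>\<omega>. (Rep_ell2 (W \<omega>) x)\<^sup>2 \<partial>N) = (\<integral>\<omega>. (Y \<omega> x)\<^sup>2 \<partial>N)"
      by (rule Bochner_Integration.integral_cong) (simp_all add: RW)
    then show "(\<integral>\<omega>. (Rep_ell2 (W \<omega>) x)\<^sup>2 \<partial>N) \<le> pmf p x" using gauss(4)[of x] by simp
  qed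
  have lin: "(\<lambda>n. \<integral>\<omega>. cos ((\<Sum>i<K. t i * Rep_ell2 (empirical_process n \<omega>) i) + a) \<partial>M)
      \<longlonglongrightarrow> (\<integral>\<omega>. cos ((\<Sum>i<K. t i * Rep_ell2 (W \<omega>) i) + a) \<partial>N)" for K t a
  proof -
    define \<sigma> where "\<sigma> = sqrt ((\<Sum>x<K. (t x)\<^sup>2 * pmf p x) - (\<Sum>x<K. t x * pmf p x)\<^sup>2)"
    have "0 \<le> (\<integral>\<omega>. (\<Sum>i<K. t i * Y \<omega> i)\<^sup>2 \<partial>N)" by (rule Bochner_Integration.integral_nonneg) simp
    then have \<sigma>: "(\<integral>\<omega>. (\<Sum>i<K. t i * Y \<omega> i)\<^sup>2 \<partial>N) = \<sigma>\<^sup>2" "0 \<le> \<sigma>"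
      unfolding gauss(2) \<sigma>_def by simp_all
    have "gaussian_rv N (\<lambda>\<omega>. \<Sum>i<K. t i * Y \<omega> i)"
      using gp by (simp add: gaussian_process_def)
    then have "(\<integral>\<omega>. cos ((\<Sum>i<K. t i * Y \<omega> i) + a) \<partial>N) = (\<integral>x. cos (\<sigma> * x + a) \<partial>std_normal_distribution)"
      by (rule prob_space.gaussian_rv_integral_cos[OF N _ gauss(1) \<sigma>])
    moreover have "(\<integral>\<omega>. cos ((\<Sum>i<K. t i * Rep_ell2 (W \<omega>) i) + a) \<partial>N) = (\<integral>\<omega>. cos ((\<Sum>i<K. t i * Y \<omega> i) + a) \<partial>N)"
      by (rule Bochner_Integration.integral_cong) (simp_all add: RW)
    ultimately show ?thesis
      using linear_combination_clt[OF \<sigma>_def, of a] by (simp only: Rep_empirical_process)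
  qed
  have lipconv: "(\<lambda>n. \<integral>\<omega>. g (E n \<omega>) \<partial>M) \<longlonglongrightarrow> (\<integral>\<omega>. g (Abs_ell2 (blockwise (pmf p) T (Y \<omega>))) \<partial>N)"
    if g: "lipschitz_on L UNIV g" "\<And>x. \<bar>g x\<bar> \<le> B" for g :: "ell2 \<Rightarrow> real" and L B
  proof -
    \<comment> \<open>Composition with the 1-Lipschitz \<open>block_map\<close> stays within
      Lipschitz test functions; this is the continuous mapping argument in the form needed
      here.\<close>
    have "lipschitz_on (L * 1) UNIV (\<lambda>f. g (block_map f))"
      by (rule lipschitz_on_compose2[OF lipschitz_block_map lipschitz_on_subset[OF g(1)]]) simp
    then have "(\<lambda>n. \<integral>\<omega>. g (block_map (empirical_process n \<omega>)) \<partial>M) \<longlonglongrightarrow> (\<integral>\<omega>. g (block_map (W \<omega>)) \<partial>N)"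
      by (rule ell2_lipschitz_convergence[OF prob_space_axioms N moment_bounded_empirical_process mbW summable_pmf_nat lin])
        (rule g(2))
    from tendsto_add[OF estimator_vs_block_map[OF T dec g Em RE] this]
    have "(\<lambda>n. \<integral>\<omega>. g (E n \<omega>) \<partial>M) \<longlonglongrightarrow> (\<integral>\<omega>. g (block_map (W \<omega>)) \<partial>N)" by simp
    moreover have "(\<integral>\<omega>. g (block_map (W \<omega>)) \<partial>N) = (\<integral>\<omega>. g (Abs_ell2 (blockwise (pmf p) T (Y \<omega>))) \<partial>N)"
      by (rule Bochner_Integration.integral_cong) (simp_all add: bW)
    ultimately show ?thesis by (simp only:)
  qed
  have "(\<lambda>n. \<integral>\<omega>. f (E n \<omega>) \<partial>M) \<longlonglongrightarrow> (\<integral>\<omega>. f (Abs_ell2 (blockwise (pmf p) T (Y \<omega>))) \<partial>N)"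
    if f: "continuous_on UNIV f" "bounded (range f)" for f :: "ell2 \<Rightarrow> real"
  proof -
    obtain B where B: "\<And>x. \<bar>f x\<bar> \<le> B" using f(2) by (auto simp: bounded_iff)
    show ?thesis by (rule tendsto_integral_of_lipschitz[OF prob_space_axioms N Em bYm lipconv f(1) B])
  qed
  then have "weakly_converges M E N (\<lambda>\<omega>. Abs_ell2 (blockwise (pmf p) T (Y \<omega>)))"
    unfolding weakly_converges_def using Em bYm by blast
  moreover have "(\<lambda>n \<omega>. Abs_ell2 (?F n \<omega>)) = E" by (simp add: E_def fun_eq_iff)
  moreover have "(\<lambda>\<omega>. Abs_ell2 (?F n \<omega>)) = E n" for n by (simp add: E_def fun_eq_iff)
  ultimately show ?thesis
    unfolding weakly_converges_ell2_def random_element_ell2_def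
    using ssE ssY Em bYm square_summable_blockwise by auto
qed

end

theorem theorem3p8:
  fixes p :: "nat pmf"
    and M :: "'a measure" and X :: "nat \<Rightarrow> 'a \<Rightarrow> nat"
    and N :: "'b measure" and Y :: "'b \<Rightarrow> nat \<Rightarrow> real"
  assumes "decseq (pmf p)"
    and "prob_space M"
    and "prob_space.indep_vars M (\<lambda>_. count_space UNIV) X UNIV"
    and "\<And>i. distr M (count_space UNIV) (X i) = measure_pmf p"
    and "prob_space N"
    and "random_element_ell2 N Y"
    and "gaussian_process N Y"
    and "\<And>x. (\<integral>\<omega>. Y \<omega> x \<partial>N) = 0"
    and "\<And>x x'. covariance N (\<lambda>\<omega>. Y \<omega> x) (\<lambda>\<omega>. Y \<omega> x') =
           pmf p x * (if x = x' then 1 else 0) - pmf p x * pmf p x'"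
  shows "weakly_converges_ell2 M (fluctuation (pmf p) (rear_estimator X))
           N (\<lambda>\<omega>. blockwise (pmf p) rear (Y \<omega>)) \<and>
         weakly_converges_ell2 M (fluctuation (pmf p) (gren_estimator X))
           N (\<lambda>\<omega>. blockwise (pmf p) gren (Y \<omega>))"
proof -
  interpret iid_sample M X p
    using assms(2-4) by (simp add: iid_sample_def iid_sample_axioms_def)
  note conv = estimator_weak_convergence[OF _ assms(1,5-9)]
  have "rear_estimator X = (\<lambda>n \<omega>. extend_by_zero (rear (emp_vector X n \<omega>)))"
    "gren_estimator X = (\<lambda>n \<omega>. extend_by_zero (gren (emp_vector X n \<omega>)))"
    by (simp_all add: fun_eq_iff rear_estimator_def gren_estimator_def)
  then show ?thesis
    using conv[OF rear.isotonic_operator_axioms] conv[OF gren.isotonic_operator_axioms] by simp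
qed

end
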